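(* Let $V$ be a smooth distribution of $k$-planes in $\mathbb{R}^n$ satisfying the Hörmander condition. Let $1<h\le k$ be the smallest positive integer for which $V$ is $h$-non-involutive. Let $m\ge h$, let $K$ be a compact subset of $\mathbb{R}^m$, and let $f$ be a Lipschitz map from $K$, endowed with the Euclidean distance, to the Carnot-Carathéodory space $(\mathbb{R}^n,d_V)$. Then $$\mathscr{H}^m_{d_V}(f(K))=0.$$
   Context: A $k$-dimensional distribution of planes in $\mathbb{R}^n$ is a map $V:\mathbb{R}^n\to\mathrm{Gr}(n,k)$; it is smooth (resp. of class $C^r$) if there are smooth (resp. $C^r$) vector fields $X_1,\dots,X_k$ on $\mathbb{R}^n$ with $V(x)=\mathrm{span}\{X_1(x),\dots,X_k(x)\}$ for every $x$. A vector field $Y$ is tangent to $V$ if $Y(x)\in V(x)$ for every $x$; a distribution $W$ is tangent to $V$ if $W(x)\subseteq V(x)$ for every $x$. These notions are also used locally. A $C^1$ distribution $W$ is non-involutive at $x$ if there are $C^1$ vector fields $X,X'$ tangent to $W$ with $[X,X'](x)\notin W(x)$. For $h\le k$, $V$ is $h$-non-involutive at $x$ if every $h$-dimensional distribution of class $C^1$ tangent to $V$ (defined near $x$) is non-involutive at $x$; $V$ is $h$-non-involutive if this holds at every $x\in\mathbb{R}^n$. In the theorem it is part of the assumptions that such an $h\le k$ exists. $V$ satisfies the Hörmander condition if for every $x\in\mathbb{R}^n$ there are a neighbourhood $U$ of $x$, an integer $N(x)$ and smooth vector fields $X_1,\dots,X_k$ spanning $V$ in $U$ such that the elementary commutators $[X_{i_1},[\dots,[X_{i_{N-1}},X_{i_N}]\dots]]$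 of length $N\le N(x)$ (including the $X_i$ themselves, $N=1$) span $\mathbb{R}^n$ at $x$. An absolutely continuous curve $\gamma:[0,1]\to\mathbb{R}^n$ is horizontal if $\gamma'(t)\in V(\gamma(t))$ for a.e. $t$. The Carnot-Carathéodory distance is $d_V(x,y):=\inf\{\ell(\gamma):\gamma\text{ horizontal},\ \gamma(0)=x,\ \gamma(1)=y\}$, where $\ell$ is Euclidean length; under the Hörmander condition it is a finite distance (Chow-Rashevskii). $\mathscr{H}^m_{d_V}$ is the $m$-dimensional Hausdorff measure with respect to $d_V$. *)

theory Defs
  imports "HOL-Analysis.Analysis" "HOL-Library.Extended_Nat"
begin

subsection \<open>Regularity of maps on open sets\<close>

text \<open>On an open set \<open>U\<close> the derivative \<open>at x\<close> at a point of \<open>U\<close> only depends on the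
  restriction of the map to \<open>U\<close>, so the following are the usual classes on \<open>U\<close>; the values
  outside \<open>U\<close> are irrelevant. Class \<open>r = \<infinity>\<close> means smooth.\<close>

primrec n_differentiable_on ::
  "nat \<Rightarrow> 'a::euclidean_space set \<Rightarrow> ('a \<Rightarrow> 'b::euclidean_space) \<Rightarrow> bool" where
  "n_differentiable_on 0 U f \<longleftrightarrow> continuous_on U f"
| "n_differentiable_on (Suc r) U f \<longleftrightarrow>
     (\<forall>x\<in>U. f differentiable (at x)) \<and>
     (\<forall>v. n_differentiable_on r U (\<lambda>x. frechet_derivative f (at x) v))"

definition class_C_on ::
  "enat \<Rightarrow> 'a::euclidean_space set \<Rightarrow> ('a \<Rightarrow> 'b::euclidean_space) \<Rightarrow> bool" where
  "class_C_on r U f \<longleftrightarrow> (\<forall>j::nat. enat j \<le> r \<longrightarrow> n_differentiable_on j U f)"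

subsection \<open>Distributions of planes\<close>

definition spans_on ::
  "'a::euclidean_space set \<Rightarrow> nat \<Rightarrow> (nat \<Rightarrow> 'a \<Rightarrow> 'a) \<Rightarrow> ('a \<Rightarrow> 'a set) \<Rightarrow> bool" where
  "spans_on U k X V \<longleftrightarrow> (\<forall>x\<in>U. V x = span ((\<lambda>i. X i x) ` {..<k}))"

definition distribution_on ::
  "enat \<Rightarrow> 'a::euclidean_space set \<Rightarrow> nat \<Rightarrow> ('a \<Rightarrow> 'a set) \<Rightarrow> bool" where
  "distribution_on r U k V \<longleftrightarrow>
     (\<forall>x\<in>U. subspace (V x) \<and> dim (V x) = k) \<and>
     (\<exists>X. (\<forall>i<k. class_C_on r U (X i)) \<and> spans_on U k X V)"

definition field_tangent_on ::
  "'a::euclidean_space set \<Rightarrow> ('a \<Rightarrow> 'a) \<Rightarrow> ('a \<Rightarrow> 'a set) \<Rightarrow> bool" where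
  "field_tangent_on U Y V \<longleftrightarrow> (\<forall>x\<in>U. Y x \<in> V x)"

definition distribution_tangent_on ::
  "'a::euclidean_space set \<Rightarrow> ('a \<Rightarrow> 'a set) \<Rightarrow> ('a \<Rightarrow> 'a set) \<Rightarrow> bool" where
  "distribution_tangent_on U W V \<longleftrightarrow> (\<forall>x\<in>U. W x \<subseteq> V x)"

definition lie_bracket ::
  "('a::euclidean_space \<Rightarrow> 'a) \<Rightarrow> ('a \<Rightarrow> 'a) \<Rightarrow> 'a \<Rightarrow> 'a" where
  "lie_bracket X Y x =
     frechet_derivative Y (at x) (X x) - frechet_derivative X (at x) (Y x)"

definition noninvolutive_at ::
  "'a::euclidean_space set \<Rightarrow> ('a \<Rightarrow> 'a set) \<Rightarrow> 'a \<Rightarrow> bool" where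
  "noninvolutive_at U W x \<longleftrightarrow>
     (\<exists>X Y. class_C_on 1 U X \<and> class_C_on 1 U Y \<and>
            field_tangent_on U X W \<and> field_tangent_on U Y W \<and>
            lie_bracket X Y x \<notin> W x)"

definition h_noninvolutive_at ::
  "nat \<Rightarrow> ('a::euclidean_space \<Rightarrow> 'a set) \<Rightarrow> 'a \<Rightarrow> bool" where
  "h_noninvolutive_at h V x \<longleftrightarrow>
     (\<forall>U W. open U \<and> x \<in> U \<and> distribution_on 1 U h W \<and> distribution_tangent_on U W V
        \<longrightarrow> noninvolutive_at U W x)"

definition h_noninvolutive :: "nat \<Rightarrow> ('a::euclidean_space \<Rightarrow> 'a set) \<Rightarrow> bool" where
  "h_noninvolutive h V \<longleftrightarrow> (\<forall>x. h_noninvolutive_at h V x)"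

text \<open>The list \<open>[i\<^sub>1, \<dots>, i\<^sub>N]\<close> encodes \<open>[X\<^bsub>i\<^sub>1\<^esub>, [\<dots>, [X\<^bsub>i\<^sub>N\<^sub>-\<^sub>1\<^esub>, X\<^bsub>i\<^sub>N\<^esub>] \<dots>]]\<close>;
  the value at the empty list is a dummy.\<close>

fun elementary_commutator ::
  "(nat \<Rightarrow> 'a::euclidean_space \<Rightarrow> 'a) \<Rightarrow> nat list \<Rightarrow> 'a \<Rightarrow> 'a" where
  "elementary_commutator X [] = (\<lambda>x. 0)"
| "elementary_commutator X [i] = X i"
| "elementary_commutator X (i # j # js) =
     lie_bracket (X i) (elementary_commutator X (j # js))"

definition hoermander :: "nat \<Rightarrow> ('a::euclidean_space \<Rightarrow> 'a set) \<Rightarrow> bool" where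
  "hoermander k V \<longleftrightarrow>
     (\<forall>x. \<exists>U N X. open U \<and> x \<in> U \<and>
        (\<forall>i<k. class_C_on \<infinity> U (X i)) \<and> spans_on U k X V \<and>
        span {elementary_commutator X js x | js.
                js \<noteq> [] \<and> set js \<subseteq> {..<k} \<and> length js \<le> N} = UNIV)"

subsection \<open>The Carnot-Caratheodory distance\<close>

text \<open>The members of a division of a subset of the line are compact intervals
  \<open>{Inf I..Sup I}\<close> with pairwise disjoint interiors.\<close>

definition abs_continuous_on :: "real set \<Rightarrow> (real \<Rightarrow> 'a::euclidean_space) \<Rightarrow> bool" where
  "abs_continuous_on S \<gamma> \<longleftrightarrow>
     (\<forall>\<epsilon>>0. \<exists>\<delta>>0. \<forall>D T. D division_of T \<and> T \<subseteq> S \<and> (\<Sum>I\<in>D. Sup I - Inf I) < \<delta>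
        \<longrightarrow> (\<Sum>I\<in>D. norm (\<gamma> (Sup I) - \<gamma> (Inf I))) < \<epsilon>)"

definition curve_length :: "(real \<Rightarrow> 'a::euclidean_space) \<Rightarrow> ennreal" where
  "curve_length \<gamma> =
     (SUP D \<in> {D. D division_of {0..1}}. ennreal (\<Sum>I\<in>D. norm (\<gamma> (Sup I) - \<gamma> (Inf I))))"

definition horizontal ::
  "('a::euclidean_space \<Rightarrow> 'a set) \<Rightarrow> (real \<Rightarrow> 'a) \<Rightarrow> bool" where
  "horizontal V \<gamma> \<longleftrightarrow>
     abs_continuous_on {0..1} \<gamma> \<and>
     (AE t in lebesgue. t \<in> {0..1} \<longrightarrow>
        (\<exists>v\<in>V (\<gamma> t). (\<gamma> has_vector_derivative v) (at t within {0..1})))"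

text \<open>As an infimum in \<open>[0,\<infinity>]\<close>, the distance is \<open>\<infinity>\<close> for points not joined by a
  horizontal curve.\<close>

definition cc_dist ::
  "('a::euclidean_space \<Rightarrow> 'a set) \<Rightarrow> 'a \<Rightarrow> 'a \<Rightarrow> ennreal" where
  "cc_dist V x y =
     (INF \<gamma> \<in> {\<gamma>. horizontal V \<gamma> \<and> \<gamma> 0 = x \<and> \<gamma> 1 = y}. curve_length \<gamma>)"

subsection \<open>Lipschitz maps and Hausdorff measure for \<open>[0,\<infinity>]\<close>-valued distances\<close>

definition lipschitz_wrt ::
  "('b \<Rightarrow> 'b \<Rightarrow> ennreal) \<Rightarrow> 'a::metric_space set \<Rightarrow> ('a \<Rightarrow> 'b) \<Rightarrow> bool" where
  "lipschitz_wrt d K f \<longleftrightarrow>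
     (\<exists>L\<ge>0. \<forall>x\<in>K. \<forall>y\<in>K. d (f x) (f y) \<le> ennreal (L * dist x y))"

definition diam_wrt :: "('b \<Rightarrow> 'b \<Rightarrow> ennreal) \<Rightarrow> 'b set \<Rightarrow> ennreal" where
  "diam_wrt d A = (SUP x\<in>A. SUP y\<in>A. d x y)"

text \<open>The empty set contributes \<open>0\<close> also when \<open>m = 0\<close>, whereas \<open>0 ^ 0 = 1\<close>.
  The normalising factor makes the measure agree with Lebesgue measure on Euclidean
  \<open>m\<close>-space.\<close>

definition hausdorff_pre ::
  "('b \<Rightarrow> 'b \<Rightarrow> ennreal) \<Rightarrow> nat \<Rightarrow> ennreal \<Rightarrow> 'b set \<Rightarrow> ennreal" where
  "hausdorff_pre d m \<delta> E =
     (INF A \<in> {A :: nat \<Rightarrow> 'b set. E \<subseteq> (\<Union>i. A i) \<and> (\<forall>i. diam_wrt d (A i) \<le> \<delta>)}.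
        \<Sum>i. if A i = {} then 0
            else ennreal (unit_ball_vol (real m) / 2 ^ m) * diam_wrt d (A i) ^ m)"

definition hausdorff_measure ::
  "('b \<Rightarrow> 'b \<Rightarrow> ennreal) \<Rightarrow> nat \<Rightarrow> 'b set \<Rightarrow> ennreal" where
  "hausdorff_measure d m E = (SUP \<delta> \<in> {0<..}. hausdorff_pre d m \<delta> E)"

end

theory Submission
  imports Defs
begin

lemma emeasure_UN_le_scaled:
  assumes C: "countable C" and A: "\<And>i. i \<in> C \<Longrightarrow> A i \<in> sets M" and s: "sets N = sets M"
    and d: "disjoint_family_on A C"
    and le: "\<And>i. i \<in> C \<Longrightarrow> emeasure N (A i) \<le> c * emeasure M (A i)"
  shows "emeasure N (\<Union>i\<in>C. A i) \<le> c * emeasure M (\<Union>i\<in>C. A i)"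
proof -
  have "emeasure N (\<Union>i\<in>C. A i) = (\<integral>\<^sup>+i. emeasure N (A i) \<partial>count_space C)"
    by (rule emeasure_UN_countable) (use A s d C in auto)
  also have "\<dots> \<le> (\<integral>\<^sup>+i. c * emeasure M (A i) \<partial>count_space C)"
    by (rule nn_integral_mono) (use le in auto)
  also have "\<dots> = c * (\<integral>\<^sup>+i. emeasure M (A i) \<partial>count_space C)"
    by (rule nn_integral_cmult) auto
  also have "\<dots> = c * emeasure M (\<Union>i\<in>C. A i)"
    by (subst emeasure_UN_countable) (use A d C in auto)
  finally show ?thesis .
qed

lemma Vitali_covering_intervals:
  fixes S :: "real set" and K :: "(real \<times> real) set"
  assumes K: "\<And>a b. (a, b) \<in> K \<Longrightarrow> a < b"
    and S: "\<And>t d. t \<in> S \<Longrightarrow> 0 < d \<Longrightarrow> \<exists>a b. (a, b) \<in> K \<and> t \<in> {a..b} \<and> b - a < d"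
  obtains C where "countable C" "C \<subseteq> K" "disjoint_family_on (\<lambda>i. {fst i..snd i}) C"
    "negligible (S - (\<Union>i\<in>C. {fst i..snd i}))"
proof -
  have cb: "cball ((fst i + snd i) / 2) ((snd i - fst i) / 2) = {fst i..snd i}" for i :: "real \<times> real"
    by (simp add: cball_eq_atLeastAtMost field_simps)
  obtain C where C: "countable C" "C \<subseteq> K"
     "pairwise (\<lambda>i j. disjnt (cball ((fst i + snd i) / 2) ((snd i - fst i) / 2)) (cball ((fst j + snd j) / 2) ((snd j - fst j) / 2))) C"
     "negligible(S - (\<Union>i \<in> C. cball ((fst i + snd i) / 2) ((snd i - fst i) / 2)))"
  proof (rule Vitali_covering_theorem_cballs[of K "\<lambda>i. (snd i - fst i) / 2" S "\<lambda>i. (fst i + snd i) / 2"])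
    fix t d :: real assume "t \<in> S" "0 < d"
    then obtain a b where "(a, b) \<in> K" "t \<in> {a..b}" "b - a < d" using S by blast
    then show "\<exists>i. i \<in> K \<and> t \<in> cball ((fst i + snd i) / 2) ((snd i - fst i) / 2) \<and> (snd i - fst i) / 2 < d"
      using K[of a b] cb[of "(a, b)"] by (intro exI[of _ "(a, b)"]) auto
  qed (use K in auto)
  show ?thesis
    by (rule that[OF C(1,2)]) (use C(3,4) in \<open>auto simp: cb disjoint_family_on_def pairwise_def disjnt_def\<close>)
qed

lemma negligible_slope_gap:
  fixes g :: "real \<Rightarrow> real"
  assumes mono: "mono g" and cont: "continuous_on UNIV g" and pq: "p < q" and bS: "bounded S"
    and lo: "\<And>t d. t \<in> S \<Longrightarrow> 0 < d \<Longrightarrow> \<exists>a b. a < b \<and> t \<in> {a..b} \<and> b - a < d \<and> g b - g a < p * (b - a)"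
    and hi: "\<And>t d. t \<in> S \<Longrightarrow> 0 < d \<Longrightarrow> \<exists>a b. a < b \<and> t \<in> {a..b} \<and> b - a < d \<and> q * (b - a) < g b - g a"
  shows "negligible S"
proof (cases "S = {}")
  case False
  then obtain t where "t \<in> S" by auto
  from lo[OF this zero_less_one] obtain a b where ab: "a < b" "g b - g a < p * (b - a)" by blast
  moreover have "g a \<le> g b" using mono ab by (simp add: monoD)
  ultimately have "0 < p * (b - a)" by linarith
  then have p: "0 < p" using ab by (simp add: zero_less_mult_iff)
  then have q: "0 < q" using pq by linarith
  define \<nu> where "\<nu> = interval_measure g"
  have sets_nu: "sets \<nu> = sets borel" by (simp add: \<nu>_def)
  have nu: "emeasure \<nu> {a..b} = ennreal (g b - g a)" if "a \<le> b" for a b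
    unfolding \<nu>_def using that mono cont by (intro emeasure_interval_measure_Icc) (auto simp: monoD)
  obtain E where E: "E \<in> sets lebesgue" "S \<subseteq> E" "outer_measure_of lebesgue S = emeasure lebesgue E"
    using outer_measure_of_attain[of S lebesgue] by auto
  obtain B where B: "S \<subseteq> cbox (-B) B" using bS by (metis bounded_subset_cbox_symmetric)
  have "emeasure lebesgue E \<le> emeasure lebesgue (cbox (-B) B)"
    unfolding E(3)[symmetric] using outer_measure_of_mono[OF B, of lebesgue] by simp
  also have "\<dots> < \<infinity>" using emeasure_lborel_cbox_finite[of "-B" B] by simp
  finally obtain u where u: "emeasure lebesgue E = ennreal u" "0 \<le> u"
    by (metis ennreal_cases infinity_ennreal_def less_irrefl)
  have hull: "emeasure lebesgue E \<le> emeasure lborel A" if "A \<in> sets borel" "negligible (S - A)" for A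
  proof -
    have N: "S - A \<in> null_sets lebesgue" using that(2) by (simp add: negligible_iff_null_sets)
    have "outer_measure_of lebesgue S \<le> outer_measure_of lebesgue (A \<union> (S - A))"
      by (rule outer_measure_of_mono) auto
    also have "\<dots> = emeasure lebesgue (A \<union> (S - A))"
      using that N by (intro outer_measure_of_eq sets.Un) auto
    also have "\<dots> = emeasure lborel A"
      using that N by (subst emeasure_Un_null_set) auto
    finally show ?thesis using E(3) by simp
  qed
  have main: "q * u \<le> p * (u + e)" if e: "0 < e" for e
  proof -
    obtain T where T: "open T" "E \<subseteq> T" "T - E \<in> lmeasurable" "emeasure lebesgue (T - E) < ennreal e"
      using sets_lebesgue_outer_open[OF E(1) e] by blast
    have "emeasure lebesgue T = emeasure lebesgue E + emeasure lebesgue (T - E)"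
      using T E(1) by (subst plus_emeasure) (auto simp: Un_absorb1 fmeasurable_def)
    also have "\<dots> \<le> ennreal (u + e)" using T(4) u e by (simp add: ennreal_plus less_imp_le add_left_mono)
    finally have eT: "emeasure lborel T \<le> ennreal (u + e)" using T(1) by (simp add: emeasure_completion)
    define K where "K = {(a, b). a < b \<and> {a..b} \<subseteq> T \<and> g b - g a < p * (b - a)}"
    obtain C where C: "countable C" "C \<subseteq> K" "disjoint_family_on (\<lambda>i. {fst i..snd i}) C"
      "negligible (S - (\<Union>i\<in>C. {fst i..snd i}))"
    proof (rule Vitali_covering_intervals[of K S])
      fix t d :: real assume t: "t \<in> S" "0 < d"
      then obtain d' where d': "d' > 0" "ball t d' \<subseteq> T"
        using T(1,2) E(2) open_contains_ball by blast
      from lo[OF t(1), of "min d d'"] obtain a b where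
        *: "a < b" "t \<in> {a..b}" "b - a < min d d'" "g b - g a < p * (b - a)" using t d' by auto
      have "{a..b} \<subseteq> ball t d'" using * by (auto simp: dist_real_def)
      then show "\<exists>a b. (a, b) \<in> K \<and> t \<in> {a..b} \<and> b - a < d" using * d' K_def by auto
    qed (auto simp: K_def)
    define U where "U = (\<Union>i\<in>C. {fst i..snd i})"
    have U: "U \<in> sets borel" unfolding U_def using C(1) by auto
    have "emeasure \<nu> U \<le> ennreal p * emeasure lborel U" unfolding U_def
    proof (rule emeasure_UN_le_scaled[OF C(1) _ _ C(3)])
      fix i assume "i \<in> C"
      then have i: "fst i < snd i" "g (snd i) - g (fst i) < p * (snd i - fst i)"
        using C(2) by (auto simp: K_def)
      then show "emeasure \<nu> {fst i..snd i} \<le> ennreal p * emeasure lborel {fst i..snd i}"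
        using p by (simp add: nu ennreal_mult''[symmetric])
    qed (auto simp: sets_nu)
    also have "emeasure lborel U \<le> emeasure lborel T"
    proof (rule emeasure_mono)
      show "U \<subseteq> T"
      proof
        fix t assume "t \<in> U"
        then obtain i where "i \<in> C" "t \<in> {fst i..snd i}" by (auto simp: U_def)
        then have "i \<in> K" "t \<in> {fst i..snd i}" using C(2) by auto
        then show "t \<in> T" unfolding K_def by auto
      qed
    qed (use T(1) in auto)
    then have "ennreal p * emeasure lborel U \<le> ennreal p * ennreal (u + e)"
      using eT by (intro mult_left_mono) auto
    finally have nuU: "emeasure \<nu> U \<le> ennreal p * ennreal (u + e)" .
    define S' where "S' = S \<inter> (\<Union>i\<in>C. {fst i<..<snd i})"
    have "S - S' \<subseteq> (S - U) \<union> (fst ` C \<union> snd ` C)"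
    proof
      fix t assume t: "t \<in> S - S'"
      show "t \<in> (S - U) \<union> (fst ` C \<union> snd ` C)"
      proof (rule ccontr)
        assume c: "t \<notin> (S - U) \<union> (fst ` C \<union> snd ` C)"
        then obtain i where i: "i \<in> C" "fst i \<le> t" "t \<le> snd i" using t by (auto simp: U_def)
        moreover have "t \<noteq> fst i" "t \<noteq> snd i" using c i(1) by auto
        ultimately show False using t by (auto simp: S'_def)
      qed
    qed
    moreover have "negligible (fst ` C \<union> snd ` C)" using C(1) by (simp add: negligible_iff_null_sets null_sets_completionI countable_imp_null_set_lborel)
    ultimately have nS: "negligible (S - S')"
      using C(4) by (metis U_def negligible_Un negligible_subset)
    define K' where "K' = {(a, b). a < b \<and> (\<exists>i\<in>C. {a..b} \<subseteq> {fst i<..<snd i}) \<and> q * (b - a) < g b - g a}"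
    obtain C' where C': "countable C'" "C' \<subseteq> K'" "disjoint_family_on (\<lambda>i. {fst i..snd i}) C'"
      "negligible (S' - (\<Union>i\<in>C'. {fst i..snd i}))"
    proof (rule Vitali_covering_intervals[of K' S'])
      fix t d :: real assume t: "t \<in> S'" "0 < d"
      then obtain i where i: "i \<in> C" "t \<in> {fst i<..<snd i}" by (auto simp: S'_def)
      then obtain d' where d': "d' > 0" "ball t d' \<subseteq> {fst i<..<snd i}"
        by (metis open_contains_ball open_greaterThanLessThan)
      from hi[of t "min d d'"] obtain a b where
        *: "a < b" "t \<in> {a..b}" "b - a < min d d'" "q * (b - a) < g b - g a" using t d' S'_def by auto
      have "{a..b} \<subseteq> ball t d'" using * by (auto simp: dist_real_def)
      then have "(a, b) \<in> K'" using * d' i by (auto simp: K'_def intro!: bexI[of _ i])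
      then show "\<exists>a b. (a, b) \<in> K' \<and> t \<in> {a..b} \<and> b - a < d" using * by auto
    qed (auto simp: K'_def)
    define U' where "U' = (\<Union>i\<in>C'. {fst i..snd i})"
    have U': "U' \<in> sets borel" unfolding U'_def using C'(1) by auto
    have U'U: "U' \<subseteq> U"
    proof
      fix t assume "t \<in> U'"
      then obtain j where j: "j \<in> C'" "t \<in> {fst j..snd j}" by (auto simp: U'_def)
      then obtain i where "i \<in> C" "{fst j..snd j} \<subseteq> {fst i<..<snd i}" using C'(2) by (auto simp: K'_def)
      then have "t \<in> {fst i..snd i}" using j by (meson greaterThanLessThan_subseteq_atLeastAtMost_iff order_refl subsetD)
      then show "t \<in> U" using \<open>i \<in> C\<close> by (auto simp: U_def)
    qed
    have "S - U' \<subseteq> (S - S') \<union> (S' - U')" by auto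
    then have "negligible (S - U')" using nS C'(4) U'_def by (metis negligible_Un negligible_subset)
    then have "ennreal u \<le> emeasure lborel U'" using hull[OF U'] u by simp
    also have "\<dots> \<le> ennreal (1/q) * emeasure \<nu> U'" unfolding U'_def
    proof (rule emeasure_UN_le_scaled[OF C'(1) _ _ C'(3)])
      fix i assume "i \<in> C'"
      then have i: "fst i < snd i" "q * (snd i - fst i) < g (snd i) - g (fst i)"
        using C'(2) by (auto simp: K'_def)
      then have "snd i - fst i \<le> 1 / q * (g (snd i) - g (fst i))" using q by (simp add: field_simps)
      then show "emeasure lborel {fst i..snd i} \<le> ennreal (1/q) * emeasure \<nu> {fst i..snd i}"
        using i q by (simp add: nu ennreal_mult'[symmetric] del: ennreal_1)
    qed (auto simp: sets_nu)
    also have "\<dots> \<le> ennreal (1/q) * (ennreal p * ennreal (u + e))"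
      using U U'U sets_nu by (intro mult_left_mono order_trans[OF emeasure_mono nuU]) auto
    also have "\<dots> = ennreal (1/q * (p * (u + e)))" using p q u e by (simp add: ennreal_mult'[symmetric] del: ennreal_plus)
    finally have "u \<le> 1/q * (p * (u + e))"
      using p q u e by (subst (asm) ennreal_le_iff) auto
    then show ?thesis using q by (simp add: field_simps)
  qed
  have "q * u \<le> p * u"
  proof (rule field_le_epsilon)
    fix e :: real assume "0 < e"
    then have "q * u \<le> p * (u + e / p)" using main[of "e / p"] p by simp
    also have "\<dots> = p * u + e" using p by (simp add: distrib_left)
    finally show "q * u \<le> p * u + e" .
  qed
  then have "u = 0" using pq u by (metis mult_le_cancel_right not_less order.order_iff_strict)
  then have "E \<in> null_sets lebesgue" using E u by auto
  then show ?thesis using E(2) by (metis negligible_iff_null_sets negligible_subset)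
qed auto

lemma negligible_nondifferentiable_mono:
  fixes g :: "real \<Rightarrow> real"
  assumes mono: "mono g" and lip: "\<And>s t. \<bar>g s - g t\<bar> \<le> L * \<bar>s - t\<bar>"
  shows "negligible {t. \<not> g differentiable (at t)}"
proof -
  have cont: "continuous_on UNIV g"
    by (rule lipschitz_on_continuous_on[of "\<bar>L\<bar>"])
       (auto simp: lipschitz_on_def dist_real_def intro!: order_trans[OF lip] mult_right_mono)
  define S where "S = (\<lambda>(n::nat, p::rat, q::rat). if p < q then {t \<in> {-real n..real n}.
      (\<forall>d>0. \<exists>a b. a < b \<and> t \<in> {a..b} \<and> b - a < d \<and> g b - g a < of_rat p * (b - a)) \<and>
      (\<forall>d>0. \<exists>a b. a < b \<and> t \<in> {a..b} \<and> b - a < d \<and> of_rat q * (b - a) < g b - g a)} else {})"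
  have "negligible (S i)" for i
  proof -
    obtain n p q where i: "i = (n, p, q)" by (cases i)
    show ?thesis
    proof (cases "p < q")
      case True
      then show ?thesis unfolding i S_def
        by (simp, intro negligible_slope_gap[OF mono cont, of "of_rat p" "of_rat q"])
           (auto intro: bounded_subset[of "{-real n..real n}"] simp: of_rat_less)
    qed (auto simp: i S_def)
  qed
  then have "negligible (\<Union>i. S i)" by (intro negligible_countable_Union[of "range S", simplified]) auto
  moreover have "{t. \<not> g differentiable (at t)} \<subseteq> (\<Union>i. S i)"
  proof (rule ccontr)
    assume "\<not> ?thesis"
    then obtain t where nd: "\<not> g differentiable (at t)" and nS: "\<And>i. t \<notin> S i" by auto
    define P where "P p d \<longleftrightarrow> (\<forall>a b. a < b \<longrightarrow> t \<in> {a..b} \<longrightarrow> b - a < d \<longrightarrow> p * (b - a) \<le> g b - g a)" for p d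
    define Q where "Q q d \<longleftrightarrow> (\<forall>a b. a < b \<longrightarrow> t \<in> {a..b} \<longrightarrow> b - a < d \<longrightarrow> g b - g a \<le> q * (b - a))" for q d
    have PQ: "(\<exists>d>0. P (of_rat p) d) \<or> (\<exists>d>0. Q (of_rat q) d)" if "p < q" for p q :: rat
    proof -
      obtain n :: nat where "\<bar>t\<bar> \<le> real n" using real_arch_simple by blast
      then have "t \<in> {-real n..real n}" by auto
      with nS[of "(n, p, q)"] that
      have "\<not> ((\<forall>d>0. \<exists>a b. a < b \<and> t \<in> {a..b} \<and> b - a < d \<and> g b - g a < of_rat p * (b - a)) \<and>
          (\<forall>d>0. \<exists>a b. a < b \<and> t \<in> {a..b} \<and> b - a < d \<and> of_rat q * (b - a) < g b - g a))"
        unfolding S_def by simp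
      then show ?thesis unfolding P_def Q_def by (meson not_less)
    qed
    define A where "A = {p. \<exists>d>0. P p d}"
    have "P 0 1" using mono by (auto simp: P_def monoD)
    then have A0: "0 \<in> A" unfolding A_def using zero_less_one by blast
    have AL: "p \<le> L" if pA: "p \<in> A" for p
    proof -
      obtain d where "d > 0" "P p d" using pA by (auto simp: A_def)
      then have "p * ((t + d/2) - t) \<le> g (t + d/2) - g t"
        unfolding P_def by (elim allE[of _ t] allE[of _ "t + d/2"]) auto
      then have "p * (d/2) \<le> g (t + d/2) - g t" by simp
      also have "\<dots> \<le> L * (d/2)" using abs_le_D1[OF lip[of "t + d/2" t]] \<open>d > 0\<close> by simp
      finally show ?thesis using \<open>d > 0\<close> by simp
    qed
    define D where "D = Sup A"
    have bA: "bdd_above A" using AL by (auto simp: bdd_above_def)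
    have lower: "\<exists>d>0. P p d" if pD: "p < D" for p
    proof -
      obtain p' where "p' \<in> A" "p < p'" using pD less_cSupE[of p A] A0 unfolding D_def by blast
      then obtain d where d: "d > 0" "P p' d" by (auto simp: A_def)
      have "P p d" unfolding P_def
      proof (intro allI impI)
        fix a b assume ab: "a < b" "t \<in> {a..b}" "b - a < d"
        have "p * (b - a) \<le> p' * (b - a)" using ab \<open>p < p'\<close> by (intro mult_right_mono) auto
        also have "\<dots> \<le> g b - g a" using d ab by (auto simp: P_def)
        finally show "p * (b - a) \<le> g b - g a" .
      qed
      then show ?thesis using d by blast
    qed
    have upper: "\<exists>d>0. Q q d" if Dq: "D < q" for q
    proof -
      obtain q' where q': "D < of_rat q'" "of_rat q' < q" using of_rat_dense[OF Dq] by blast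
      obtain p where p: "D < of_rat p" "of_rat p < (of_rat q' :: real)" using of_rat_dense[OF q'(1)] by blast
      have "of_rat p \<notin> A" using cSup_upper[OF _ bA] p(1) unfolding D_def by force
      then obtain d where d: "d > 0" "Q (of_rat q') d" using PQ[of p q'] p(2) by (auto simp: A_def of_rat_less)
      have "Q q d" unfolding Q_def
      proof (intro allI impI)
        fix a b assume ab: "a < b" "t \<in> {a..b}" "b - a < d"
        have "g b - g a \<le> of_rat q' * (b - a)" using d ab by (auto simp: Q_def)
        also have "\<dots> \<le> q * (b - a)" using ab q' by (intro mult_right_mono) auto
        finally show "g b - g a \<le> q * (b - a)" .
      qed
      then show ?thesis using d by blast
    qed
    have "((\<lambda>s. (g s - g t) / (s - t)) \<longlongrightarrow> D) (at t)"
    proof (rule LIM_I)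
      fix r :: real assume r: "0 < r"
      obtain d1 where d1: "d1 > 0" "P (D - r/2) d1" using lower[of "D - r/2"] r by auto
      obtain d2 where d2: "d2 > 0" "Q (D + r/2) d2" using upper[of "D + r/2"] r by auto
      have "norm ((g s - g t) / (s - t) - D) < r" if s: "s \<noteq> t" "norm (s - t) < min d1 d2" for s
      proof -
        have sym: "(g s - g t) / (s - t) = (g (max s t) - g (min s t)) / (max s t - min s t)"
          using s by (auto simp: max_def min_def field_simps divide_simps)
        have ms: "min s t < max s t" "t \<in> {min s t..max s t}" "max s t - min s t < d1" "max s t - min s t < d2"
          using s by auto
        have "(D - r/2) * (max s t - min s t) \<le> g (max s t) - g (min s t)" using d1 ms by (auto simp: P_def)
        moreover have "g (max s t) - g (min s t) \<le> (D + r/2) * (max s t - min s t)" using d2 ms by (auto simp: Q_def)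
        ultimately have "D - r/2 \<le> (g s - g t) / (s - t)" "(g s - g t) / (s - t) \<le> D + r/2"
          unfolding sym using ms(1) by (simp_all add: pos_le_divide_eq pos_divide_le_eq)
        then show ?thesis using r by (auto simp: abs_if)
      qed
      then show "\<exists>s>0. \<forall>x. x \<noteq> t \<and> norm (x - t) < s \<longrightarrow> norm ((g x - g t) / (x - t) - D) < r"
        using d1 d2 by (intro exI[of _ "min d1 d2"]) auto
    qed
    then have "(g has_field_derivative D) (at t)" by (simp add: has_field_derivative_iff)
    then show False using nd real_differentiable_def by blast
  qed
  ultimately show ?thesis by (rule negligible_subset)
qed

theorem negligible_nondifferentiable_lipschitz:
  fixes G :: "real \<Rightarrow> 'b::euclidean_space"
  assumes lip: "\<And>s t. norm (G s - G t) \<le> L * \<bar>s - t\<bar>"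
  shows "negligible {t. \<not> G differentiable (at t)}"
proof -
  have L: "0 \<le> L" using order_trans[OF norm_ge_zero lip[of 1 0]] by simp
  have comp: "negligible {t. \<not> (\<lambda>t. G t \<bullet> b) differentiable (at t)}" if b: "b \<in> Basis" for b
  proof -
    define g where "g t = G t \<bullet> b + L * t" for t
    have l: "\<bar>G s \<bullet> b - G t \<bullet> b\<bar> \<le> L * \<bar>s - t\<bar>" for s t
      using order_trans[OF Basis_le_norm[OF b, of "G s - G t"] lip] by (simp add: inner_diff_left)
    have "mono g"
    proof (rule monoI)
      fix s t :: real assume "s \<le> t"
      then show "g s \<le> g t" using l[of s t] by (auto simp: g_def algebra_simps abs_if split: if_splits)
    qed
    moreover have "\<bar>g s - g t\<bar> \<le> (2 * L) * \<bar>s - t\<bar>" for s t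
    proof -
      have "\<bar>g s - g t\<bar> \<le> \<bar>G s \<bullet> b - G t \<bullet> b\<bar> + \<bar>L * (s - t)\<bar>" by (simp add: g_def algebra_simps)
      also have "\<dots> \<le> (2 * L) * \<bar>s - t\<bar>" using l[of s t] L by (simp add: abs_mult)
      finally show ?thesis .
    qed
    ultimately have "negligible {t. \<not> g differentiable (at t)}" by (rule negligible_nondifferentiable_mono)
    moreover have "(\<lambda>t. G t \<bullet> b) differentiable (at t)" if "g differentiable (at t)" for t
    proof -
      have "(\<lambda>t. g t - L * t) differentiable (at t)" using that by (intro derivative_intros) auto
      then show ?thesis by (simp add: g_def)
    qed
    ultimately show ?thesis by (elim negligible_subset) auto
  qed
  have "{t. \<not> G differentiable (at t)} = (\<Union>b\<in>Basis. {t. \<not> (\<lambda>t. G t \<bullet> b) differentiable (at t)})"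
    using differentiable_componentwise_within[of G _ UNIV] by auto
  also have "negligible \<dots>" using comp by (intro negligible_Union) auto
  finally show ?thesis .
qed

lemma span_image_sum:
  fixes X :: "nat \<Rightarrow> 'b::real_vector"
  assumes "w \<in> span (X ` {..<k})"
  obtains c where "w = (\<Sum>i<k. c i *\<^sub>R X i)"
proof -
  let ?S = "range (\<lambda>c. \<Sum>i<k. c i *\<^sub>R X i)"
  have "span (X ` {..<k}) \<subseteq> ?S"
  proof (rule span_minimal)
    show "X ` {..<k} \<subseteq> ?S"
    proof clarify
      fix j assume "j < k"
      then have "X j = (\<Sum>i<k. (if i = j then 1 else 0) *\<^sub>R X i)"
        by (simp add: if_distrib[of "\<lambda>c. c *\<^sub>R _"] cong: if_cong)
      then show "X j \<in> ?S" by (rule range_eqI[of _ _ "\<lambda>i. if i = j then 1 else 0"])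
    qed
    show "subspace ?S"
    proof (rule subspaceI)
      show "0 \<in> ?S" by (rule range_eqI[of _ _ "\<lambda>_. 0"]) simp
    next
      fix x y assume "x \<in> ?S" "y \<in> ?S"
      then obtain c d where "x = (\<Sum>i<k. c i *\<^sub>R X i)" "y = (\<Sum>i<k. d i *\<^sub>R X i)" by auto
      then have "x + y = (\<Sum>i<k. (c i + d i) *\<^sub>R X i)" by (simp add: sum.distrib scaleR_add_left)
      then show "x + y \<in> ?S" by (rule range_eqI[of _ _ "\<lambda>i. c i + d i"])
    next
      fix r :: real and x assume "x \<in> ?S"
      then obtain c where "x = (\<Sum>i<k. c i *\<^sub>R X i)" by auto
      then have "r *\<^sub>R x = (\<Sum>i<k. (r * c i) *\<^sub>R X i)" by (simp add: scaleR_sum_right)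
      then show "r *\<^sub>R x \<in> ?S" by (rule range_eqI[of _ _ "\<lambda>i. r * c i"])
    qed
  qed
  then show ?thesis using assms that by blast
qed

definition dual_family :: "nat \<Rightarrow> (nat \<Rightarrow> 'b::real_inner) \<Rightarrow> (nat \<Rightarrow> 'b) \<Rightarrow> bool" where
  "dual_family k z X \<longleftrightarrow> (\<forall>i<k. \<forall>j<k. z i \<bullet> X j = (if i = j then 1 else 0))"

lemma dual_family_sum:
  assumes "dual_family k z X" "i < k"
  shows "z i \<bullet> (\<Sum>j<k. c j *\<^sub>R X j) = c i"
proof -
  have "z i \<bullet> (\<Sum>j<k. c j *\<^sub>R X j) = (\<Sum>j<k. c j * (if i = j then 1 else 0))"
    unfolding inner_sum_right using assms by (intro sum.cong) (auto simp: dual_family_def)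
  then show ?thesis using assms(2) by (simp add: if_distrib cong: if_cong)
qed

lemma dual_family_expand:
  assumes "dual_family k z X" "w \<in> span (X ` {..<k})"
  shows "w = (\<Sum>i<k. (z i \<bullet> w) *\<^sub>R X i)"
proof -
  obtain c where c: "w = (\<Sum>i<k. c i *\<^sub>R X i)" using span_image_sum[OF assms(2)] .
  then have "z i \<bullet> w = c i" if "i < k" for i using dual_family_sum[OF assms(1) that] by simp
  then show ?thesis using c by simp
qed

lemma independent_imp_dual_family:
  fixes X :: "nat \<Rightarrow> 'b::euclidean_space"
  assumes ind: "independent (X ` {..<k})" and inj: "inj_on X {..<k}"
  obtains z where "dual_family k z X"
proof -
  have "\<exists>v. \<forall>j<k. v \<bullet> X j = (if i = j then 1 else 0)" if "i < k" for i
  proof -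
    obtain \<phi> :: "'b \<Rightarrow> real" where \<phi>: "linear \<phi>" "\<And>x. x \<in> X ` {..<k} \<Longrightarrow> \<phi> x = (if x = X i then 1 else 0)"
      using linear_independent_extend[OF ind, of "\<lambda>x. if x = X i then 1 else 0"] by blast
    have "adjoint \<phi> 1 \<bullet> X j = (if i = j then 1 else 0)" if "j < k" for j
    proof -
      have "adjoint \<phi> 1 \<bullet> X j = \<phi> (X j)" using adjoint_works[OF \<phi>(1), of "X j" 1] by (simp add: inner_commute)
      also have "\<dots> = (if i = j then 1 else 0)" using \<phi>(2)[of "X j"] inj \<open>i < k\<close> that by (auto simp: inj_on_def)
      finally show ?thesis .
    qed
    then show ?thesis by blast
  qed
  then obtain z where "\<And>i j. i < k \<Longrightarrow> j < k \<Longrightarrow> z i \<bullet> X j = (if i = j then 1 else 0)" by metis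
  then show ?thesis using that[of z] by (auto simp: dual_family_def)
qed

lemma dim_span_imp_dual_family:
  fixes X :: "nat \<Rightarrow> 'b::euclidean_space"
  assumes d: "dim (span (X ` {..<k})) = k"
  obtains z where "dual_family k z X"
proof -
  have card: "card (X ` {..<k}) = k"
  proof (rule antisym)
    show "card (X ` {..<k}) \<le> k" using card_image_le[of "{..<k}" X] by simp
    show "k \<le> card (X ` {..<k})" using dim_le_card'[of "X ` {..<k}"] d by simp
  qed
  then have inj: "inj_on X {..<k}" by (intro eq_card_imp_inj_on) auto
  have "independent (X ` {..<k})"
    using d card by (intro card_le_dim_spanning[of _ "span (X ` {..<k})"]) (auto intro: span_base)
  with inj show ?thesis using independent_imp_dual_family that by blast
qed

lemma perturbed_coefficient_bound:
  fixes X Y z :: "nat \<Rightarrow> 'b::euclidean_space"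
  assumes dual: "dual_family k z X"
    and near: "\<And>j. j < k \<Longrightarrow> (\<Sum>i<k. norm (z i)) * norm (Y j - X j) \<le> 1/2"
  shows "(\<Sum>i<k. \<bar>c i\<bar>) \<le> 2 * (\<Sum>i<k. norm (z i)) * norm (\<Sum>j<k. c j *\<^sub>R Y j)"
proof -
  let ?Z = "\<Sum>i<k. norm (z i)" and ?w = "\<Sum>j<k. c j *\<^sub>R Y j"
  have 1: "\<bar>c i\<bar> \<le> norm (z i) * norm ?w + norm (z i) * (\<Sum>j<k. \<bar>c j\<bar> * norm (Y j - X j))" if "i < k" for i
  proof -
    have "(\<Sum>j<k. c j *\<^sub>R X j) = ?w - (\<Sum>j<k. c j *\<^sub>R (Y j - X j))"
      by (simp add: sum_subtractf scaleR_diff_right)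
    then have "c i = z i \<bullet> ?w - z i \<bullet> (\<Sum>j<k. c j *\<^sub>R (Y j - X j))"
      using dual_family_sum[OF dual that, of c] by (simp add: inner_diff_right)
    then have "\<bar>c i\<bar> \<le> \<bar>z i \<bullet> ?w\<bar> + \<bar>z i \<bullet> (\<Sum>j<k. c j *\<^sub>R (Y j - X j))\<bar>" by linarith
    also have "\<dots> \<le> norm (z i) * norm ?w + norm (z i) * norm (\<Sum>j<k. c j *\<^sub>R (Y j - X j))"
      by (intro add_mono Cauchy_Schwarz_ineq2)
    also have "norm (\<Sum>j<k. c j *\<^sub>R (Y j - X j)) \<le> (\<Sum>j<k. \<bar>c j\<bar> * norm (Y j - X j))"
      by (rule order_trans[OF norm_sum]) simp
    finally show ?thesis by (simp add: mult_left_mono)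
  qed
  have "(\<Sum>i<k. \<bar>c i\<bar>) \<le> (\<Sum>i<k. norm (z i) * norm ?w + norm (z i) * (\<Sum>j<k. \<bar>c j\<bar> * norm (Y j - X j)))"
    by (intro sum_mono 1) auto
  also have "\<dots> = ?Z * norm ?w + ?Z * (\<Sum>j<k. \<bar>c j\<bar> * norm (Y j - X j))"
    by (simp add: sum.distrib sum_distrib_right)
  also have "?Z * (\<Sum>j<k. \<bar>c j\<bar> * norm (Y j - X j)) = (\<Sum>j<k. \<bar>c j\<bar> * (?Z * norm (Y j - X j)))"
    by (simp add: sum_distrib_left mult_ac)
  also have "\<dots> \<le> (\<Sum>j<k. \<bar>c j\<bar> * (1/2))" by (intro sum_mono mult_left_mono near) auto
  also have "\<dots> = (\<Sum>j<k. \<bar>c j\<bar>) / 2" by (simp add: sum_divide_distrib)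
  finally show ?thesis by simp
qed

lemma perturbed_family_dim:
  fixes X Y z :: "nat \<Rightarrow> 'b::euclidean_space"
  assumes dual: "dual_family k z X"
    and near: "\<And>j. j < k \<Longrightarrow> (\<Sum>i<k. norm (z i)) * norm (Y j - X j) \<le> 1/2"
  shows "dim (span (Y ` {..<k})) = k"
proof -
  have zero: "c i = 0" if "(\<Sum>j<k. c j *\<^sub>R Y j) = 0" "i < k" for c i
  proof -
    have "(\<Sum>i<k. \<bar>c i\<bar>) \<le> 0" using perturbed_coefficient_bound[OF dual near, of c] that by simp
    then have "(\<Sum>i<k. \<bar>c i\<bar>) = 0" by (meson abs_ge_zero antisym sum_nonneg)
    then show ?thesis using that(2) by (simp add: sum_nonneg_eq_0_iff)
  qed
  have inj: "inj_on Y {..<k}"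
  proof (rule inj_onI, rule ccontr)
    fix i j assume ij: "i \<in> {..<k}" "j \<in> {..<k}" "Y i = Y j" "i \<noteq> j"
    let ?c = "\<lambda>l. (if l = i then 1 else 0) - (if l = j then 1 else (0::real))"
    have "(\<Sum>l<k. ?c l *\<^sub>R Y l) = Y i - Y j"
      using ij by (simp add: scaleR_diff_left sum_subtractf if_distrib[of "\<lambda>c. c *\<^sub>R _"] cong: if_cong)
    then have "?c i = 0" using ij by (intro zero) auto
    then show False using ij by simp
  qed
  have "independent (Y ` {..<k})"
  proof (rule independent_if_scalars_zero)
    fix g y assume g: "(\<Sum>x\<in>Y ` {..<k}. g x *\<^sub>R x) = 0" "y \<in> Y ` {..<k}"
    then have "(\<Sum>j<k. g (Y j) *\<^sub>R Y j) = 0" using inj by (simp add: sum.reindex)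
    then show "g y = 0" using g(2) zero[of "g \<circ> Y"] by auto
  qed auto
  then show ?thesis using inj by (simp add: dim_span dim_eq_card_independent card_image)
qed

lemma mem_subspace_if_orthogonal_annihilator:
  fixes w :: "'b::euclidean_space"
  assumes "subspace S" and orth: "\<And>\<zeta>. (\<forall>v\<in>S. \<zeta> \<bullet> v = 0) \<Longrightarrow> \<zeta> \<bullet> w = 0"
  shows "w \<in> S"
proof -
  obtain y u where yu: "y \<in> span S" "\<And>v. v \<in> span S \<Longrightarrow> orthogonal u v" "w = y + u"
    using orthogonal_subspace_decomp_exists[of S w] by blast
  have sp: "span S = S" using assms(1) by (simp add: span_eq_iff)
  have "u \<bullet> w = 0" using yu(2) sp by (intro orth) (auto simp: orthogonal_def)
  moreover have "u \<bullet> y = 0" using yu(1,2) by (auto simp: orthogonal_def)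
  ultimately have "u = 0" using yu(3) by (simp add: inner_add_right)
  then show ?thesis using yu sp by simp
qed

definition annihilator_correction ::
  "nat \<Rightarrow> (nat \<Rightarrow> 'b \<Rightarrow> 'b) \<Rightarrow> (nat \<Rightarrow> 'b) \<Rightarrow> 'b \<Rightarrow> 'b \<Rightarrow> 'b::euclidean_space \<Rightarrow> real" where
  "annihilator_correction k D z \<zeta> a b = (\<Sum>i<k. (\<zeta> \<bullet> D i a) * (z i \<bullet> b))"

lemma bounded_bilinear_annihilator_correction:
  assumes D: "\<And>i. i < k \<Longrightarrow> bounded_linear (D i)"
  shows "bounded_bilinear (annihilator_correction k D z \<zeta>)"
proof -
  have l: "linear (D i)" if "i < k" for i using D[OF that] by (rule bounded_linear.linear)
  have 1: "linear (\<lambda>y. c * (v \<bullet> (y::'a)))" for c v by (intro linearI) (auto simp: inner_add_right distrib_left)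
  have 2: "linear (\<lambda>x. (\<zeta> \<bullet> D i x) * c)" if "i < k" for i c
    by (intro linearI) (auto simp: inner_add_right distrib_right linear_add[OF l[OF that]] linear_cmul[OF l[OF that]])
  have "bilinear (annihilator_correction k D z \<zeta>)"
    unfolding bilinear_def annihilator_correction_def
    using 1 2 by (intro conjI allI linear_compose_sum ballI) auto
  then show ?thesis by (simp add: bilinear_conv_bounded_bilinear)
qed

definition annihilates_to_first_order ::
  "('b::euclidean_space \<Rightarrow> 'b set) \<Rightarrow> 'b \<Rightarrow> 'b \<Rightarrow> ('b \<Rightarrow> 'b \<Rightarrow> real) \<Rightarrow> bool" where
  "annihilates_to_first_order V p \<zeta> B \<longleftrightarrow>
     (\<forall>\<eta>>0. \<exists>\<delta>>0. \<forall>q w. norm (q - p) < \<delta> \<longrightarrow> w \<in> V q \<longrightarrow> \<bar>\<zeta> \<bullet> w - B (q - p) w\<bar> \<le> \<eta> * norm (q - p) * norm w)"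

lemma eventually_all_less:
  fixes k :: nat
  assumes "\<And>j. j < k \<Longrightarrow> eventually (\<lambda>x. P j x) F"
  shows "eventually (\<lambda>x. \<forall>j<k. P j x) F"
  using eventually_ball_finite[of "{..<k}" "\<lambda>x j. P j x" F] assms by (simp add: Ball_def)

lemma annihilates_to_first_order_frame:
  fixes X :: "nat \<Rightarrow> 'b::euclidean_space \<Rightarrow> 'b"
  assumes U: "open U" "p \<in> U" and V: "spans_on U k X V"
    and der: "\<And>i. i < k \<Longrightarrow> (X i has_derivative D i) (at p)"
    and dual: "dual_family k z (\<lambda>i. X i p)"
    and \<zeta>: "\<And>i. i < k \<Longrightarrow> \<zeta> \<bullet> X i p = 0"
  shows "annihilates_to_first_order V p \<zeta> (annihilator_correction k D z \<zeta>)"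
  unfolding annihilates_to_first_order_def
proof (intro allI impI)
  fix \<eta> :: real assume \<eta>: "\<eta> > 0"
  define Z where "Z = (\<Sum>i<k. norm (z i))"
  have Z: "0 \<le> Z" by (auto simp: Z_def sum_nonneg)
  define C where "C = (\<Sum>i<k. norm \<zeta> * onorm (D i) * norm (z i))"
  have bl: "bounded_linear (D i)" if "i < k" for i using der[OF that] by (rule has_derivative_bounded_linear)
  have C: "0 \<le> C" unfolding C_def by (intro sum_nonneg mult_nonneg_nonneg onorm_pos_le bl) auto
  define e where "e = \<eta> / ((2 * Z + 1) * (norm \<zeta> + C + 1))"
  have e: "e > 0" unfolding e_def using \<eta> Z C by (intro divide_pos_pos mult_pos_pos) (auto simp: add_nonneg_pos add_pos_nonneg)
  have ev1: "eventually (\<lambda>q. norm (X j q - X j p - D j (q - p)) \<le> e * norm (q - p)) (nhds p)" if "j < k" for j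
    using der[OF that] e unfolding has_derivative_at_alt eventually_nhds_metric dist_norm by simp
  have ev2: "eventually (\<lambda>q. norm (X j q - X j p) < d) (nhds p)" if "j < k" "d > 0" for j d
  proof -
    have "isCont (X j) p" using der[OF that(1)] has_derivative_continuous by blast
    then have "eventually (\<lambda>q. dist (X j q) (X j p) < d) (nhds p)"
      using that(2) by (auto simp: continuous_at tendsto_iff eventually_at_filter elim!: allE[of _ d] eventually_mono)
    then show ?thesis by (simp add: dist_norm)
  qed
  have "eventually (\<lambda>q. q \<in> U \<and> (\<forall>j<k. norm (X j q - X j p - D j (q - p)) \<le> e * norm (q - p)
      \<and> norm (X j q - X j p) < e \<and> norm (X j q - X j p) < 1 / (2 * Z + 1))) (nhds p)"
    by (intro eventually_conj eventually_nhds_in_open eventually_all_less U ev1 ev2 e) (use Z in auto)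
  then obtain \<delta> where \<delta>: "\<delta> > 0" and all: "\<And>q. norm (q - p) < \<delta> \<Longrightarrow> q \<in> U \<and> (\<forall>j<k. norm (X j q - X j p - D j (q - p)) \<le> e * norm (q - p)
      \<and> norm (X j q - X j p) < e \<and> norm (X j q - X j p) < 1 / (2 * Z + 1))"
    unfolding eventually_nhds_metric dist_norm by auto
  show "\<exists>\<delta>>0. \<forall>q w. norm (q - p) < \<delta> \<longrightarrow> w \<in> V q \<longrightarrow>
     \<bar>\<zeta> \<bullet> w - annihilator_correction k D z \<zeta> (q - p) w\<bar> \<le> \<eta> * norm (q - p) * norm w"
  proof (intro exI[of _ \<delta>] conjI \<delta> allI impI)
    fix q w assume q: "norm (q - p) < \<delta>" and w: "w \<in> V q"
    note a = all[OF q]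
    have "w \<in> span ((\<lambda>i. X i q) ` {..<k})" using w V a by (auto simp: spans_on_def)
    then obtain c where c: "w = (\<Sum>j<k. c j *\<^sub>R X j q)" by (rule span_image_sum)
    have "(\<Sum>i<k. \<bar>c i\<bar>) \<le> 2 * Z * norm w" unfolding c Z_def
    proof (rule perturbed_coefficient_bound[OF dual])
      fix j assume "j < k"
      then have "norm (X j q - X j p) \<le> 1 / (2 * Z + 1)" using a by (auto intro: less_imp_le)
      then have "Z * norm (X j q - X j p) \<le> Z * (1 / (2 * Z + 1))" using Z by (intro mult_left_mono) auto
      also have "\<dots> \<le> 1/2" using Z by (simp add: field_simps)
      finally show "(\<Sum>i<k. norm (z i)) * norm (X j q - X j p) \<le> 1/2" by (simp add: Z_def)
    qed
    define br where "br j = \<zeta> \<bullet> (X j q - X j p - D j (q - p)) - (\<Sum>i<k. (\<zeta> \<bullet> D i (q - p)) * (z i \<bullet> (X j q - X j p)))" for j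
    have br: "\<zeta> \<bullet> X j q - annihilator_correction k D z \<zeta> (q - p) (X j q) = br j" if j: "j < k" for j
    proof -
      have "(\<Sum>i<k. (\<zeta> \<bullet> D i (q - p)) * (z i \<bullet> X j p)) = (\<Sum>i<k. (\<zeta> \<bullet> D i (q - p)) * (if i = j then 1 else 0))"
        using dual j by (intro sum.cong) (auto simp: dual_family_def)
      also have "\<dots> = \<zeta> \<bullet> D j (q - p)" using j by (simp add: if_distrib cong: if_cong)
      finally have 1: "(\<Sum>i<k. (\<zeta> \<bullet> D i (q - p)) * (z i \<bullet> X j p)) = \<zeta> \<bullet> D j (q - p)" .
      have "(\<Sum>i<k. (\<zeta> \<bullet> D i (q - p)) * (z i \<bullet> (X j q - X j p)))
        = (\<Sum>i<k. (\<zeta> \<bullet> D i (q - p)) * (z i \<bullet> X j q)) - (\<Sum>i<k. (\<zeta> \<bullet> D i (q - p)) * (z i \<bullet> X j p))"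
        by (simp only: inner_diff_right right_diff_distrib sum_subtractf)
      then show ?thesis using \<zeta>[OF j] unfolding br_def annihilator_correction_def 1
        by (simp only: inner_diff_right)
    qed
    have br_le: "\<bar>br j\<bar> \<le> (norm \<zeta> + C) * e * norm (q - p)" if j: "j < k" for j
    proof -
      have "\<bar>br j\<bar> \<le> \<bar>\<zeta> \<bullet> (X j q - X j p - D j (q - p))\<bar> + \<bar>\<Sum>i<k. (\<zeta> \<bullet> D i (q - p)) * (z i \<bullet> (X j q - X j p))\<bar>"
        unfolding br_def by linarith
      also have "\<bar>\<zeta> \<bullet> (X j q - X j p - D j (q - p))\<bar> \<le> norm \<zeta> * (e * norm (q - p))"
        using a j by (intro order_trans[OF Cauchy_Schwarz_ineq2] mult_left_mono) auto
      also have "\<bar>\<Sum>i<k. (\<zeta> \<bullet> D i (q - p)) * (z i \<bullet> (X j q - X j p))\<bar> \<le> (\<Sum>i<k. \<bar>(\<zeta> \<bullet> D i (q - p)) * (z i \<bullet> (X j q - X j p))\<bar>)"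
        by (rule sum_abs)
      also have "\<dots> \<le> (\<Sum>i<k. (norm \<zeta> * onorm (D i) * norm (z i)) * (e * norm (q - p)))"
      proof (rule sum_mono)
        fix i assume i: "i \<in> {..<k}"
        have "\<bar>(\<zeta> \<bullet> D i (q - p)) * (z i \<bullet> (X j q - X j p))\<bar> \<le> (norm \<zeta> * norm (D i (q - p))) * (norm (z i) * norm (X j q - X j p))"
          unfolding abs_mult by (intro mult_mono Cauchy_Schwarz_ineq2) auto
        also have "\<dots> \<le> (norm \<zeta> * (onorm (D i) * norm (q - p))) * (norm (z i) * e)"
          using a j i onorm[OF bl, of i] onorm_pos_le[OF bl, of i]
          by (intro mult_mono mult_left_mono mult_nonneg_nonneg) (auto intro: less_imp_le)
        finally show "\<bar>(\<zeta> \<bullet> D i (q - p)) * (z i \<bullet> (X j q - X j p))\<bar> \<le> (norm \<zeta> * onorm (D i) * norm (z i)) * (e * norm (q - p))"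
          by (simp add: mult_ac)
      qed
      also have "\<dots> = C * (e * norm (q - p))" by (simp add: C_def sum_distrib_right)
      finally show ?thesis by (simp only: distrib_right mult.assoc)
    qed
    have "\<zeta> \<bullet> w - annihilator_correction k D z \<zeta> (q - p) w = (\<Sum>j<k. c j * br j)"
    proof -
      have "annihilator_correction k D z \<zeta> (q - p) w = (\<Sum>j<k. c j * annihilator_correction k D z \<zeta> (q - p) (X j q))"
        unfolding c annihilator_correction_def inner_sum_right sum_distrib_left
        by (subst sum.swap) (simp only: inner_scaleR_right mult.left_commute)
      moreover have "\<zeta> \<bullet> w = (\<Sum>j<k. c j * (\<zeta> \<bullet> X j q))" unfolding c by (simp add: inner_sum_right)
      ultimately have "\<zeta> \<bullet> w - annihilator_correction k D z \<zeta> (q - p) w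
          = (\<Sum>j<k. c j * (\<zeta> \<bullet> X j q - annihilator_correction k D z \<zeta> (q - p) (X j q)))"
        by (simp only: right_diff_distrib sum_subtractf)
      also have "\<dots> = (\<Sum>j<k. c j * br j)" using br by (intro sum.cong) auto
      finally show ?thesis .
    qed
    then have "\<bar>\<zeta> \<bullet> w - annihilator_correction k D z \<zeta> (q - p) w\<bar> \<le> (\<Sum>j<k. \<bar>c j\<bar> * \<bar>br j\<bar>)"
      using sum_abs[of "\<lambda>j. c j * br j" "{..<k}"] by (simp add: abs_mult)
    also have "\<dots> \<le> (\<Sum>j<k. \<bar>c j\<bar> * ((norm \<zeta> + C) * e * norm (q - p)))"
      using br_le by (intro sum_mono mult_left_mono) auto
    also have "\<dots> = (\<Sum>j<k. \<bar>c j\<bar>) * ((norm \<zeta> + C) * e * norm (q - p))" by (simp add: sum_distrib_right)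
    also have "\<dots> \<le> (2 * Z * norm w) * ((norm \<zeta> + C) * e * norm (q - p))"
      using \<open>(\<Sum>i<k. \<bar>c i\<bar>) \<le> 2 * Z * norm w\<close> C e by (intro mult_right_mono) auto
    also have "\<dots> = (2 * Z) * (norm \<zeta> + C) * e * (norm (q - p) * norm w)" by (simp add: mult_ac)
    also have "\<dots> \<le> \<eta> * (norm (q - p) * norm w)"
    proof (rule mult_right_mono)
      have "(2 * Z) * (norm \<zeta> + C) * e \<le> ((2 * Z + 1) * (norm \<zeta> + C + 1)) * e"
        using Z C e by (intro mult_right_mono mult_mono) auto
      also have "\<dots> = \<eta>" unfolding e_def using Z C by (simp add: add_nonneg_eq_0_iff)
      finally show "(2 * Z) * (norm \<zeta> + C) * e \<le> \<eta>" .
    qed auto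
    finally show "\<bar>\<zeta> \<bullet> w - annihilator_correction k D z \<zeta> (q - p) w\<bar> \<le> \<eta> * norm (q - p) * norm w"
      by (simp add: mult_ac)
  qed
qed

lemma class_C_on_1_iff:
  "class_C_on 1 U f \<longleftrightarrow> continuous_on U f \<and> (\<forall>x\<in>U. f differentiable (at x)) \<and>
     (\<forall>v. continuous_on U (\<lambda>x. frechet_derivative f (at x) v))"
proof -
  have "enat j \<le> 1 \<longleftrightarrow> j = 0 \<or> j = 1" for j by (auto simp: one_enat_def)
  then have "class_C_on 1 U f \<longleftrightarrow> n_differentiable_on 0 U f \<and> n_differentiable_on 1 U f"
    unfolding class_C_on_def by metis
  then show ?thesis by simp
qed

lemma class_C_on_mono: "class_C_on r U f \<Longrightarrow> s \<le> r \<Longrightarrow> class_C_on s U f"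
  unfolding class_C_on_def by (meson order_trans)

lemma class_C_on_1_subset:
  "class_C_on 1 U f \<Longrightarrow> T \<subseteq> U \<Longrightarrow> class_C_on 1 T f"
  unfolding class_C_on_1_iff by (meson continuous_on_subset subsetD)

lemma tangent_field_derivative:
  fixes T :: "'b::euclidean_space \<Rightarrow> 'b"
  assumes U: "open U" "p \<in> U" and tan: "field_tangent_on U T W"
    and T: "T differentiable (at p)"
    and B: "bounded_bilinear B" and ann: "annihilates_to_first_order W p \<zeta> B"
    and orth: "\<zeta> \<bullet> T p = 0"
  shows "\<zeta> \<bullet> frechet_derivative T (at p) v = B v (T p)"
proof -
  interpret B: bounded_bilinear B by fact
  let ?D = "frechet_derivative T (at p)"
  have dT: "(T has_derivative ?D) (at p)" using T frechet_derivative_works by blast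
  let ?\<phi> = "\<lambda>q. \<zeta> \<bullet> T q - B (q - p) (T q)"
  have "(?\<phi> has_derivative (\<lambda>v. \<zeta> \<bullet> ?D v - (B (p - p) (?D v) + B v (T p)))) (at p)"
    by (auto intro!: derivative_eq_intros dT B.FDERIV)
  then have 1: "(?\<phi> has_derivative (\<lambda>v. \<zeta> \<bullet> ?D v - B v (T p))) (at p)" by (simp add: B.zero_left)
  have 2: "(?\<phi> has_derivative (\<lambda>v. 0)) (at p)"
    unfolding has_derivative_at_alt
  proof (intro conjI allI impI)
    fix e :: real assume e: "e > 0"
    have "isCont T p" using dT has_derivative_continuous by blast
    then obtain d1 where d1: "d1 > 0" "\<And>q. dist q p < d1 \<Longrightarrow> dist (T q) (T p) < 1"
      unfolding continuous_at_eps_delta by (metis zero_less_one)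
    define M where "M = norm (T p) + 1"
    have M: "M > 0" by (simp add: M_def add_nonneg_pos)
    obtain d2 where d2: "d2 > 0" "\<And>q w. norm (q - p) < d2 \<Longrightarrow> w \<in> W q \<Longrightarrow> \<bar>\<zeta> \<bullet> w - B (q - p) w\<bar> \<le> e / M * norm (q - p) * norm w"
      using ann e M unfolding annihilates_to_first_order_def by (meson divide_pos_pos)
    obtain d3 where d3: "d3 > 0" "ball p d3 \<subseteq> U" using U open_contains_ball by blast
    show "\<exists>d>0. \<forall>y. norm (y - p) < d \<longrightarrow> norm (?\<phi> y - ?\<phi> p - 0) \<le> e * norm (y - p)"
    proof (intro exI[of _ "min d1 (min d2 d3)"] conjI allI impI)
      fix q assume q: "norm (q - p) < min d1 (min d2 d3)"
      then have "q \<in> U" using d3 by (auto simp: dist_norm norm_minus_commute)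
      then have "T q \<in> W q" using tan by (auto simp: field_tangent_on_def)
      then have "\<bar>?\<phi> q\<bar> \<le> e / M * norm (q - p) * norm (T q)" using d2 q by auto
      also have "norm (T q) \<le> M"
        using d1(2)[of q] q norm_triangle_ineq2[of "T q" "T p"] by (auto simp: dist_norm M_def)
      then have "e / M * norm (q - p) * norm (T q) \<le> e / M * norm (q - p) * M" using e M by (intro mult_left_mono) auto
      also have "\<dots> = e * norm (q - p)" using M by simp
      finally show "norm (?\<phi> q - ?\<phi> p - 0) \<le> e * norm (q - p)" using orth by (simp add: B.zero_left)
    qed (use d1 d2 d3 in auto)
  qed simp
  have "(\<lambda>v. \<zeta> \<bullet> ?D v - B v (T p)) = (\<lambda>v. 0)" using has_derivative_unique[OF 1 2] .
  then show ?thesis by (metis eq_iff_diff_eq_0)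
qed

lemma involutive_at_if_frame_brackets_vanish:
  fixes Y :: "nat \<Rightarrow> 'b::euclidean_space \<Rightarrow> 'b"
  assumes U: "open U" "p \<in> U" and W: "spans_on U h Y W"
    and der: "\<And>i. i < h \<Longrightarrow> Y i differentiable (at p)"
    and dual: "dual_family h b (\<lambda>i. Y i p)"
    and br: "\<And>i j. i < h \<Longrightarrow> j < h \<Longrightarrow> lie_bracket (Y i) (Y j) p = 0"
  shows "\<not> noninvolutive_at U W p"
proof
  assume "noninvolutive_at U W p"
  then obtain S T where ST: "class_C_on 1 U S" "class_C_on 1 U T" "field_tangent_on U S W" "field_tangent_on U T W"
    and nin: "lie_bracket S T p \<notin> W p" unfolding noninvolutive_at_def by blast
  let ?D = "\<lambda>i. frechet_derivative (Y i) (at p)"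
  have D: "(Y i has_derivative ?D i) (at p)" if "i < h" for i using der[OF that] frechet_derivative_works by blast
  have Wp: "W p = span ((\<lambda>i. Y i p) ` {..<h})" using W U by (auto simp: spans_on_def)
  have "lie_bracket S T p \<in> W p"
  proof (rule mem_subspace_if_orthogonal_annihilator)
    show "subspace (W p)" unfolding Wp by simp
    fix \<zeta> assume \<zeta>: "\<forall>v\<in>W p. \<zeta> \<bullet> v = 0"
    let ?B = "annihilator_correction h ?D b \<zeta>"
    have bl: "bounded_linear (?D i)" if "i < h" for i using D[OF that] has_derivative_bounded_linear by blast
    have B: "bounded_bilinear ?B" by (rule bounded_bilinear_annihilator_correction[OF bl])
    interpret B: bounded_bilinear ?B by fact
    have Yp: "Y i p \<in> W p" if "i < h" for i using that unfolding Wp by (auto intro: span_base)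
    have ann: "annihilates_to_first_order W p \<zeta> ?B"
      using \<zeta> Yp by (intro annihilates_to_first_order_frame[OF U W D dual]) auto
    have STp: "S p \<in> W p" "T p \<in> W p" using ST U by (auto simp: field_tangent_on_def)
    have "\<zeta> \<bullet> lie_bracket S T p = ?B (S p) (T p) - ?B (T p) (S p)"
      unfolding lie_bracket_def inner_diff_right
      using ST U STp \<zeta> by (subst (1 2) tangent_field_derivative[OF U _ _ B ann]) (auto simp: class_C_on_1_iff)
    also have "?B (S p) (T p) = ?B (T p) (S p)"
    proof -
      have sym: "?B (Y i p) (Y j p) = ?B (Y j p) (Y i p)" if ij: "i < h" "j < h" for i j
      proof -
        have BY: "?B v (Y j p) = \<zeta> \<bullet> ?D j v" if "j < h" for v j
        proof -
          have "?B v (Y j p) = (\<Sum>i<h. (\<zeta> \<bullet> ?D i v) * (if i = j then 1 else 0))"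
            unfolding annihilator_correction_def using dual that by (intro sum.cong) (auto simp: dual_family_def)
          then show ?thesis using that by (simp add: if_distrib cong: if_cong)
        qed
        have "?B (Y i p) (Y j p) - ?B (Y j p) (Y i p) = \<zeta> \<bullet> lie_bracket (Y i) (Y j) p"
          using ij by (simp add: BY lie_bracket_def inner_diff_right)
        then show ?thesis using br ij by simp
      qed
      obtain c where c: "S p = (\<Sum>i<h. c i *\<^sub>R Y i p)" using STp(1) span_image_sum unfolding Wp by blast
      obtain d where d: "T p = (\<Sum>i<h. d i *\<^sub>R Y i p)" using STp(2) span_image_sum unfolding Wp by blast
      have "?B (S p) (T p) = (\<Sum>i<h. \<Sum>j<h. c i * d j * ?B (Y i p) (Y j p))"
        unfolding c d by (subst sum.swap) (simp add: B.sum_left B.sum_right B.scaleR_left B.scaleR_right sum_distrib_left mult_ac)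
      also have "\<dots> = (\<Sum>i<h. \<Sum>j<h. c i * d j * ?B (Y j p) (Y i p))"
        using sym by (intro sum.cong) auto
      also have "\<dots> = ?B (T p) (S p)"
        unfolding c d by (simp add: B.sum_left B.sum_right B.scaleR_left B.scaleR_right sum_distrib_left mult_ac)
      finally show ?thesis .
    qed
    finally show "\<zeta> \<bullet> lie_bracket S T p = 0" by simp
  qed
  then show False using nin by blast
qed

theorem isotropic_imp_not_h_noninvolutive:
  fixes X :: "nat \<Rightarrow> 'b::euclidean_space \<Rightarrow> 'b"
  assumes X: "\<And>l. l < k \<Longrightarrow> class_C_on 1 UNIV (X l)" and V: "spans_on UNIV k X V"
    and z: "dual_family k z (\<lambda>l. X l p)"
    and a: "\<And>i. i < h \<Longrightarrow> a i \<in> V p" and b: "dual_family h b a"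
    and iso: "\<And>\<zeta> i j. (\<forall>v\<in>V p. \<zeta> \<bullet> v = 0) \<Longrightarrow> i < h \<Longrightarrow> j < h \<Longrightarrow>
        annihilator_correction k (\<lambda>l. frechet_derivative (X l) (at p)) z \<zeta> (a i) (a j) =
        annihilator_correction k (\<lambda>l. frechet_derivative (X l) (at p)) z \<zeta> (a j) (a i)"
  shows "\<not> h_noninvolutive_at h V p"
proof
  assume noninv: "h_noninvolutive_at h V p"
  let ?D = "\<lambda>l q. frechet_derivative (X l) (at q)"
  have D: "(X l has_derivative ?D l q) (at q)" if "l < k" for l q
    using X[OF that] frechet_derivative_works by (auto simp: class_C_on_1_iff)
  have Vq: "V q = span ((\<lambda>l. X l q) ` {..<k})" for q using V by (auto simp: spans_on_def)
  define \<alpha> where "\<alpha> i l = z l \<bullet> a i" for i l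
  have a_exp: "a i = (\<Sum>l<k. \<alpha> i l *\<^sub>R X l p)" if "i < h" for i
    unfolding \<alpha>_def using dual_family_expand[OF z] a[OF that] Vq by auto
  define brc where "brc i j = (\<Sum>l<k. \<alpha> j l *\<^sub>R ?D l p (a i)) - (\<Sum>l<k. \<alpha> i l *\<^sub>R ?D l p (a j))" for i j
  have anti: "brc j i = - brc i j" for i j by (simp add: brc_def)
  have "brc i j \<in> V p" if ij: "i < h" "j < h" for i j
  proof (rule mem_subspace_if_orthogonal_annihilator)
    show "subspace (V p)" unfolding Vq by simp
    fix \<zeta> assume \<zeta>: "\<forall>v\<in>V p. \<zeta> \<bullet> v = 0"
    show "\<zeta> \<bullet> brc i j = 0" using iso[OF \<zeta> ij]
      by (simp add: brc_def inner_diff_right inner_sum_right annihilator_correction_def \<alpha>_def mult_ac)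
  qed
  then have brc_exp: "(\<Sum>l<k. (z l \<bullet> brc i j) *\<^sub>R X l p) = brc i j" if "i < h" "j < h" for i j
    using dual_family_expand[OF z] Vq that by metis
  define \<mu> where "\<mu> j l = (\<Sum>i<h. (- (z l \<bullet> brc i j) / 2) *\<^sub>R b i)" for j l
  have mu: "\<mu> j l \<bullet> a i = - (z l \<bullet> brc i j) / 2" if "i < h" for i j l
  proof -
    have "\<mu> j l \<bullet> a i = (\<Sum>i'<h. (- (z l \<bullet> brc i' j) / 2) * (if i' = i then 1 else 0))"
      unfolding \<mu>_def inner_sum_left using b that by (intro sum.cong) (auto simp: dual_family_def)
    then show ?thesis using that by (simp add: if_distrib cong: if_cong)
  qed
  define Y where "Y i q = (\<Sum>l<k. (\<alpha> i l + \<mu> i l \<bullet> (q - p)) *\<^sub>R X l q)" for i q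
  let ?DY = "\<lambda>i q v. \<Sum>l<k. (\<alpha> i l + \<mu> i l \<bullet> (q - p)) *\<^sub>R ?D l q v + (\<mu> i l \<bullet> v) *\<^sub>R X l q"
  have DY: "(Y i has_derivative ?DY i q) (at q)" for i q
    unfolding Y_def by (intro has_derivative_sum) (auto intro!: derivative_eq_intros D)
  have frY: "frechet_derivative (Y i) (at q) = ?DY i q" for i q
    using frechet_derivative_at[OF DY] by simp
  have contX: "continuous_on A (X l)" if "l < k" for l A
    using X[OF that] by (auto simp: class_C_on_1_iff intro: continuous_on_subset)
  have contD: "continuous_on A (\<lambda>q. ?D l q v)" if "l < k" for l A v
    using X[OF that] by (auto simp: class_C_on_1_iff intro: continuous_on_subset)
  have CY: "class_C_on 1 UNIV (Y i)" for i
    unfolding class_C_on_1_iff frY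
  proof (intro conjI ballI allI)
    show "continuous_on UNIV (Y i)" unfolding Y_def by (intro continuous_intros contX) auto
    show "Y i differentiable (at q)" for q using DY differentiableI by blast
    show "continuous_on UNIV (\<lambda>q. ?DY i q v)" for v
      by (intro continuous_intros contX contD) auto
  qed
  have Yp: "Y i p = a i" if "i < h" for i using a_exp[OF that] by (simp add: Y_def)
  have lie: "lie_bracket (Y i) (Y j) p = 0" if ij: "i < h" "j < h" for i j
  proof -
    have "lie_bracket (Y i) (Y j) p = ?DY j p (a i) - ?DY i p (a j)"
      unfolding lie_bracket_def frY Yp[OF ij(1)] Yp[OF ij(2)] ..
    also have "\<dots> = brc i j + ((\<Sum>l<k. (\<mu> j l \<bullet> a i) *\<^sub>R X l p) - (\<Sum>l<k. (\<mu> i l \<bullet> a j) *\<^sub>R X l p))"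
      by (simp add: brc_def sum.distrib)
    also have "(\<Sum>l<k. (\<mu> j l \<bullet> a i) *\<^sub>R X l p) - (\<Sum>l<k. (\<mu> i l \<bullet> a j) *\<^sub>R X l p)
        = - (\<Sum>l<k. (z l \<bullet> brc i j) *\<^sub>R X l p)"
    proof -
      have "(\<mu> j l \<bullet> a i) - (\<mu> i l \<bullet> a j) = - (z l \<bullet> brc i j)" for l
        using ij by (simp add: mu anti[of i j])
      then have "(\<Sum>l<k. ((\<mu> j l \<bullet> a i) - (\<mu> i l \<bullet> a j)) *\<^sub>R X l p) = (\<Sum>l<k. (- (z l \<bullet> brc i j)) *\<^sub>R X l p)"
        by simp
      then show ?thesis by (simp only: scaleR_diff_left sum_subtractf scaleR_minus_left sum_negf)
    qed
    also have "\<dots> = - brc i j" using brc_exp ij by simp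
    finally show ?thesis by simp
  qed
  have dualY: "dual_family h b (\<lambda>i. Y i p)" using b Yp by (auto simp: dual_family_def)
  define Z where "Z = (\<Sum>i<h. norm (b i))"
  have Z: "0 \<le> Z" by (auto simp: Z_def sum_nonneg)
  define U where "U = (\<Inter>j\<in>{..<h}. {q. norm (Y j q - Y j p) < 1 / (2 * Z + 1)})"
  have "open U" unfolding U_def
  proof (intro open_INT ballI)
    fix j
    have "continuous_on UNIV (Y j)" using CY by (simp add: class_C_on_1_iff)
    then show "open {q. norm (Y j q - Y j p) < 1 / (2 * Z + 1)}"
      by (intro open_Collect_less continuous_intros) auto
  qed simp
  have "p \<in> U" using Z by (simp add: U_def)
  define W where "W q = span ((\<lambda>i. Y i q) ` {..<h})" for q
  have W: "spans_on U h Y W" by (simp add: spans_on_def W_def)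
  have "dim (W q) = h" if "q \<in> U" for q unfolding W_def
  proof (rule perturbed_family_dim[OF dualY])
    fix j assume "j < h"
    then have "norm (Y j q - Y j p) \<le> 1 / (2 * Z + 1)" using that by (auto simp: U_def intro: less_imp_le)
    then have "Z * norm (Y j q - Y j p) \<le> Z * (1 / (2 * Z + 1))" using Z by (intro mult_left_mono) auto
    also have "\<dots> \<le> 1/2" using Z by (simp add: field_simps)
    finally show "(\<Sum>i<h. norm (b i)) * norm (Y j q - Y j p) \<le> 1/2" by (simp add: Z_def)
  qed
  moreover have "subspace (W q)" for q unfolding W_def by simp
  moreover have "class_C_on 1 U (Y i)" for i using CY class_C_on_1_subset by blast
  ultimately have dist: "distribution_on 1 U h W"
    unfolding distribution_on_def using W by blast
  have "Y i q \<in> V q" for i q unfolding Y_def Vq by (intro span_sum span_scale span_base) auto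
  then have "distribution_tangent_on U W V"
    unfolding distribution_tangent_on_def W_def by (metis Vq image_subsetI span_minimal subspace_span)
  then have "noninvolutive_at U W p"
    using noninv dist \<open>open U\<close> \<open>p \<in> U\<close> unfolding h_noninvolutive_at_def by blast
  moreover have "\<not> noninvolutive_at U W p"
    using CY by (intro involutive_at_if_frame_brackets_vanish[OF \<open>open U\<close> \<open>p \<in> U\<close> W _ dualY lie]) (auto simp: class_C_on_1_iff)
  ultimately show False by blast
qed

lemma division_intervalE:
  fixes D :: "real set set"
  assumes "D division_of S" "I \<in> D"
  obtains u w where "u \<le> w" "I = {u..w}" "{u..w} \<subseteq> S"
proof -
  obtain u w where "I = cbox u w" "I \<noteq> {}" "I \<subseteq> S" using division_ofD[OF assms(1)] assms(2) by metis
  then show ?thesis using that[of u w] by (auto simp: box_real)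
qed

definition chord_sum :: "(real \<Rightarrow> 'b::real_normed_vector) \<Rightarrow> real set set \<Rightarrow> real" where
  "chord_sum g D = (\<Sum>I\<in>D. norm (g (Sup I) - g (Inf I)))"

definition arc_length :: "(real \<Rightarrow> 'b::real_normed_vector) \<Rightarrow> real \<Rightarrow> real \<Rightarrow> ennreal" where
  "arc_length g a b = (SUP D \<in> {D. D division_of {a..b}}. ennreal (chord_sum g D))"

lemma curve_length_eq_arc_length: "curve_length \<gamma> = arc_length \<gamma> 0 1"
  by (simp add: curve_length_def arc_length_def chord_sum_def)

lemma chord_sum_nonneg: "0 \<le> chord_sum g D"
  by (simp add: chord_sum_def sum_nonneg)

lemma chord_sum_le_arc_length: "D division_of {a..b} \<Longrightarrow> ennreal (chord_sum g D) \<le> arc_length g a b"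
  unfolding arc_length_def by (rule SUP_upper) simp

lemma arc_length_leI:
  "(\<And>D. D division_of {a..b} \<Longrightarrow> ennreal (chord_sum g D) \<le> C) \<Longrightarrow> arc_length g a b \<le> C"
  unfolding arc_length_def by (rule SUP_least) simp

lemma norm_le_arc_length: "a \<le> b \<Longrightarrow> ennreal (norm (g b - g a)) \<le> arc_length g a b"
  using chord_sum_le_arc_length[of "{{a..b}}" a b g] division_of_self[of a b]
  by (simp add: chord_sum_def box_real)

lemma sum_lengths_division:
  assumes "D division_of T"
  shows "(\<Sum>I\<in>D. Sup I - Inf I) = measure lebesgue (T :: real set)"
proof -
  have "(\<Sum>I\<in>D. Sup I - Inf I) = (\<Sum>I\<in>D. measure lebesgue I)"
  proof (rule sum.cong)
    fix I assume "I \<in> D"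
    then obtain u w where "u \<le> w" "I = {u..w}" using division_intervalE[OF assms] by metis
    then show "Sup I - Inf I = measure lebesgue I" by simp
  qed simp
  then show ?thesis using content_division[OF assms] by simp
qed

lemma chord_sum_lipschitz:
  assumes D: "D division_of {a..b}" and lip: "\<And>s t. a \<le> s \<Longrightarrow> s \<le> t \<Longrightarrow> t \<le> b \<Longrightarrow> norm (g t - g s) \<le> L * (t - s)"
    and "a \<le> b"
  shows "chord_sum g D \<le> L * (b - a)"
proof -
  have "chord_sum g D \<le> (\<Sum>I\<in>D. L * (Sup I - Inf I))" unfolding chord_sum_def
  proof (rule sum_mono)
    fix I assume "I \<in> D"
    then obtain u w where "u \<le> w" "I = {u..w}" "{u..w} \<subseteq> {a..b}" using division_intervalE[OF D] by blast
    then show "norm (g (Sup I) - g (Inf I)) \<le> L * (Sup I - Inf I)" using lip by simp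
  qed
  also have "\<dots> = L * (b - a)"
    using sum_lengths_division[OF D] \<open>a \<le> b\<close> by (simp add: sum_distrib_left[symmetric])
  finally show ?thesis .
qed

lemma arc_length_lipschitz:
  assumes "\<And>s t. a \<le> s \<Longrightarrow> s \<le> t \<Longrightarrow> t \<le> b \<Longrightarrow> norm (g t - g s) \<le> L * (t - s)" "a \<le> b"
  shows "arc_length g a b \<le> ennreal (L * (b - a))"
  by (intro arc_length_leI ennreal_leI chord_sum_lipschitz assms) auto

lemma division_of_adjacent:
  fixes a b c :: real
  assumes "D division_of {a..b}" "E division_of {b..c}" "a \<le> b" "b \<le> c"
  shows "D \<union> E division_of {a..c}"
proof -
  have "D \<union> E division_of ({a..b} \<union> {b..c})"
    using assms(1,2) by (rule division_disjoint_union) (auto simp: interior_atLeastAtMost_real)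
  then show ?thesis using assms by (simp add: ivl_disj_un_two_touch)
qed

lemma chord_sum_adjacent:
  fixes a b c :: real
  assumes D: "D division_of {a..b}" and E: "E division_of {b..c}"
  shows "chord_sum g (D \<union> E) = chord_sum g D + chord_sum g E"
  unfolding chord_sum_def
proof (rule sum.union_inter_neutral)
  show "finite D" "finite E" using D E by auto
  show "\<forall>I\<in>D \<inter> E. norm (g (Sup I) - g (Inf I)) = 0"
  proof
    fix I assume I: "I \<in> D \<inter> E"
    obtain u w where u: "u \<le> w" "I = {u..w}" "{u..w} \<subseteq> {a..b}" using I division_intervalE[OF D] by blast
    have "{u..w} \<subseteq> {b..c}" using I division_ofD(2)[OF E, of I] unfolding u(2) by blast
    then have "u = w" using u by auto
    then show "norm (g (Sup I) - g (Inf I)) = 0" using u by simp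
  qed
qed

lemma arc_length_superadditive:
  assumes "a \<le> b" "b \<le> c"
  shows "arc_length g a b + arc_length g b c \<le> arc_length g a c"
proof -
  have ne: "{D. D division_of {x..y}} \<noteq> {}" for x y :: real
    using elementary_interval[of x y] by (auto simp: box_real)
  have "arc_length g a b + arc_length g b c =
      (SUP E\<in>{E. E division_of {b..c}}. SUP D\<in>{D. D division_of {a..b}}. ennreal (chord_sum g D) + ennreal (chord_sum g E))"
    unfolding arc_length_def using ne by (simp add: ennreal_SUP_add_left ennreal_SUP_add_right)
  also have "\<dots> \<le> arc_length g a c"
  proof (intro SUP_least)
    fix D E assume "D \<in> {D. D division_of {a..b}}" "E \<in> {E. E division_of {b..c}}"
    then have DE: "D division_of {a..b}" "E division_of {b..c}" by auto
    have "ennreal (chord_sum g D) + ennreal (chord_sum g E) = ennreal (chord_sum g (D \<union> E))"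
      by (simp add: chord_sum_adjacent[OF DE] chord_sum_nonneg)
    also have "\<dots> \<le> arc_length g a c"
      by (intro chord_sum_le_arc_length division_of_adjacent[OF DE assms])
    finally show "ennreal (chord_sum g D) + ennreal (chord_sum g E) \<le> arc_length g a c" .
  qed
  finally show ?thesis .
qed

lemma arc_length_mono:
  assumes "a \<le> b" "b \<le> c" "c \<le> d"
  shows "arc_length g b c \<le> arc_length g a d"
proof -
  have "arc_length g b c \<le> arc_length g a b + arc_length g b c" by simp
  also have "\<dots> \<le> arc_length g a c" using assms by (intro arc_length_superadditive)
  also have "\<dots> \<le> arc_length g a c + arc_length g c d" by simp
  also have "\<dots> \<le> arc_length g a d" using assms by (intro arc_length_superadditive) auto
  finally show ?thesis .
qed

lemma chord_sum_restrict:
  fixes D :: "real set set"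
  assumes D: "D division_of {a..c}" and uw: "a \<le> u" "u \<le> w" "w \<le> c"
  shows "(\<Sum>I\<in>D. if {u..w} \<inter> I = {} then 0 else norm (g (Sup ({u..w} \<inter> I)) - g (Inf ({u..w} \<inter> I))))
    \<le> arc_length g u w"
proof -
  let ?E = "{{u..w} \<inter> I | I. I \<in> D \<and> {u..w} \<inter> I \<noteq> {}}"
  let ?F = "{I\<in>D. {u..w} \<inter> I \<noteq> {}}"
  have E: "?E division_of {u..w}" using division_inter_1[OF D, of u w] uw by (simp add: box_real)
  have "(\<Sum>I\<in>D. if {u..w} \<inter> I = {} then 0 else norm (g (Sup ({u..w} \<inter> I)) - g (Inf ({u..w} \<inter> I))))
     = (\<Sum>I\<in>?F. norm (g (Sup ({u..w} \<inter> I)) - g (Inf ({u..w} \<inter> I))))"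
    using division_of_finite[OF D] by (intro sum.mono_neutral_cong_right) auto
  also have "\<dots> = (\<Sum>J\<in>(\<lambda>I. {u..w} \<inter> I) ` ?F. norm (g (Sup J) - g (Inf J)))"
  proof (rule sum.reindex_nontrivial[symmetric, unfolded comp_def])
    show "finite ?F" using D by auto
    fix I J assume IJ: "I \<in> ?F" "J \<in> ?F" "I \<noteq> J" "{u..w} \<inter> I = {u..w} \<inter> J"
    have "{u..w} \<inter> I \<in> ?E" using IJ by (auto simp: box_real)
    then obtain x y where xy: "x \<le> y" "{u..w} \<inter> I = {x..y}" by (rule division_intervalE[OF E])
    have "interior I \<inter> interior J = {}" using IJ(1-3) division_ofD(5)[OF D] by blast
    moreover have "{x..y} \<subseteq> I" "{x..y} \<subseteq> J" using xy(2) IJ(4) by blast+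
    then have "interior {x..y} \<subseteq> interior I" "interior {x..y} \<subseteq> interior J" by (simp_all only: interior_mono)
    then have "{x<..<y} \<subseteq> interior I" "{x<..<y} \<subseteq> interior J" by simp_all
    ultimately have "{x<..<y} = {}" by blast
    then have "x = y" using xy(1) by simp
    then show "norm (g (Sup ({u..w} \<inter> I)) - g (Inf ({u..w} \<inter> I))) = 0" unfolding xy(2) by simp
  qed
  also have "(\<lambda>I. {u..w} \<inter> I) ` ?F = ?E" by (auto simp: box_real)
  also have "ennreal (\<Sum>J\<in>?E. norm (g (Sup J) - g (Inf J))) \<le> arc_length g u w"
    using chord_sum_le_arc_length[of ?E u w g] E by (simp add: box_real chord_sum_def)
  finally show ?thesis .
qed

lemma arc_length_subadditive:
  assumes "a \<le> b" "b \<le> c"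
  shows "arc_length g a c \<le> arc_length g a b + arc_length g b c"
proof (rule arc_length_leI)
  fix D assume D: "D division_of {a..c}"
  let ?f = "\<lambda>A I. if A \<inter> I = {} then 0 else norm (g (Sup (A \<inter> I)) - g (Inf (A \<inter> I)))"
  have "chord_sum g D \<le> (\<Sum>I\<in>D. ?f {a..b} I + ?f {b..c} I)" unfolding chord_sum_def
  proof (rule sum_mono)
    fix I assume "I \<in> D"
    then obtain u w where I: "u \<le> w" "I = {u..w}" "{u..w} \<subseteq> {a..c}" using division_intervalE[OF D] by blast
    consider "w < b" | "b < u" | "u \<le> b" "b \<le> w" by linarith
    then show "norm (g (Sup I) - g (Inf I)) \<le> ?f {a..b} I + ?f {b..c} I"
    proof cases
      case 1
      then have "{a..b} \<inter> I = I" using I by auto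
      then show ?thesis using I by simp
    next
      case 2
      then have "{b..c} \<inter> I = I" using I by auto
      then show ?thesis using I by simp
    next
      case 3
      then have "{a..b} \<inter> I = {u..b}" "{b..c} \<inter> I = {b..w}" using I by auto
      then show ?thesis using 3 I norm_triangle_ineq[of "g w - g b" "g b - g u"] by simp
    qed
  qed
  also have "ennreal (\<Sum>I\<in>D. ?f {a..b} I + ?f {b..c} I) = ennreal (\<Sum>I\<in>D. ?f {a..b} I) + ennreal (\<Sum>I\<in>D. ?f {b..c} I)"
    by (subst sum.distrib, rule ennreal_plus) (auto intro!: sum_nonneg)
  also have "\<dots> \<le> arc_length g a b + arc_length g b c"
    using assms by (intro add_mono chord_sum_restrict[OF D]) auto
  finally show "ennreal (chord_sum g D) \<le> arc_length g a b + arc_length g b c"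
    by (simp add: ennreal_leI)
qed

lemma arc_length_additive:
  "a \<le> b \<Longrightarrow> b \<le> c \<Longrightarrow> arc_length g a c = arc_length g a b + arc_length g b c"
  by (intro antisym arc_length_subadditive arc_length_superadditive)

lemma arc_length_refl: "arc_length g a a = 0"
proof -
  have *: "norm (g t - g s) \<le> 0 * (t - s)" if "a \<le> s" "s \<le> t" "t \<le> a" for s t
  proof -
    have "s = t" using that by linarith
    then show ?thesis by simp
  qed
  have "arc_length g a a \<le> ennreal (0 * (a - a))" by (rule arc_length_lipschitz[OF *]) (assumption | rule order_refl)+
  then show ?thesis by simp
qed

lemma division_of_affine:
  fixes a b c m :: real
  assumes D: "D division_of {a..b}" and c: "0 < c" and ab: "a \<le> b"
  shows "(\<lambda>I. (\<lambda>x. m + c * x) ` I) ` D division_of {m + c * a..m + c * b}"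
proof (rule division_ofI)
  have im: "(\<lambda>x. m + c * x) ` {u..w} = {m + c * u..m + c * w}" if "u \<le> w" for u w
    using image_affinity_atLeastAtMost[of c m u w] c that by (simp add: add.commute)
  show "finite ((\<lambda>I. (\<lambda>x. m + c * x) ` I) ` D)" using D by auto
  show "\<Union> ((\<lambda>I. (\<lambda>x. m + c * x) ` I) ` D) = {m + c * a..m + c * b}"
    unfolding image_Union[symmetric] division_ofD(6)[OF D] by (rule im[OF ab])
  fix K assume "K \<in> (\<lambda>I. (\<lambda>x. m + c * x) ` I) ` D"
  then obtain I where I: "I \<in> D" "K = (\<lambda>x. m + c * x) ` I" by auto
  then obtain u w where uw: "u \<le> w" "I = {u..w}" "{u..w} \<subseteq> {a..b}" using division_intervalE[OF D] by blast
  show "K \<subseteq> {m + c * a..m + c * b}" unfolding I(2) uw(2) im[OF ab, symmetric] by (rule image_mono[OF uw(3)])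
  show "K \<noteq> {}" using I uw by auto
  show "\<exists>a b. K = cbox a b" unfolding I(2) uw(2) im[OF uw(1)] by (metis box_real(2))
  fix K' assume "K' \<in> (\<lambda>I. (\<lambda>x. m + c * x) ` I) ` D" and ne: "K \<noteq> K'"
  then obtain I' where I': "I' \<in> D" "K' = (\<lambda>x. m + c * x) ` I'" by auto
  then obtain u' w' where uw': "u' \<le> w'" "I' = {u'..w'}" using division_intervalE[OF D] by blast
  have "interior I \<inter> interior I' = {}" using ne I I' by (intro division_ofD(5)[OF D I(1) I'(1)]) auto
  then have "{u<..<w} \<inter> {u'<..<w'} = {}" using uw uw' by (simp add: interior_atLeastAtMost_real)
  have "max u u' \<ge> min w w'"
  proof (rule ccontr)
    assume "\<not> max u u' \<ge> min w w'"
    then obtain t where "max u u' < t" "t < min w w'" using dense by (metis not_le)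
    then have "t \<in> {u<..<w} \<inter> {u'<..<w'}" by auto
    then show False using \<open>{u<..<w} \<inter> {u'<..<w'} = {}\<close> by blast
  qed
  then have "max (m + c * u) (m + c * u') \<ge> min (m + c * w) (m + c * w')"
    using c by (auto simp: max_def min_def split: if_splits)
  then show "interior K \<inter> interior K' = {}"
    unfolding I(2) I'(2) uw(2) uw'(2) im[OF uw(1)] im[OF uw'(1)] by auto
qed

lemma arc_length_affine_reparam:
  fixes a b c m :: real
  assumes "0 \<le> c" "a \<le> b"
  shows "arc_length (\<lambda>x. g (m + c * x)) a b \<le> arc_length g (m + c * a) (m + c * b)"
proof (cases "c = 0")
  case True
  then have "arc_length (\<lambda>x. g (m + c * x)) a b \<le> ennreal (0 * (b - a))"
    using assms by (intro arc_length_lipschitz) auto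
  then show ?thesis by simp
next
  case False
  then have c: "c > 0" using assms by simp
  show ?thesis
  proof (rule arc_length_leI)
    fix D assume D: "D division_of {a..b}"
    have inj: "inj_on (\<lambda>I. (\<lambda>x. m + c * x) ` I) D"
    proof (rule inj_onI)
      fix I J assume "(\<lambda>x. m + c * x) ` I = (\<lambda>x. m + c * x) ` J"
      moreover have "inj (\<lambda>x. m + c * x)" using c by (auto simp: inj_on_def)
      ultimately show "I = J" by (simp only: inj_image_eq_iff)
    qed
    have "chord_sum (\<lambda>x. g (m + c * x)) D = chord_sum g ((\<lambda>I. (\<lambda>x. m + c * x) ` I) ` D)"
      unfolding chord_sum_def sum.reindex[OF inj] comp_def
    proof (rule sum.cong)
      fix I assume "I \<in> D"
      then obtain u w where uw: "u \<le> w" "I = {u..w}" using division_intervalE[OF D] by blast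
      have "(\<lambda>x. m + c * x) ` {u..w} = {m + c * u..m + c * w}"
        using image_affinity_atLeastAtMost[of c m u w] c uw by (simp add: add.commute)
      then show "norm (g (m + c * Sup I) - g (m + c * Inf I)) =
          norm (g (Sup ((\<lambda>x. m + c * x) ` I)) - g (Inf ((\<lambda>x. m + c * x) ` I)))" using uw c by simp
    qed simp
    then show "ennreal (chord_sum (\<lambda>x. g (m + c * x)) D) \<le> arc_length g (m + c * a) (m + c * b)"
      using chord_sum_le_arc_length[OF division_of_affine[OF D c assms(2)]] by simp
  qed
qed

lemma tagged_sum_eq_chord_sum:
  assumes P: "P tagged_division_of S"
  shows "(\<Sum>(t, I)\<in>P. norm (g (Sup I) - g (Inf I))) = chord_sum g (snd ` P)"
proof -
  let ?d = "\<lambda>I. if I = {} then 0 else norm (g (Sup I) - g (Inf I))"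
  have ne: "I \<noteq> {}" if "(t, I) \<in> P" for t I using tagged_division_ofD(2)[OF P that] by auto
  have "(\<Sum>(t, I)\<in>P. norm (g (Sup I) - g (Inf I))) = (\<Sum>(t, I)\<in>P. ?d I)"
    using ne by (intro sum.cong) auto
  also have "\<dots> = sum ?d (snd ` P)"
  proof (rule sum.over_tagged_division_lemma[OF P])
    fix u v :: real assume "box u v = {}"
    then have "u = v \<or> cbox u v = {}" by (auto simp: box_real)
    then show "?d (cbox u v) = 0" by auto
  qed
  also have "\<dots> = chord_sum g (snd ` P)" unfolding chord_sum_def using ne by (intro sum.cong) auto
  finally show ?thesis .
qed

lemma absolutely_continuous_mean_value:
  fixes \<gamma> :: "real \<Rightarrow> 'b::euclidean_space" and \<Lambda> :: "'b \<Rightarrow> real"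
  assumes ac: "abs_continuous_on {0..1} \<gamma>" and ab: "0 \<le> a" "a \<le> b" "b \<le> 1"
    and lin: "bounded_linear \<Lambda>" and M: "0 \<le> M"
    and ae: "AE t in lebesgue. t \<in> {a..b} \<longrightarrow>
       (\<exists>v. (\<gamma> has_vector_derivative v) (at t within {0..1}) \<and> \<bar>\<Lambda> v\<bar> \<le> M * norm v)"
    and len: "arc_length \<gamma> a b \<le> ennreal c" and l: "0 \<le> c"
  shows "\<bar>\<Lambda> (\<gamma> b - \<gamma> a)\<bar> \<le> M * c"
proof -
  interpret \<Lambda>: bounded_linear \<Lambda> by fact
  obtain K where K: "K > 0" "\<And>x. \<bar>\<Lambda> x\<bar> \<le> norm x * K" using \<Lambda>.pos_bounded by auto
  define N where "N = {t\<in>{a..b}. \<not> (\<exists>v. (\<gamma> has_vector_derivative v) (at t within {0..1}) \<and> \<bar>\<Lambda> v\<bar> \<le> M * norm v)}"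
  have N: "N \<in> null_sets lebesgue"
  proof -
    obtain N' where "N' \<in> null_sets lebesgue" "{t \<in> space lebesgue. \<not> (t \<in> {a..b} \<longrightarrow>
       (\<exists>v. (\<gamma> has_vector_derivative v) (at t within {0..1}) \<and> \<bar>\<Lambda> v\<bar> \<le> M * norm v))} \<subseteq> N'"
      using ae unfolding eventually_ae_filter by blast
    then show ?thesis by (intro null_sets_completion_subset[of N N']) (auto simp: N_def)
  qed
  have main: "\<bar>\<Lambda> (\<gamma> b - \<gamma> a)\<bar> \<le> M * c + (M + K) * e * (b - a) + K * e" if e: "e > 0" for e
  proof -
    obtain \<delta> where \<delta>: "\<delta> > 0" "\<And>D T. D division_of T \<Longrightarrow> T \<subseteq> {0..1} \<Longrightarrow> (\<Sum>I\<in>D. Sup I - Inf I) < \<delta> \<Longrightarrow> chord_sum \<gamma> D < e"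
      using ac e unfolding abs_continuous_on_def chord_sum_def by metis
    obtain G where G: "open G" "N \<subseteq> G" "G - N \<in> lmeasurable" "emeasure lebesgue (G - N) < ennreal \<delta>"
      using sets_lebesgue_outer_open[of N \<delta>] N \<delta> by auto
    have "emeasure lebesgue G \<le> emeasure lebesgue (G - N) + emeasure lebesgue N"
      using G N by (intro order_trans[OF emeasure_mono emeasure_subadditive]) (auto simp: fmeasurable_def)
    then have eG: "emeasure lebesgue G < ennreal \<delta>" using G N by auto
    have "\<exists>d>0. (t \<in> N \<longrightarrow> ball t d \<subseteq> G) \<and> (t \<in> {a..b} - N \<longrightarrow> (\<exists>v. \<bar>\<Lambda> v\<bar> \<le> M * norm v \<and>
        (\<forall>s\<in>{0..1}. \<bar>s - t\<bar> < d \<longrightarrow> norm (\<gamma> s - \<gamma> t - (s - t) *\<^sub>R v) \<le> e * \<bar>s - t\<bar>)))" for t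
    proof (cases "t \<in> N")
      case True
      then show ?thesis using G open_contains_ball by blast
    next
      case False
      show ?thesis
      proof (cases "t \<in> {a..b}")
        case True
        then obtain v where v: "(\<gamma> has_vector_derivative v) (at t within {0..1})" "\<bar>\<Lambda> v\<bar> \<le> M * norm v"
          using False N_def by auto
        then obtain d where "d > 0" "\<forall>s\<in>{0..1}. norm (s - t) < d \<longrightarrow> norm (\<gamma> s - \<gamma> t - (s - t) *\<^sub>R v) \<le> e * norm (s - t)"
          using e unfolding has_vector_derivative_def has_derivative_within_alt by blast
        then show ?thesis using v False by (intro exI[of _ d]) auto
      qed (use False in \<open>auto intro: exI[of _ 1]\<close>)
    qed
    then obtain d where d: "\<And>t. d t > 0" "\<And>t. t \<in> N \<Longrightarrow> ball t (d t) \<subseteq> G"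
      "\<And>t. t \<in> {a..b} - N \<Longrightarrow> \<exists>v. \<bar>\<Lambda> v\<bar> \<le> M * norm v \<and>
        (\<forall>s\<in>{0..1}. \<bar>s - t\<bar> < d t \<longrightarrow> norm (\<gamma> s - \<gamma> t - (s - t) *\<^sub>R v) \<le> e * \<bar>s - t\<bar>)"
      by metis
    have "gauge (\<lambda>t. ball t (d t))" using d(1) by (simp add: gauge_ball_dependent)
    then obtain P where P: "P tagged_division_of {a..b}" "(\<lambda>t. ball t (d t)) fine P"
      by (rule fine_division_exists_real)
    have tag: "\<exists>u w. u \<le> t \<and> t \<le> w \<and> I = {u..w} \<and> a \<le> u \<and> w \<le> b \<and> I \<subseteq> ball t (d t)" if tI: "(t, I) \<in> P" for t I
    proof -
      obtain u w where I: "I = {u..w}" using tagged_division_ofD(4)[OF P(1) tI] by (auto simp: box_real)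
      moreover have "t \<in> I" "I \<subseteq> {a..b}" using tagged_division_ofD(2,3)[OF P(1) tI] by auto
      moreover have "I \<subseteq> ball t (d t)" using P(2) tI by (auto simp: fine_def)
      ultimately show ?thesis by auto
    qed
    let ?inc = "\<lambda>I. \<gamma> (Sup I) - \<gamma> (Inf I)"
    have finP: "finite P" using P(1) by auto
    define Q where "Q = {x\<in>P. fst x \<in> N}"
    have "\<Lambda> (\<gamma> b - \<gamma> a) = (\<Sum>(t, I)\<in>P. \<Lambda> (?inc I))"
      using additive_tagged_division_1[OF ab(2) P(1), of \<gamma>] \<Lambda>.sum[of "\<lambda>(t, I). ?inc I" P]
      by (simp add: case_prod_unfold)
    also have "\<bar>\<dots>\<bar> \<le> (\<Sum>(t, I)\<in>P. \<bar>\<Lambda> (?inc I)\<bar>)"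
      by (rule order_trans[OF sum_abs]) (simp add: case_prod_unfold)
    also have "\<dots> = (\<Sum>(t, I)\<in>P - Q. \<bar>\<Lambda> (?inc I)\<bar>) + (\<Sum>(t, I)\<in>Q. \<bar>\<Lambda> (?inc I)\<bar>)"
      using finP by (intro sum.subset_diff) (auto simp: Q_def)
    finally have split: "\<bar>\<Lambda> (\<gamma> b - \<gamma> a)\<bar> \<le> (\<Sum>(t, I)\<in>P - Q. \<bar>\<Lambda> (?inc I)\<bar>) + (\<Sum>(t, I)\<in>Q. \<bar>\<Lambda> (?inc I)\<bar>)" .
    have "(\<Sum>(t, I)\<in>P - Q. \<bar>\<Lambda> (?inc I)\<bar>) \<le> (\<Sum>(t, I)\<in>P - Q. M * norm (?inc I) + (M + K) * e * (Sup I - Inf I))"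
    proof (rule sum_mono, clarify)
      fix t I assume tI: "(t, I) \<in> P" "(t, I) \<notin> Q"
      obtain u w where I: "u \<le> t" "t \<le> w" "I = {u..w}" "a \<le> u" "w \<le> b" "I \<subseteq> ball t (d t)" using tag[OF tI(1)] by auto
      have "t \<in> {a..b} - N" using I tI by (auto simp: Q_def)
      then obtain v where v: "\<bar>\<Lambda> v\<bar> \<le> M * norm v"
        "\<And>s. s \<in> {0..1} \<Longrightarrow> \<bar>s - t\<bar> < d t \<Longrightarrow> norm (\<gamma> s - \<gamma> t - (s - t) *\<^sub>R v) \<le> e * \<bar>s - t\<bar>"
        using d(3) by blast
      have "u \<in> I" "w \<in> I" using I(1-3) by auto
      then have uw: "u \<in> ball t (d t)" "w \<in> ball t (d t)" using I(6) by blast+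
      define r where "r = \<gamma> w - \<gamma> u - (w - u) *\<^sub>R v"
      have req: "r = (\<gamma> w - \<gamma> t - (w - t) *\<^sub>R v) - (\<gamma> u - \<gamma> t - (u - t) *\<^sub>R v)"
        by (simp add: r_def algebra_simps)
      have "norm r \<le> norm (\<gamma> w - \<gamma> t - (w - t) *\<^sub>R v) + norm (\<gamma> u - \<gamma> t - (u - t) *\<^sub>R v)"
        unfolding req by (rule norm_triangle_ineq4)
      also have "\<dots> \<le> e * \<bar>w - t\<bar> + e * \<bar>u - t\<bar>"
        using I uw ab by (intro add_mono v(2)) (auto simp: dist_real_def abs_minus_commute)
      also have "\<dots> = e * (w - u)" using I by (simp add: algebra_simps)
      finally have r: "norm r \<le> e * (w - u)" .
      have inc: "\<gamma> w - \<gamma> u = (w - u) *\<^sub>R v + r" by (simp add: r_def)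
      have "\<bar>\<Lambda> (\<gamma> w - \<gamma> u)\<bar> \<le> (w - u) * \<bar>\<Lambda> v\<bar> + \<bar>\<Lambda> r\<bar>"
        unfolding inc \<Lambda>.add \<Lambda>.scaleR using I by (intro order_trans[OF abs_triangle_ineq]) (simp add: abs_mult)
      also have "\<dots> \<le> (w - u) * (M * norm v) + (e * (w - u)) * K"
      proof (rule add_mono)
        show "(w - u) * \<bar>\<Lambda> v\<bar> \<le> (w - u) * (M * norm v)" using I v(1) by (intro mult_left_mono) auto
        have "norm r * K \<le> (e * (w - u)) * K" using K r by (intro mult_right_mono) auto
        then show "\<bar>\<Lambda> r\<bar> \<le> (e * (w - u)) * K" using K(2)[of r] by linarith
      qed
      also have "(w - u) * (M * norm v) = M * norm ((\<gamma> w - \<gamma> u) - r)" using I by (simp add: inc)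
      also have "\<dots> \<le> M * (norm (\<gamma> w - \<gamma> u) + e * (w - u))"
        using M r norm_triangle_ineq4[of "\<gamma> w - \<gamma> u" r] by (intro mult_left_mono) auto
      finally show "\<bar>\<Lambda> (?inc I)\<bar> \<le> M * norm (?inc I) + (M + K) * e * (Sup I - Inf I)"
        using I by (simp add: algebra_simps)
    qed
    also have "\<dots> \<le> (\<Sum>(t, I)\<in>P. M * norm (?inc I) + (M + K) * e * (Sup I - Inf I))"
    proof (rule sum_mono2[OF finP])
      fix x assume "x \<in> P - (P - Q)"
      then obtain t I where "x = (t, I)" "(t, I) \<in> P" by (cases x) auto
      with tag[of t I] show "0 \<le> (case x of (t, I) \<Rightarrow> M * norm (?inc I) + (M + K) * e * (Sup I - Inf I))"
        using M K e by auto
    qed auto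
    also have "\<dots> = M * (\<Sum>(t, I)\<in>P. norm (?inc I)) + (M + K) * e * (\<Sum>(t, I)\<in>P. Sup I - Inf I)"
      by (simp add: case_prod_unfold sum.distrib sum_distrib_left)
    also have "\<dots> = M * chord_sum \<gamma> (snd ` P) + (M + K) * e * (b - a)"
      using tagged_sum_eq_chord_sum[OF P(1), of \<gamma>] additive_tagged_division_1[OF ab(2) P(1), of "\<lambda>x. x"] by simp
    finally have good: "(\<Sum>(t, I)\<in>P - Q. \<bar>\<Lambda> (?inc I)\<bar>) \<le> M * chord_sum \<gamma> (snd ` P) + (M + K) * e * (b - a)" .
    have "chord_sum \<gamma> (snd ` P) \<le> c"
    proof -
      have "ennreal (chord_sum \<gamma> (snd ` P)) \<le> ennreal c"
        using chord_sum_le_arc_length[OF division_of_tagged_division[OF P(1)], of \<gamma>] len by (rule order_trans)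
      then show ?thesis using l by (simp add: ennreal_le_iff)
    qed
    then have Mc: "M * chord_sum \<gamma> (snd ` P) \<le> M * c" using M by (rule mult_left_mono)
    have bad: "(\<Sum>(t, I)\<in>Q. \<bar>\<Lambda> (?inc I)\<bar>) \<le> K * (\<Sum>(t, I)\<in>Q. norm (?inc I))"
      unfolding sum_distrib_left case_prod_unfold
    proof (rule sum_mono)
      fix x assume "x \<in> Q"
      show "\<bar>\<Lambda> (?inc (snd x))\<bar> \<le> K * norm (?inc (snd x))" using K(2)[of "?inc (snd x)"] by (simp only: mult.commute)
    qed
    have "(\<Sum>(t, I)\<in>Q. norm (?inc I)) \<le> e"
    proof -
      have "P tagged_partial_division_of {a..b}" using P(1) unfolding tagged_division_of_def by blast
      moreover have "Q \<subseteq> P" unfolding Q_def by blast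
      ultimately have "Q tagged_partial_division_of {a..b}" by (rule tagged_partial_division_subset)
      then have Q: "Q tagged_division_of \<Union>(snd ` Q)" by (rule tagged_partial_division_of_Union_self)
      then have sQ: "snd ` Q division_of \<Union>(snd ` Q)" by (rule division_of_tagged_division)
      have sub: "\<Union>(snd ` Q) \<subseteq> {0..1} \<inter> G"
      proof
        fix x assume "x \<in> \<Union>(snd ` Q)"
        then obtain t I where tI: "(t, I) \<in> Q" "x \<in> I" by force
        then have "(t, I) \<in> P" "t \<in> N" unfolding Q_def by auto
        from tag[OF this(1)] obtain u w where "I = {u..w}" "a \<le> u" "w \<le> b" "I \<subseteq> ball t (d t)" by blast
        moreover have "ball t (d t) \<subseteq> G" using d(2) \<open>t \<in> N\<close> by blast
        ultimately show "x \<in> {0..1} \<inter> G" using tI(2) ab by auto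
      qed
      have "emeasure lebesgue (\<Union>(snd ` Q)) < ennreal \<delta>"
        using sub G(1) by (intro le_less_trans[OF emeasure_mono eG]) auto
      then have "measure lebesgue (\<Union>(snd ` Q)) < \<delta>"
        unfolding measure_def by (cases "emeasure lebesgue (\<Union>(snd ` Q))") (auto simp: ennreal_less_iff)
      then have "chord_sum \<gamma> (snd ` Q) < e"
        using sub by (intro \<delta>(2)[OF sQ]) (auto simp: sum_lengths_division[OF sQ])
      moreover have "(\<Sum>(t, I)\<in>Q. norm (?inc I)) = chord_sum \<gamma> (snd ` Q)"
        by (rule tagged_sum_eq_chord_sum[OF Q])
      ultimately show ?thesis by simp
    qed
    then have "K * (\<Sum>(t, I)\<in>Q. norm (?inc I)) \<le> K * e" using K(1) by simp
    then show ?thesis using split good Mc bad by linarith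
  qed
  show ?thesis
  proof (rule field_le_epsilon)
    fix e :: real assume e: "e > 0"
    define C where "C = (M + K) * (b - a) + K"
    have C: "C > 0" unfolding C_def using M K ab by (intro add_nonneg_pos mult_nonneg_nonneg) auto
    define e' where "e' = e / C"
    have "\<bar>\<Lambda> (\<gamma> b - \<gamma> a)\<bar> \<le> M * c + (M + K) * e' * (b - a) + K * e'"
      using main[of e'] e C by (simp add: e'_def)
    also have "\<dots> = M * c + C * e'" by (simp add: C_def algebra_simps)
    also have "\<dots> = M * c + e" using C by (simp add: e'_def)
    finally show "\<bar>\<Lambda> (\<gamma> b - \<gamma> a)\<bar> \<le> M * c + e" .
  qed
qed

locale first_order_distribution =
  fixes V :: "'b::euclidean_space \<Rightarrow> 'b set"
  assumes subspace_V: "subspace (V p)"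
    and first_order_annihilator:
      "(\<forall>v\<in>V p. \<zeta> \<bullet> v = 0) \<Longrightarrow> \<exists>B. bounded_bilinear B \<and> annihilates_to_first_order V p \<zeta> B"

definition chord_controlled :: "('b::euclidean_space \<Rightarrow> 'b set) \<Rightarrow> real \<Rightarrow> 'b \<Rightarrow> 'b \<Rightarrow> bool" where
  "chord_controlled V c q q' \<longleftrightarrow> (\<forall>p \<zeta> B K \<eta> \<delta> R. bounded_bilinear B \<longrightarrow> (\<forall>x y. \<bar>B x y\<bar> \<le> K * norm x * norm y) \<longrightarrow>
     0 \<le> K \<longrightarrow> 0 \<le> \<eta> \<longrightarrow>
     (\<forall>q w. norm (q - p) < \<delta> \<longrightarrow> w \<in> V q \<longrightarrow> \<bar>\<zeta> \<bullet> w - B (q - p) w\<bar> \<le> \<eta> * norm (q - p) * norm w) \<longrightarrow>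
     norm (q - p) + c \<le> R \<longrightarrow> R < \<delta> \<longrightarrow> \<bar>\<zeta> \<bullet> (q' - q) - B (q - p) (q' - q)\<bar> \<le> (\<eta> * R + K * c) * c)"

lemma chord_controlledD:
  assumes "chord_controlled V c q q'" "bounded_bilinear B" "\<And>x y. \<bar>B x y\<bar> \<le> K * norm x * norm y" "0 \<le> K" "0 \<le> \<eta>"
    and "\<And>q w. norm (q - p) < \<delta> \<Longrightarrow> w \<in> V q \<Longrightarrow> \<bar>\<zeta> \<bullet> w - B (q - p) w\<bar> \<le> \<eta> * norm (q - p) * norm w"
    and "norm (q - p) + c \<le> R" "R < \<delta>"
  shows "\<bar>\<zeta> \<bullet> (q' - q) - B (q - p) (q' - q)\<bar> \<le> (\<eta> * R + K * c) * c"
  using assms(1)[unfolded chord_controlled_def, rule_format, of B K \<eta> p \<delta> \<zeta> R] assms(2-) by blast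

lemma horizontal_chord_controlled:
  assumes hor: "horizontal V \<gamma>" and ab: "0 \<le> a" "a \<le> b" "b \<le> 1"
    and len: "arc_length \<gamma> a b \<le> ennreal c" and c: "0 \<le> c"
  shows "chord_controlled V c (\<gamma> a) (\<gamma> b)"
  unfolding chord_controlled_def
proof (intro allI impI)
  fix p \<zeta> B K \<eta> \<delta> R
  assume B: "bounded_bilinear B" and K: "\<forall>x y. \<bar>B x y\<bar> \<le> K * norm x * norm y" "0 \<le> K" and \<eta>: "0 \<le> \<eta>"
    and ann: "\<forall>q w. norm (q - p) < \<delta> \<longrightarrow> w \<in> V q \<longrightarrow> \<bar>\<zeta> \<bullet> w - B (q - p) w\<bar> \<le> \<eta> * norm (q - p) * norm w"
    and R: "norm (\<gamma> a - p) + c \<le> R" "R < \<delta>"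
  interpret B: bounded_bilinear B by fact
  have R0: "0 \<le> R" using R(1) c norm_ge_zero[of "\<gamma> a - p"] by linarith
  let ?L = "\<lambda>v. \<zeta> \<bullet> v - B (\<gamma> a - p) v"
  have "\<bar>?L (\<gamma> b - \<gamma> a)\<bar> \<le> (\<eta> * R + K * c) * c"
  proof (rule absolutely_continuous_mean_value[where \<gamma> = \<gamma>])
    show "abs_continuous_on {0..1} \<gamma>" using hor by (simp add: horizontal_def)
    show "bounded_linear ?L" by (intro bounded_linear_sub bounded_linear_inner_right B.bounded_linear_right)
    show "0 \<le> \<eta> * R + K * c" using \<eta> R0 K c by simp
    show "AE t in lebesgue. t \<in> {a..b} \<longrightarrow> (\<exists>v. (\<gamma> has_vector_derivative v) (at t within {0..1}) \<and>
        \<bar>?L v\<bar> \<le> (\<eta> * R + K * c) * norm v)"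
      using hor[unfolded horizontal_def, THEN conjunct2]
    proof (rule eventually_mono, intro impI)
      fix t assume h: "t \<in> {0..1} \<longrightarrow> (\<exists>v\<in>V (\<gamma> t). (\<gamma> has_vector_derivative v) (at t within {0..1}))"
        and t: "t \<in> {a..b}"
      then obtain v where v: "v \<in> V (\<gamma> t)" "(\<gamma> has_vector_derivative v) (at t within {0..1})" using ab by auto
      have "ennreal (norm (\<gamma> t - \<gamma> a)) \<le> arc_length \<gamma> a t" using t by (intro norm_le_arc_length) auto
      also have "\<dots> \<le> arc_length \<gamma> a b" using t by (intro arc_length_mono) auto
      finally have "ennreal (norm (\<gamma> t - \<gamma> a)) \<le> ennreal c" using len by (rule order_trans)
      then have ta: "norm (\<gamma> t - \<gamma> a) \<le> c" using c by (simp add: ennreal_le_iff)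
      have "norm (\<gamma> t - p) \<le> norm (\<gamma> a - p) + norm (\<gamma> t - \<gamma> a)"
        using norm_triangle_ineq[of "\<gamma> a - p" "\<gamma> t - \<gamma> a"] by simp
      then have tp: "norm (\<gamma> t - p) \<le> R" using ta R by linarith
      have "?L v = (\<zeta> \<bullet> v - B (\<gamma> t - p) v) + B (\<gamma> t - \<gamma> a) v"
        using B.diff_left[of "\<gamma> t - p" "\<gamma> a - p" v] by (simp add: algebra_simps)
      then have "\<bar>?L v\<bar> \<le> \<bar>\<zeta> \<bullet> v - B (\<gamma> t - p) v\<bar> + \<bar>B (\<gamma> t - \<gamma> a) v\<bar>" by linarith
      also have "\<dots> \<le> \<eta> * norm (\<gamma> t - p) * norm v + K * norm (\<gamma> t - \<gamma> a) * norm v"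
        using ann v tp R K by (intro add_mono) auto
      also have "\<dots> \<le> \<eta> * R * norm v + K * c * norm v"
        using tp ta \<eta> K by (intro add_mono mult_right_mono mult_left_mono) auto
      finally have "\<bar>?L v\<bar> \<le> (\<eta> * R + K * c) * norm v" by (simp add: distrib_right)
      then show "\<exists>v. (\<gamma> has_vector_derivative v) (at t within {0..1}) \<and> \<bar>?L v\<bar> \<le> (\<eta> * R + K * c) * norm v"
        using v by blast
    qed
  qed (use ab len c in auto)
  then show "\<bar>\<zeta> \<bullet> (\<gamma> b - \<gamma> a) - B (\<gamma> a - p) (\<gamma> b - \<gamma> a)\<bar> \<le> (\<eta> * R + K * c) * c" .
qed

lemma cc_dist_lessE:
  assumes "cc_dist V q q' < c"
  obtains \<gamma> where "horizontal V \<gamma>" "\<gamma> 0 = q" "\<gamma> 1 = q'" "arc_length \<gamma> 0 1 < c"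
  using assms unfolding cc_dist_def INF_less_iff curve_length_eq_arc_length by blast

lemma cc_dist_chord_controlled:
  assumes "cc_dist V q q' < ennreal c"
  shows "chord_controlled V c q q'"
proof -
  obtain \<gamma> where g: "horizontal V \<gamma>" "\<gamma> 0 = q" "\<gamma> 1 = q'" "arc_length \<gamma> 0 1 < ennreal c"
    using cc_dist_lessE[OF assms] .
  have "0 < ennreal c" using g(4) by (rule le_less_trans[OF zero_le])
  then have "0 \<le> c" by (simp add: ennreal_less_zero_iff less_imp_le)
  then show ?thesis using horizontal_chord_controlled[OF g(1), of 0 1 c] g by (simp add: less_imp_le)
qed

lemma norm_le_cc_dist: "ennreal (norm (q' - q)) \<le> cc_dist V q q'"
  unfolding cc_dist_def curve_length_eq_arc_length
proof (rule INF_greatest)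
  fix \<gamma> assume "\<gamma> \<in> {\<gamma>. horizontal V \<gamma> \<and> \<gamma> 0 = q \<and> \<gamma> 1 = q'}"
  then show "ennreal (norm (q' - q)) \<le> arc_length \<gamma> 0 1" using norm_le_arc_length[of 0 1 \<gamma>] by auto
qed

definition tangent_at :: "('b::euclidean_space \<Rightarrow> 'b set) \<Rightarrow> (real \<Rightarrow> 'b) \<Rightarrow> real set \<Rightarrow> real \<Rightarrow> bool" where
  "tangent_at V G S t \<longleftrightarrow> (\<forall>\<zeta>. (\<forall>v\<in>V (G t). \<zeta> \<bullet> v = 0) \<longrightarrow>
     (\<forall>\<epsilon>>0. \<exists>\<delta>>0. \<forall>s\<in>S. \<bar>s - t\<bar> < \<delta> \<longrightarrow> \<bar>\<zeta> \<bullet> (G s - G t)\<bar> \<le> \<epsilon> * \<bar>s - t\<bar>))"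

lemma tangent_at_subset: "tangent_at V G S t \<Longrightarrow> T \<subseteq> S \<Longrightarrow> tangent_at V G T t"
  unfolding tangent_at_def by (meson subsetD)

lemma (in first_order_distribution) tangent_at_if_chord_controlled:
  assumes L: "0 < L" and t: "t \<in> S"
    and lip: "\<And>s. s \<in> S \<Longrightarrow> norm (G s - G t) \<le> L * \<bar>s - t\<bar>"
    and cc: "\<And>s s'. s \<in> S \<Longrightarrow> s' \<in> S \<Longrightarrow> s < s' \<Longrightarrow> chord_controlled V (L * (s' - s)) (G s) (G s')"
  shows "tangent_at V G S t"
  unfolding tangent_at_def
proof (intro allI impI)
  fix \<zeta> and \<epsilon> :: real assume \<zeta>: "\<forall>v\<in>V (G t). \<zeta> \<bullet> v = 0" and \<epsilon>: "\<epsilon> > 0"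
  obtain B where B: "bounded_bilinear B" "annihilates_to_first_order V (G t) \<zeta> B"
    using first_order_annihilator[OF \<zeta>] by blast
  interpret B: bounded_bilinear B by (rule B(1))
  obtain K where K: "K > 0" "\<And>x y. norm (B x y) \<le> norm x * norm y * K" using B.pos_bounded by blast
  have K': "\<bar>B x y\<bar> \<le> K * norm x * norm y" for x y using K(2)[of x y] by (simp add: mult_ac)
  obtain \<delta> where \<delta>: "\<delta> > 0" "\<forall>q w. norm (q - G t) < \<delta> \<longrightarrow> w \<in> V q \<longrightarrow> \<bar>\<zeta> \<bullet> w - B (q - G t) w\<bar> \<le> 1 * norm (q - G t) * norm w"
    using B(2) unfolding annihilates_to_first_order_def by (meson zero_less_one)
  define d where "d = min (\<delta> / (2 * L)) (\<epsilon> / ((2 + 2 * K) * L\<^sup>2))"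
  have "d > 0" using \<delta> \<epsilon> K L by (auto simp: d_def intro!: divide_pos_pos mult_pos_pos add_pos_pos)
  moreover have "\<bar>\<zeta> \<bullet> (G s - G t)\<bar> \<le> \<epsilon> * \<bar>s - t\<bar>" if s: "s \<in> S" "\<bar>s - t\<bar> < d" for s
  proof -
    define c where "c = L * \<bar>s - t\<bar>"
    have c0: "0 \<le> c" using L by (simp add: c_def)
    have "\<bar>s - t\<bar> < \<delta> / (2 * L)" using s by (simp add: d_def)
    then have c: "2 * c < \<delta>" using L by (simp add: c_def field_simps)
    have nst: "norm (G s - G t) \<le> c" using lip[OF s(1)] by (simp add: c_def)
    have "\<bar>\<zeta> \<bullet> (G s - G t)\<bar> \<le> (2 + 2 * K) * c * c"
    proof -
      consider "s = t" | "t < s" | "s < t" by linarith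
      then show ?thesis
      proof cases
        case 1
        then show ?thesis using c0 K by simp
      next
        case 2
        then have "chord_controlled V c (G t) (G s)" using cc[OF t s(1)] by (simp add: c_def)
        then have "\<bar>\<zeta> \<bullet> (G s - G t) - B (G t - G t) (G s - G t)\<bar> \<le> (1 * (2 * c) + K * c) * c"
          by (rule chord_controlledD) (use B(1) K' K(1) \<delta>(2) c c0 in auto)
        then have "\<bar>\<zeta> \<bullet> (G s - G t)\<bar> \<le> (1 * (2 * c) + K * c) * c" by (simp add: B.zero_left)
        also have "\<dots> \<le> (2 + 2 * K) * c * c" using c0 K by (intro mult_right_mono) (auto simp: algebra_simps)
        finally show ?thesis .
      next
        case 3
        then have "chord_controlled V c (G s) (G t)" using cc[OF s(1) t] by (simp add: c_def)
        then have "\<bar>\<zeta> \<bullet> (G t - G s) - B (G s - G t) (G t - G s)\<bar> \<le> (1 * (2 * c) + K * c) * c"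
          by (rule chord_controlledD) (use B(1) K' K(1) \<delta>(2) c nst in auto)
        moreover have "\<bar>B (G s - G t) (G t - G s)\<bar> \<le> K * c * c"
          using nst c0 K(1) by (intro order_trans[OF K'] mult_mono mult_left_mono) (auto simp: norm_minus_commute)
        ultimately have "\<bar>\<zeta> \<bullet> (G t - G s)\<bar> \<le> (1 * (2 * c) + K * c) * c + K * c * c" by linarith
        also have "\<dots> = (2 + 2 * K) * c * c" by (simp add: algebra_simps)
        finally show ?thesis by (simp add: inner_diff_right abs_minus_commute)
      qed
    qed
    also have "\<dots> = (2 + 2 * K) * L\<^sup>2 * \<bar>s - t\<bar> * \<bar>s - t\<bar>" by (simp add: c_def power2_eq_square)
    also have "\<dots> \<le> \<epsilon> * \<bar>s - t\<bar>"
    proof (rule mult_right_mono)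
      have "\<bar>s - t\<bar> \<le> \<epsilon> / ((2 + 2 * K) * L\<^sup>2)" using s by (simp add: d_def)
      moreover have "(2 + 2 * K) * L\<^sup>2 > 0" using K L by (intro mult_pos_pos) auto
      ultimately show "(2 + 2 * K) * L\<^sup>2 * \<bar>s - t\<bar> \<le> \<epsilon>" by (simp add: pos_le_divide_eq mult_ac)
    qed simp
    finally show ?thesis .
  qed
  ultimately show "\<exists>\<delta>>0. \<forall>s\<in>S. \<bar>s - t\<bar> < \<delta> \<longrightarrow> \<bar>\<zeta> \<bullet> (G s - G t)\<bar> \<le> \<epsilon> * \<bar>s - t\<bar>" by blast
qed

lemma abs_continuous_on_lipschitz:
  assumes L: "0 \<le> L" and lip: "\<And>s t. s \<in> {0..1} \<Longrightarrow> t \<in> {0..1} \<Longrightarrow> norm (\<gamma> s - \<gamma> t) \<le> L * \<bar>s - t\<bar>"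
  shows "abs_continuous_on {0..1} \<gamma>"
  unfolding abs_continuous_on_def
proof (intro allI impI)
  fix \<epsilon> :: real assume \<epsilon>: "\<epsilon> > 0"
  have "(\<Sum>I\<in>D. norm (\<gamma> (Sup I) - \<gamma> (Inf I))) < \<epsilon>"
    if D: "D division_of T" "T \<subseteq> {0..1}" "(\<Sum>I\<in>D. Sup I - Inf I) < \<epsilon> / (L + 1)" for D T
  proof -
    have I: "0 \<le> Sup I - Inf I \<and> norm (\<gamma> (Sup I) - \<gamma> (Inf I)) \<le> L * (Sup I - Inf I)" if "I \<in> D" for I
    proof -
      obtain u w where uw: "u \<le> w" "I = {u..w}" "{u..w} \<subseteq> T" using division_intervalE[OF D(1) \<open>I \<in> D\<close>] .
      then have "{u..w} \<subseteq> {0..1}" using D(2) by blast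
      then have "u \<in> {0..1}" "w \<in> {0..1}" using uw(1) by auto
      with uw show ?thesis using lip[of w u] by auto
    qed
    have "(\<Sum>I\<in>D. norm (\<gamma> (Sup I) - \<gamma> (Inf I))) \<le> (\<Sum>I\<in>D. L * (Sup I - Inf I))"
      using I by (intro sum_mono) auto
    also have "\<dots> = L * (\<Sum>I\<in>D. Sup I - Inf I)" by (simp add: sum_distrib_left)
    also have "\<dots> \<le> (L + 1) * (\<Sum>I\<in>D. Sup I - Inf I)"
      using I by (intro mult_right_mono sum_nonneg) auto
    also have "\<dots> < \<epsilon>" using D(3) L by (simp add: pos_less_divide_eq mult.commute)
    finally show ?thesis .
  qed
  moreover have "\<epsilon> / (L + 1) > 0" using \<epsilon> L by simp
  ultimately show "\<exists>\<delta>>0. \<forall>D T. D division_of T \<and> T \<subseteq> {0..1} \<and> (\<Sum>I\<in>D. Sup I - Inf I) < \<delta> \<longrightarrow>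
      (\<Sum>I\<in>D. norm (\<gamma> (Sup I) - \<gamma> (Inf I))) < \<epsilon>" by blast
qed

lemma (in first_order_distribution) derivative_in_V_if_tangent:
  assumes u: "u \<in> {0..1}" and der: "(\<gamma> has_vector_derivative v) (at u within {0..1})"
    and tan: "tangent_at V \<gamma> {0..1} u"
  shows "v \<in> V (\<gamma> u)"
proof (rule mem_subspace_if_orthogonal_annihilator[OF subspace_V])
  fix \<zeta> assume \<zeta>: "\<forall>w\<in>V (\<gamma> u). \<zeta> \<bullet> w = 0"
  have "\<bar>\<zeta> \<bullet> v\<bar> \<le> 0 + e" if e: "e > 0" for e
  proof -
    define e' where "e' = e / (1 + norm \<zeta>)"
    have n: "1 + norm \<zeta> > 0" by (simp add: add_pos_nonneg)
    then have e': "e' > 0" using e by (simp add: e'_def)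
    obtain d1 where d1: "d1 > 0" "\<And>s. s \<in> {0..1} \<Longrightarrow> \<bar>s - u\<bar> < d1 \<Longrightarrow> \<bar>\<zeta> \<bullet> (\<gamma> s - \<gamma> u)\<bar> \<le> e' * \<bar>s - u\<bar>"
      using tan \<zeta> e' unfolding tangent_at_def by meson
    obtain d2 where d2: "d2 > 0" "\<And>s. s \<in> {0..1} \<Longrightarrow> \<bar>s - u\<bar> < d2 \<Longrightarrow> norm (\<gamma> s - \<gamma> u - (s - u) *\<^sub>R v) \<le> e' * \<bar>s - u\<bar>"
      using der e' unfolding has_vector_derivative_def has_derivative_within_alt real_norm_def by metis
    obtain s where s: "s \<in> {0..1}" "s \<noteq> u" "\<bar>s - u\<bar> < min d1 d2"
    proof (cases "u < 1")
      case True
      define m where "m = min (min d1 d2) (1 - u) / 2"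
      have "m > 0" "m < d1" "m < d2" "m \<le> 1 - u" using True d1(1) d2(1) by (auto simp: m_def min_def)
      then show ?thesis using u by (intro that[of "u + m"]) auto
    next
      case False
      define m where "m = min (min d1 d2) 1 / 2"
      have "m > 0" "m < d1" "m < d2" "m \<le> 1" using d1(1) d2(1) by (auto simp: m_def min_def)
      then show ?thesis using u False by (intro that[of "u - m"]) auto
    qed
    have "(s - u) * (\<zeta> \<bullet> v) = \<zeta> \<bullet> (\<gamma> s - \<gamma> u) - \<zeta> \<bullet> (\<gamma> s - \<gamma> u - (s - u) *\<^sub>R v)"
      by (simp add: inner_diff_right)
    then have "\<bar>s - u\<bar> * \<bar>\<zeta> \<bullet> v\<bar> \<le> \<bar>\<zeta> \<bullet> (\<gamma> s - \<gamma> u)\<bar> + \<bar>\<zeta> \<bullet> (\<gamma> s - \<gamma> u - (s - u) *\<^sub>R v)\<bar>"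
      by (simp add: abs_mult[symmetric])
    also have "\<dots> \<le> e' * \<bar>s - u\<bar> + norm \<zeta> * (e' * \<bar>s - u\<bar>)"
    proof (rule add_mono)
      show "\<bar>\<zeta> \<bullet> (\<gamma> s - \<gamma> u)\<bar> \<le> e' * \<bar>s - u\<bar>" using s d1(2) by simp
      show "\<bar>\<zeta> \<bullet> (\<gamma> s - \<gamma> u - (s - u) *\<^sub>R v)\<bar> \<le> norm \<zeta> * (e' * \<bar>s - u\<bar>)"
        using s d2(2)[of s] by (intro order_trans[OF Cauchy_Schwarz_ineq2] mult_left_mono) auto
    qed
    also have "\<dots> = \<bar>s - u\<bar> * ((1 + norm \<zeta>) * e')" by (simp add: algebra_simps)
    also have "(1 + norm \<zeta>) * e' = e" using n by (simp add: e'_def)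
    finally show ?thesis using s by simp
  qed
  then have "\<bar>\<zeta> \<bullet> v\<bar> \<le> 0" by (rule field_le_epsilon)
  then show "\<zeta> \<bullet> v = 0" by simp
qed

lemma (in first_order_distribution) cc_dist_le_arc_length:
  assumes st: "s \<le> t" and L: "0 \<le> L"
    and lip: "\<And>u w. u \<in> {s..t} \<Longrightarrow> w \<in> {s..t} \<Longrightarrow> norm (G u - G w) \<le> L * \<bar>u - w\<bar>"
    and tan: "\<And>u. u \<in> {s..t} \<Longrightarrow> tangent_at V G {s..t} u"
  shows "cc_dist V (G s) (G t) \<le> arc_length G s t"
proof -
  define \<gamma> where "\<gamma> u = G (s + (t - s) * u)" for u
  have dom: "s + (t - s) * u \<in> {s..t}" if "u \<in> {0..1}" for u
    using that st mult_left_le[of u "t - s"] by auto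
  define M where "M = L * (t - s)"
  have M: "0 \<le> M" using L st by (simp add: M_def)
  have glip: "norm (\<gamma> u - \<gamma> w) \<le> M * \<bar>u - w\<bar>" if "u \<in> {0..1}" "w \<in> {0..1}" for u w
  proof -
    have "norm (\<gamma> u - \<gamma> w) \<le> L * \<bar>(s + (t - s) * u) - (s + (t - s) * w)\<bar>"
      unfolding \<gamma>_def using that by (intro lip dom)
    also have "(s + (t - s) * u) - (s + (t - s) * w) = (t - s) * (u - w)" by (simp add: algebra_simps)
    finally show ?thesis using st by (simp add: M_def abs_mult)
  qed
  have gtan: "tangent_at V \<gamma> {0..1} u" if u: "u \<in> {0..1}" for u
    unfolding tangent_at_def
  proof (intro allI impI)
    fix \<zeta> and e :: real assume \<zeta>: "\<forall>v\<in>V (\<gamma> u). \<zeta> \<bullet> v = 0" and e: "e > 0"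
    have "e / (t - s + 1) > 0" using e st by simp
    then obtain d where d: "d > 0" "\<And>x. x \<in> {s..t} \<Longrightarrow> \<bar>x - (s + (t - s) * u)\<bar> < d \<Longrightarrow>
        \<bar>\<zeta> \<bullet> (G x - G (s + (t - s) * u))\<bar> \<le> e / (t - s + 1) * \<bar>x - (s + (t - s) * u)\<bar>"
      using tan[OF dom[OF u]] \<zeta> unfolding tangent_at_def \<gamma>_def by meson
    show "\<exists>\<delta>>0. \<forall>w\<in>{0..1}. \<bar>w - u\<bar> < \<delta> \<longrightarrow> \<bar>\<zeta> \<bullet> (\<gamma> w - \<gamma> u)\<bar> \<le> e * \<bar>w - u\<bar>"
    proof (intro exI[of _ "d / (t - s + 1)"] conjI ballI impI)
      show "d / (t - s + 1) > 0" using d st by simp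
      fix w :: real assume w: "w \<in> {0..1}" "\<bar>w - u\<bar> < d / (t - s + 1)"
      have eq: "\<bar>(s + (t - s) * w) - (s + (t - s) * u)\<bar> = (t - s) * \<bar>w - u\<bar>"
      proof -
        have "(s + (t - s) * w) - (s + (t - s) * u) = (t - s) * (w - u)" by (simp add: algebra_simps)
        then show ?thesis using st by (simp add: abs_mult)
      qed
      have "(t - s) * \<bar>w - u\<bar> \<le> (t - s + 1) * \<bar>w - u\<bar>" by (intro mult_right_mono) auto
      also have "\<dots> < d" using w(2) st by (simp add: pos_less_divide_eq mult.commute)
      finally have "\<bar>\<zeta> \<bullet> (\<gamma> w - \<gamma> u)\<bar> \<le> e / (t - s + 1) * ((t - s) * \<bar>w - u\<bar>)"
        unfolding \<gamma>_def using d(2)[OF dom[OF w(1)]] eq by simp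
      also have "\<dots> = (e * \<bar>w - u\<bar>) * ((t - s) / (t - s + 1))" by simp
      also have "\<dots> \<le> e * \<bar>w - u\<bar>" using st e by (intro mult_left_le) auto
      finally show "\<bar>\<zeta> \<bullet> (\<gamma> w - \<gamma> u)\<bar> \<le> e * \<bar>w - u\<bar>" .
    qed
  qed
  define cl where "cl u = max 0 (min 1 u)" for u :: real
  have cl: "cl u \<in> {0..1}" "u \<in> {0..1} \<Longrightarrow> cl u = u" "\<bar>cl u - cl w\<bar> \<le> \<bar>u - w\<bar>" for u w
    by (auto simp: cl_def max_def min_def)
  have "norm ((\<gamma> \<circ> cl) u - (\<gamma> \<circ> cl) w) \<le> M * \<bar>u - w\<bar>" for u w
    using order_trans[OF glip[OF cl(1) cl(1)] mult_left_mono[OF cl(3) M]] by simp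
  then have neg: "negligible {u. \<not> (\<gamma> \<circ> cl) differentiable (at u)}" by (rule negligible_nondifferentiable_lipschitz)
  have "horizontal V \<gamma>" unfolding horizontal_def
  proof
    show "abs_continuous_on {0..1} \<gamma>" using M glip by (rule abs_continuous_on_lipschitz)
    have "AE u in lebesgue. u \<notin> {u. \<not> (\<gamma> \<circ> cl) differentiable (at u)}"
      using neg by (intro AE_not_in) (simp add: negligible_iff_null_sets)
    then show "AE u in lebesgue. u \<in> {0..1} \<longrightarrow> (\<exists>v\<in>V (\<gamma> u). (\<gamma> has_vector_derivative v) (at u within {0..1}))"
    proof (rule eventually_mono, intro impI)
      fix u :: real assume "u \<notin> {u. \<not> (\<gamma> \<circ> cl) differentiable (at u)}" and u: "u \<in> {0..1}"
      then obtain v where "((\<gamma> \<circ> cl) has_vector_derivative v) (at u)"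
        using vector_derivative_works by blast
      then have "((\<gamma> \<circ> cl) has_vector_derivative v) (at u within {0..1})" by (rule has_vector_derivative_at_within)
      then have "(\<gamma> has_vector_derivative v) (at u within {0..1})"
        by (rule has_vector_derivative_transform[OF u, rotated]) (simp add: cl(2))
      then show "\<exists>v\<in>V (\<gamma> u). (\<gamma> has_vector_derivative v) (at u within {0..1})"
        using derivative_in_V_if_tangent[OF u _ gtan[OF u]] by blast
    qed
  qed
  then have "cc_dist V (G s) (G t) \<le> arc_length \<gamma> 0 1"
    unfolding cc_dist_def curve_length_eq_arc_length by (intro INF_lower) (simp add: \<gamma>_def)
  also have "\<dots> \<le> arc_length G (s + (t - s) * 0) (s + (t - s) * 1)"
    unfolding \<gamma>_def using st by (intro arc_length_affine_reparam) auto
  finally show ?thesis by simp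
qed

definition tangent_path :: "('b::euclidean_space \<Rightarrow> 'b set) \<Rightarrow> (real \<Rightarrow> 'b) \<Rightarrow> real \<Rightarrow> bool" where
  "tangent_path V G l \<longleftrightarrow> (\<forall>s\<in>{0..l}. \<forall>t\<in>{0..l}. norm (G s - G t) \<le> \<bar>s - t\<bar>) \<and> (\<forall>t\<in>{0..l}. tangent_at V G {0..l} t)"

lemma abs_continuous_imp_arc_length_small:
  assumes ac: "abs_continuous_on {0..1} \<gamma>" and e: "e > 0"
  obtains d where "d > 0" "\<And>s t. 0 \<le> s \<Longrightarrow> s \<le> t \<Longrightarrow> t \<le> 1 \<Longrightarrow> t - s < d \<Longrightarrow> arc_length \<gamma> s t \<le> ennreal e"
proof -
  obtain d where d: "d > 0" "\<And>D T. D division_of T \<Longrightarrow> T \<subseteq> {0..1} \<Longrightarrow> (\<Sum>I\<in>D. Sup I - Inf I) < d \<Longrightarrow> chord_sum \<gamma> D < e"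
    using ac e unfolding abs_continuous_on_def chord_sum_def by metis
  show ?thesis
  proof (rule that[OF d(1)])
    fix s t :: real assume st: "0 \<le> s" "s \<le> t" "t \<le> 1" "t - s < d"
    show "arc_length \<gamma> s t \<le> ennreal e"
    proof (rule arc_length_leI)
      fix D assume D: "D division_of {s..t}"
      then have "chord_sum \<gamma> D < e" using st by (intro d(2)[OF D]) (auto simp: sum_lengths_division[OF D])
      then show "ennreal (chord_sum \<gamma> D) \<le> ennreal e" by (simp add: ennreal_leI)
    qed
  qed
qed

lemma (in first_order_distribution) horizontal_imp_tangent_path:
  assumes hor: "horizontal V \<gamma>" and len: "arc_length \<gamma> 0 1 < ennreal l"
  obtains G where "tangent_path V G l" "G 0 = \<gamma> 0" "G l = \<gamma> 1"
proof -
  have ac: "abs_continuous_on {0..1} \<gamma>" using hor by (simp add: horizontal_def)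
  obtain \<Lambda> where \<Lambda>: "arc_length \<gamma> 0 1 = ennreal \<Lambda>" "0 \<le> \<Lambda>"
    using len by (cases "arc_length \<gamma> 0 1") auto
  then have Ll: "\<Lambda> < l" using len by (simp add: ennreal_less_iff)
  have fin: "arc_length \<gamma> s t < top" if "0 \<le> s" "s \<le> t" "t \<le> 1" for s t
    using arc_length_mono[of 0 s t 1 \<gamma>] that \<Lambda> by (metis ennreal_less_top le_less_trans)
  define \<kappa> where "\<kappa> = l - \<Lambda>"
  have \<kappa>: "\<kappa> > 0" using Ll by (simp add: \<kappa>_def)
  define \<sigma> where "\<sigma> t = enn2real (arc_length \<gamma> 0 t) + \<kappa> * t" for t
  have s0: "\<sigma> 0 = 0" by (simp add: \<sigma>_def arc_length_refl)
  have s1: "\<sigma> 1 = l" using \<Lambda> by (simp add: \<sigma>_def \<kappa>_def)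
  have inc: "\<sigma> t - \<sigma> s = enn2real (arc_length \<gamma> s t) + \<kappa> * (t - s)" if "0 \<le> s" "s \<le> t" "t \<le> 1" for s t
  proof -
    have "enn2real (arc_length \<gamma> 0 t) = enn2real (arc_length \<gamma> 0 s) + enn2real (arc_length \<gamma> s t)"
      using arc_length_additive[of 0 s t \<gamma>] fin[of 0 s] fin[of s t] that by (simp add: enn2real_plus)
    then show ?thesis by (simp add: \<sigma>_def algebra_simps)
  qed
  have len_le: "arc_length \<gamma> s t \<le> ennreal (\<sigma> t - \<sigma> s)" if "0 \<le> s" "s \<le> t" "t \<le> 1" for s t
  proof -
    have "arc_length \<gamma> s t = ennreal (enn2real (arc_length \<gamma> s t))" using fin[OF that] by simp
    also have "\<dots> \<le> ennreal (\<sigma> t - \<sigma> s)" using inc[OF that] \<kappa> that by (intro ennreal_leI) simp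
    finally show ?thesis .
  qed
  have strict: "\<sigma> s < \<sigma> t" if "0 \<le> s" "s < t" "t \<le> 1" for s t
  proof -
    have "0 < \<kappa> * (t - s)" using \<kappa> that by simp
    then show ?thesis using inc[of s t] that enn2real_nonneg[of "arc_length \<gamma> s t"] by linarith
  qed
  have cont: "continuous_on {0..1} \<sigma>"
    unfolding continuous_on_iff
  proof (intro ballI allI impI)
    fix x e :: real assume x: "x \<in> {0..1}" and e: "e > 0"
    obtain d where d: "d > 0" "\<And>s t. 0 \<le> s \<Longrightarrow> s \<le> t \<Longrightarrow> t \<le> 1 \<Longrightarrow> t - s < d \<Longrightarrow> arc_length \<gamma> s t \<le> ennreal (e/2)"
      using abs_continuous_imp_arc_length_small[OF ac, of "e/2"] e by auto
    have key: "\<bar>\<sigma> t - \<sigma> s\<bar> < e" if "0 \<le> s" "s \<le> t" "t \<le> 1" "t - s < min d (e / (2 * \<kappa>))" for s t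
    proof -
      have "arc_length \<gamma> s t \<le> ennreal (e/2)" using that by (intro d(2)) auto
      then have "enn2real (arc_length \<gamma> s t) \<le> enn2real (ennreal (e/2))" by (intro enn2real_mono) auto
      then have "enn2real (arc_length \<gamma> s t) \<le> e/2" using e by simp
      moreover have "\<kappa> * (t - s) < e/2" using that \<kappa> by (simp add: field_simps)
      moreover have "0 \<le> \<kappa> * (t - s)" using \<kappa> that by simp
      ultimately show ?thesis using inc[OF that(1-3)] enn2real_nonneg[of "arc_length \<gamma> s t"] by linarith
    qed
    show "\<exists>d>0. \<forall>x'\<in>{0..1}. dist x' x < d \<longrightarrow> dist (\<sigma> x') (\<sigma> x) < e"
    proof (intro exI[of _ "min d (e / (2 * \<kappa>))"] conjI ballI impI)
      show "min d (e / (2 * \<kappa>)) > 0" using d e \<kappa> by simp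
      fix y :: real assume y: "y \<in> {0..1}" "dist y x < min d (e / (2 * \<kappa>))"
      show "dist (\<sigma> y) (\<sigma> x) < e"
      proof (cases "x \<le> y")
        case True
        then show ?thesis using key[of x y] x y by (auto simp: dist_real_def)
      next
        case False
        then show ?thesis using key[of y x] x y by (auto simp: dist_real_def)
      qed
    qed
  qed
  have "\<exists>t. 0 \<le> t \<and> t \<le> 1 \<and> \<sigma> t = u" if "u \<in> {0..l}" for u
    using IVT'[of \<sigma> 0 u 1] that s0 s1 cont by auto
  then obtain \<tau> where \<tau>: "\<And>u. u \<in> {0..l} \<Longrightarrow> 0 \<le> \<tau> u \<and> \<tau> u \<le> 1 \<and> \<sigma> (\<tau> u) = u" by metis
  define G where "G u = \<gamma> (\<tau> u)" for u
  have mono: "\<tau> u \<le> \<tau> w" if "u \<in> {0..l}" "w \<in> {0..l}" "u \<le> w" for u w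
    using strict[of "\<tau> w" "\<tau> u"] \<tau>[OF that(1)] \<tau>[OF that(2)] that(3) by (cases "\<tau> u \<le> \<tau> w") auto
  have len': "arc_length \<gamma> (\<tau> u) (\<tau> w) \<le> ennreal (w - u)" if "u \<in> {0..l}" "w \<in> {0..l}" "u \<le> w" for u w
    using len_le[of "\<tau> u" "\<tau> w"] mono[OF that] \<tau>[OF that(1)] \<tau>[OF that(2)] by simp
  have lip1: "norm (G w - G u) \<le> w - u" if uw: "u \<in> {0..l}" "w \<in> {0..l}" "u \<le> w" for u w
  proof -
    have "ennreal (norm (G w - G u)) \<le> ennreal (w - u)"
      unfolding G_def using norm_le_arc_length[OF mono[OF uw], of \<gamma>] len'[OF uw] by (rule order_trans)
    then show ?thesis using uw by (simp add: ennreal_le_iff)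
  qed
  have lip: "norm (G u - G w) \<le> \<bar>u - w\<bar>" if "u \<in> {0..l}" "w \<in> {0..l}" for u w
    using lip1[of u w] lip1[of w u] that by (cases "u \<le> w") (auto simp: norm_minus_commute)
  have tan: "tangent_at V G {0..l} u" if u: "u \<in> {0..l}" for u
  proof (rule tangent_at_if_chord_controlled[of 1])
    show "u \<in> {0..l}" by fact
    show "norm (G s - G u) \<le> 1 * \<bar>s - u\<bar>" if "s \<in> {0..l}" for s using lip[OF that u] by simp
    show "chord_controlled V (1 * (s' - s)) (G s) (G s')" if "s \<in> {0..l}" "s' \<in> {0..l}" "s < s'" for s s'
      unfolding G_def using len'[of s s'] mono[of s s'] \<tau>[OF that(1)] \<tau>[OF that(2)] that
      by (intro horizontal_chord_controlled[OF hor]) auto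
  qed simp
  have l0: "0 \<le> l" using Ll \<Lambda> by simp
  have t0: "\<tau> 0 = 0" using strict[of 0 "\<tau> 0"] \<tau>[of 0] l0 s0 by force
  have t1: "\<tau> l = 1" using strict[of "\<tau> l" 1] \<tau>[of l] l0 s1 by force
  show ?thesis
  proof (rule that)
    show "tangent_path V G l" unfolding tangent_path_def using lip tan by blast
    show "G 0 = \<gamma> 0" "G l = \<gamma> 1" by (simp_all add: G_def t0 t1)
  qed
qed

lemma (in first_order_distribution) cc_dist_less_imp_tangent_path:
  assumes "cc_dist V p q < ennreal l"
  obtains G where "tangent_path V G l" "G 0 = p" "G l = q"
  using cc_dist_lessE[OF assms] horizontal_imp_tangent_path by metis

lemma (in first_order_distribution) tangent_path_imp_cc_dist_le:
  assumes G: "tangent_path V G l" and st: "0 \<le> s" "s \<le> t" "t \<le> l"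
  shows "cc_dist V (G s) (G t) \<le> ennreal (t - s)"
proof -
  have lip: "norm (G u - G w) \<le> 1 * \<bar>u - w\<bar>" if "u \<in> {s..t}" "w \<in> {s..t}" for u w
    using G[unfolded tangent_path_def, THEN conjunct1, rule_format, of u w] that st by auto
  have "cc_dist V (G s) (G t) \<le> arc_length G s t"
  proof (rule cc_dist_le_arc_length[OF st(2), of 1])
    show "tangent_at V G {s..t} u" if "u \<in> {s..t}" for u
    proof (rule tangent_at_subset)
      have "u \<in> {0..l}" using that st by auto
      then show "tangent_at V G {0..l} u" using G unfolding tangent_path_def by blast
    qed (use st in auto)
  qed (use lip in auto)
  also have "\<dots> \<le> ennreal (1 * (t - s))"
  proof (rule arc_length_lipschitz[OF _ st(2)])
    show "norm (G w - G u) \<le> 1 * (w - u)" if "s \<le> u" "u \<le> w" "w \<le> t" for u w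
      using lip[of w u] that by simp
  qed
  finally show ?thesis by simp
qed

lemma (in first_order_distribution) tangent_path_reverse:
  assumes G: "tangent_path V G l"
  shows "tangent_path V (\<lambda>t. G (l - t)) l"
  unfolding tangent_path_def
proof (intro conjI ballI)
  fix s t assume "s \<in> {0..l}" "t \<in> {0..l}"
  then show "norm (G (l - s) - G (l - t)) \<le> \<bar>s - t\<bar>"
    using G[unfolded tangent_path_def, THEN conjunct1, rule_format, of "l - s" "l - t"] by auto
next
  fix t assume t: "t \<in> {0..l}"
  show "tangent_at V (\<lambda>t. G (l - t)) {0..l} t"
    unfolding tangent_at_def
  proof (intro allI impI)
    fix \<zeta> and e :: real assume \<zeta>: "\<forall>v\<in>V (G (l - t)). \<zeta> \<bullet> v = 0" and e: "e > 0"
    have "tangent_at V G {0..l} (l - t)" using G t by (auto simp: tangent_path_def)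
    then obtain d where d: "d > 0" "\<And>s. s \<in> {0..l} \<Longrightarrow> \<bar>s - (l - t)\<bar> < d \<Longrightarrow> \<bar>\<zeta> \<bullet> (G s - G (l - t))\<bar> \<le> e * \<bar>s - (l - t)\<bar>"
      using \<zeta> e unfolding tangent_at_def by meson
    have "\<bar>\<zeta> \<bullet> (G (l - s) - G (l - t))\<bar> \<le> e * \<bar>s - t\<bar>" if "s \<in> {0..l}" "\<bar>s - t\<bar> < d" for s
      using d(2)[of "l - s"] that by (auto simp: abs_minus_commute)
    then show "\<exists>\<delta>>0. \<forall>s\<in>{0..l}. \<bar>s - t\<bar> < \<delta> \<longrightarrow> \<bar>\<zeta> \<bullet> (G (l - s) - G (l - t))\<bar> \<le> e * \<bar>s - t\<bar>"
      using d(1) by blast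
  qed
qed

lemma (in first_order_distribution) tangent_path_concat:
  assumes G: "tangent_path V G l" and H: "tangent_path V H m" and eq: "H 0 = G l" and lm: "0 \<le> l" "0 \<le> m"
  shows "tangent_path V (\<lambda>t. if t \<le> l then G t else H (t - l)) (l + m)"
proof -
  let ?F = "\<lambda>t. if t \<le> l then G t else H (t - l)"
  have F: "?F t = H (t - l)" if "l \<le> t" for t using that eq by (cases "t = l") auto
  have Gl: "norm (G s - G t) \<le> \<bar>s - t\<bar>" if "s \<in> {0..l}" "t \<in> {0..l}" for s t using G that by (auto simp: tangent_path_def)
  have Hl: "norm (H s - H t) \<le> \<bar>s - t\<bar>" if "s \<in> {0..m}" "t \<in> {0..m}" for s t using H that by (auto simp: tangent_path_def)
  have lip1: "norm (?F t - ?F s) \<le> t - s" if st: "0 \<le> s" "s \<le> t" "t \<le> l + m" for s t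
  proof -
    consider "t \<le> l" | "l \<le> s" | "s < l" "l < t" by linarith
    then show ?thesis
    proof cases
      case 1 then show ?thesis using Gl[of t s] st by auto
    next
      case 2 then show ?thesis using Hl[of "t - l" "s - l"] st F[of s] F[of t] by auto
    next
      case 3
      have "norm (?F t - ?F s) \<le> norm (H (t - l) - H 0) + norm (G l - G s)"
        using 3 norm_triangle_ineq[of "H (t - l) - H 0" "G l - G s"] by (simp add: eq)
      also have "\<dots> \<le> (t - l) + (l - s)" using 3 st lm Hl[of "t - l" 0] Gl[of l s] by (intro add_mono) auto
      finally show ?thesis by simp
    qed
  qed
  have lip: "norm (?F s - ?F t) \<le> \<bar>s - t\<bar>" if "s \<in> {0..l + m}" "t \<in> {0..l + m}" for s t
  proof (cases "s \<le> t")
    case True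
    then show ?thesis using lip1[of s t] that by (auto simp: norm_minus_commute)
  next
    case False
    then show ?thesis using lip1[of t s] that by auto
  qed
  have tan: "tangent_at V ?F {0..l + m} t" if t: "t \<in> {0..l + m}" for t
    unfolding tangent_at_def
  proof (intro allI impI)
    fix \<zeta> and e :: real assume \<zeta>: "\<forall>v\<in>V (?F t). \<zeta> \<bullet> v = 0" and e: "e > 0"
    have 1: "\<exists>d>0. \<forall>s\<in>{0..l}. \<bar>s - t\<bar> < d \<longrightarrow> \<bar>\<zeta> \<bullet> (?F s - ?F t)\<bar> \<le> e * \<bar>s - t\<bar>"
    proof (cases "t \<le> l")
      case True
      then have "tangent_at V G {0..l} t" using G t by (auto simp: tangent_path_def)
      then show ?thesis using \<zeta> e True unfolding tangent_at_def by auto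
    next
      case False
      then show ?thesis by (intro exI[of _ "t - l"]) auto
    qed
    have 2: "\<exists>d>0. \<forall>s\<in>{l..l + m}. \<bar>s - t\<bar> < d \<longrightarrow> \<bar>\<zeta> \<bullet> (?F s - ?F t)\<bar> \<le> e * \<bar>s - t\<bar>"
    proof (cases "l \<le> t")
      case True
      then have "tangent_at V H {0..m} (t - l)" using H t by (auto simp: tangent_path_def)
      then obtain d where d: "d > 0" "\<And>s. s \<in> {0..m} \<Longrightarrow> \<bar>s - (t - l)\<bar> < d \<Longrightarrow> \<bar>\<zeta> \<bullet> (H s - H (t - l))\<bar> \<le> e * \<bar>s - (t - l)\<bar>"
        using \<zeta> e F[OF True] unfolding tangent_at_def by metis
      have "\<bar>\<zeta> \<bullet> (?F s - ?F t)\<bar> \<le> e * \<bar>s - t\<bar>" if "s \<in> {l..l + m}" "\<bar>s - t\<bar> < d" for s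
        using d(2)[of "s - l"] that F[OF True] F[of s] by auto
      then show ?thesis using d(1) by blast
    next
      case False
      then show ?thesis by (intro exI[of _ "l - t"]) auto
    qed
    obtain d1 where d1: "d1 > 0" "\<forall>s\<in>{0..l}. \<bar>s - t\<bar> < d1 \<longrightarrow> \<bar>\<zeta> \<bullet> (?F s - ?F t)\<bar> \<le> e * \<bar>s - t\<bar>" using 1 by blast
    obtain d2 where d2: "d2 > 0" "\<forall>s\<in>{l..l + m}. \<bar>s - t\<bar> < d2 \<longrightarrow> \<bar>\<zeta> \<bullet> (?F s - ?F t)\<bar> \<le> e * \<bar>s - t\<bar>" using 2 by blast
    have "\<bar>\<zeta> \<bullet> (?F s - ?F t)\<bar> \<le> e * \<bar>s - t\<bar>" if "s \<in> {0..l + m}" "\<bar>s - t\<bar> < min d1 d2" for s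
    proof (cases "s \<le> l")
      case True
      then have "s \<in> {0..l}" using that by auto
      then show ?thesis using d1(2) that(2) by simp
    next
      case False
      then have "s \<in> {l..l + m}" using that by auto
      then show ?thesis using d2(2) that(2) by simp
    qed
    then show "\<exists>\<delta>>0. \<forall>s\<in>{0..l + m}. \<bar>s - t\<bar> < \<delta> \<longrightarrow> \<bar>\<zeta> \<bullet> (?F s - ?F t)\<bar> \<le> e * \<bar>s - t\<bar>"
      using d1(1) d2(1) by (intro exI[of _ "min d1 d2"]) auto
  qed
  show ?thesis unfolding tangent_path_def using lip tan by blast
qed

lemma ennreal_le_of_real_bounds:
  fixes x y :: ennreal
  assumes "\<And>l. 0 \<le> l \<Longrightarrow> y < ennreal l \<Longrightarrow> x \<le> ennreal l"
  shows "x \<le> y"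
proof (rule dense_ge)
  fix z assume "y < z"
  then obtain r where r: "y < ennreal r" "ennreal r < z" "0 \<le> r"
  proof -
    obtain w where "y < w" "w < z" using dense[OF \<open>y < z\<close>] by blast
    then show ?thesis using that[of "enn2real w"] by (cases w) auto
  qed
  then show "x \<le> z" using assms[of r] by (meson less_imp_le order_trans)
qed

lemma (in first_order_distribution) cc_dist_commute: "cc_dist V p q = cc_dist V q p"
proof -
  have "cc_dist V q p \<le> cc_dist V p q" for p q
  proof (rule ennreal_le_of_real_bounds)
    fix l :: real assume l: "0 \<le> l" "cc_dist V p q < ennreal l"
    then obtain G where G: "tangent_path V G l" "G 0 = p" "G l = q" using cc_dist_less_imp_tangent_path by blast
    show "cc_dist V q p \<le> ennreal l"
      using tangent_path_imp_cc_dist_le[OF tangent_path_reverse[OF G(1)], of 0 l] l G by simp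
  qed
  then show ?thesis by (intro antisym)
qed

lemma (in first_order_distribution) cc_dist_triangle:
  "cc_dist V p r \<le> cc_dist V p q + cc_dist V q r"
proof (cases "cc_dist V p q = top \<or> cc_dist V q r = top")
  case False
  show ?thesis
  proof (rule ennreal_le_epsilon)
    fix e :: real assume e: "e > 0"
    have lt: "\<exists>l\<ge>0. x < ennreal l \<and> ennreal l \<le> x + ennreal (e/2)" if "x \<noteq> top" for x
      using that e by (cases x) (auto simp: ennreal_less_iff ennreal_plus[symmetric] simp del: ennreal_plus intro!: exI[of _ "enn2real x + e/2"])
    obtain l where l: "l \<ge> 0" "cc_dist V p q < ennreal l" "ennreal l \<le> cc_dist V p q + ennreal (e/2)" using lt False by blast
    obtain m where m: "m \<ge> 0" "cc_dist V q r < ennreal m" "ennreal m \<le> cc_dist V q r + ennreal (e/2)" using lt False by blast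
    obtain G where G: "tangent_path V G l" "G 0 = p" "G l = q" using cc_dist_less_imp_tangent_path[OF l(2)] .
    obtain H where H: "tangent_path V H m" "H 0 = q" "H m = r" using cc_dist_less_imp_tangent_path[OF m(2)] .
    have eq: "H 0 = G l" using G H by simp
    have "cc_dist V p r \<le> ennreal (l + m)"
      using tangent_path_imp_cc_dist_le[OF tangent_path_concat[OF G(1) H(1) eq l(1) m(1)], of 0 "l + m"] G H eq l m
      by (auto split: if_splits)
    also have "\<dots> \<le> (cc_dist V p q + ennreal (e/2)) + (cc_dist V q r + ennreal (e/2))"
      using l m by (simp add: add_mono)
    also have "\<dots> = cc_dist V p q + cc_dist V q r + (ennreal (e/2) + ennreal (e/2))" by (simp add: ac_simps)
    also have "ennreal (e/2) + ennreal (e/2) = ennreal e" using e by (simp add: ennreal_plus[symmetric] del: ennreal_plus)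
    finally show "cc_dist V p r \<le> cc_dist V p q + cc_dist V q r + ennreal e" .
  qed
qed auto

lemma (in first_order_distribution) lipschitz_extension_to_line:
  assumes T: "compact T" "T \<noteq> {}" and L: "0 \<le> L"
    and lip: "\<And>s t. s \<in> T \<Longrightarrow> t \<in> T \<Longrightarrow> cc_dist V (g s) (g t) \<le> ennreal (L * \<bar>s - t\<bar>)"
  obtains G where "\<And>t. t \<in> T \<Longrightarrow> G t = g t"
    "\<And>s t. cc_dist V (G s) (G t) \<le> ennreal ((L + 1) * \<bar>s - t\<bar>)"
proof -
  define M where "M = L + 1"
  have M: "M > 0" using L by (simp add: M_def)
  have clT: "closed T" using T compact_imp_closed by blast
  have exH: "\<exists>H. tangent_path V H (M * (b - a)) \<and> H 0 = g a \<and> H (M * (b - a)) = g b" if "a \<in> T" "b \<in> T" "a < b" for a b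
  proof -
    have "cc_dist V (g a) (g b) \<le> ennreal (L * \<bar>a - b\<bar>)" by (rule lip) fact+
    also have "\<dots> < ennreal (M * (b - a))" using that L by (simp add: ennreal_less_iff M_def)
    finally show ?thesis using cc_dist_less_imp_tangent_path by metis
  qed
  define H where "H a b = (SOME H. tangent_path V H (M * (b - a)) \<and> H 0 = g a \<and> H (M * (b - a)) = g b)" for a b
  have H: "\<And>a b. a \<in> T \<Longrightarrow> b \<in> T \<Longrightarrow> a < b \<Longrightarrow> tangent_path V (H a b) (M * (b - a))"
    "\<And>a b. a \<in> T \<Longrightarrow> b \<in> T \<Longrightarrow> a < b \<Longrightarrow> H a b 0 = g a"
    "\<And>a b. a \<in> T \<Longrightarrow> b \<in> T \<Longrightarrow> a < b \<Longrightarrow> H a b (M * (b - a)) = g b"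
    using someI_ex[OF exH] unfolding H_def by blast+
  obtain lo where lo: "lo \<in> T" "\<And>t. t \<in> T \<Longrightarrow> lo \<le> t" using compact_attains_inf[OF T] by blast
  obtain hi where hi: "hi \<in> T" "\<And>t. t \<in> T \<Longrightarrow> t \<le> hi" using compact_attains_sup[OF T] by blast
  have ex_a: "\<exists>a. a \<in> T \<and> a \<le> s \<and> (\<forall>t\<in>T. t \<le> s \<longrightarrow> t \<le> a)" if "lo \<le> s" for s
  proof -
    have "compact (T \<inter> {..s})" using T(1) by (intro compact_Int_closed) auto
    moreover have "T \<inter> {..s} \<noteq> {}" using lo that by auto
    ultimately obtain a where "a \<in> T \<inter> {..s}" "\<forall>t\<in>T \<inter> {..s}. t \<le> a" using compact_attains_sup by blast
    then show ?thesis by (intro exI[of _ a]) auto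
  qed
  have ex_b: "\<exists>b. b \<in> T \<and> s \<le> b \<and> (\<forall>t\<in>T. s \<le> t \<longrightarrow> b \<le> t)" if "s \<le> hi" for s
  proof -
    have "compact (T \<inter> {s..})" using T(1) by (intro compact_Int_closed) auto
    moreover have "T \<inter> {s..} \<noteq> {}" using hi that by auto
    ultimately obtain b where "b \<in> T \<inter> {s..}" "\<forall>t\<in>T \<inter> {s..}. b \<le> t" using compact_attains_inf by blast
    then show ?thesis by (intro exI[of _ b]) auto
  qed
  obtain A where A: "\<And>s. lo \<le> s \<Longrightarrow> A s \<in> T" "\<And>s. lo \<le> s \<Longrightarrow> A s \<le> s" "\<And>s t. lo \<le> s \<Longrightarrow> t \<in> T \<Longrightarrow> t \<le> s \<Longrightarrow> t \<le> A s"
    using ex_a by metis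
  obtain B where B: "\<And>s. s \<le> hi \<Longrightarrow> B s \<in> T" "\<And>s. s \<le> hi \<Longrightarrow> s \<le> B s" "\<And>s t. s \<le> hi \<Longrightarrow> t \<in> T \<Longrightarrow> s \<le> t \<Longrightarrow> B s \<le> t"
    using ex_b by metis
  define F where "F s = (if s \<in> T then g s else H (A s) (B s) (M * (s - A s)))" for s
  have gap: "A s < s \<and> s < B s" if "s \<notin> T" "lo \<le> s" "s \<le> hi" for s
    using A(1,2)[OF that(2)] B(1,2)[OF that(3)] that(1) by (metis order_le_less)
  have FT: "F t = g t" if "t \<in> T" for t using that by (simp add: F_def)
  have FA: "cc_dist V (g (A s)) (F s) \<le> ennreal (M * (s - A s))" "cc_dist V (F s) (g (B s)) \<le> ennreal (M * (B s - s))"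
    if s: "lo \<le> s" "s \<le> hi" for s
  proof -
    have "cc_dist V (g (A s)) (F s) \<le> ennreal (M * (s - A s)) \<and> cc_dist V (F s) (g (B s)) \<le> ennreal (M * (B s - s))"
    proof (cases "s \<in> T")
      case True
      then have "A s = s" "B s = s" using A(2,3)[OF s(1)] B(2,3)[OF s(2)] by (meson antisym order_refl)+
      then show ?thesis using True lip[OF True True] by (simp add: FT)
    next
      case False
      note g = gap[OF False s]
      have AB: "A s \<in> T" "B s \<in> T" "A s < B s" using A(1)[OF s(1)] B(1)[OF s(2)] g by auto
      note P = tangent_path_imp_cc_dist_le[OF H(1)[OF AB]]
      have "M * (s - A s) \<le> M * (B s - A s)" using g M by (intro mult_left_mono) auto
      moreover have "M * (B s - A s) - M * (s - A s) = M * (B s - s)" by (simp add: algebra_simps)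
      ultimately show ?thesis
        using P[of 0 "M * (s - A s)"] P[of "M * (s - A s)" "M * (B s - A s)"] H(2,3)[OF AB] False g M
        by (simp add: F_def)
    qed
    then show "cc_dist V (g (A s)) (F s) \<le> ennreal (M * (s - A s))" "cc_dist V (F s) (g (B s)) \<le> ennreal (M * (B s - s))" by auto
  qed
  have Flip: "cc_dist V (F s) (F t) \<le> ennreal (M * (t - s))" if st: "lo \<le> s" "s \<le> t" "t \<le> hi" for s t
  proof (cases "B s \<le> A t")
    case True
    have 1: "cc_dist V (F s) (g (B s)) \<le> ennreal (M * (B s - s))" using FA st by auto
    have 3: "cc_dist V (g (A t)) (F t) \<le> ennreal (M * (t - A t))" using FA st by auto
    have "cc_dist V (g (B s)) (g (A t)) \<le> ennreal (L * \<bar>B s - A t\<bar>)" using A B st by (intro lip) auto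
    also have "\<dots> \<le> ennreal (M * (A t - B s))" using True L by (intro ennreal_leI) (auto simp: M_def intro!: mult_right_mono)
    finally have 2: "cc_dist V (g (B s)) (g (A t)) \<le> ennreal (M * (A t - B s))" .
    have "cc_dist V (F s) (F t) \<le> cc_dist V (F s) (g (B s)) + (cc_dist V (g (B s)) (g (A t)) + cc_dist V (g (A t)) (F t))"
      by (rule order_trans[OF cc_dist_triangle[of _ _ "g (B s)"]]) (rule add_left_mono[OF cc_dist_triangle])
    also have "\<dots> \<le> ennreal (M * (B s - s)) + (ennreal (M * (A t - B s)) + ennreal (M * (t - A t)))"
      using 1 2 3 by (intro add_mono)
    also have "\<dots> = ennreal (M * (B s - s) + (M * (A t - B s) + M * (t - A t)))"
      using M True B(2)[of s] A(2)[of t] st by (simp add: ennreal_plus)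
    also have "M * (B s - s) + (M * (A t - B s) + M * (t - A t)) = M * (t - s)" by (simp add: algebra_simps)
    finally show ?thesis .
  next
    case False
    have nT: "\<not> (s \<le> x \<and> x \<le> t)" if x: "x \<in> T" for x
    proof
      assume "s \<le> x \<and> x \<le> t"
      then have "B s \<le> x" "x \<le> A t" using A(3)[of t x] B(3)[of s x] x st by auto
      then show False using False by simp
    qed
    have sT: "s \<notin> T" and tT: "t \<notin> T" using nT[of s] nT[of t] st by auto
    have ss: "lo \<le> s" "s \<le> hi" and tt: "lo \<le> t" "t \<le> hi" using st by auto
    note gs = gap[OF sT ss] and gt = gap[OF tT tt]
    have "A t = A s"
    proof (rule antisym)
      have "A t < s" using nT[OF A(1)[OF tt(1)]] gt by force
      then show "A t \<le> A s" using A(3)[OF ss(1) A(1)[OF tt(1)]] by simp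
      show "A s \<le> A t" using A(3)[OF tt(1) A(1)[OF ss(1)]] gs st by simp
    qed
    moreover have "B t = B s"
    proof (rule antisym)
      have "t < B s" using nT[OF B(1)[OF ss(2)]] gs by force
      then show "B t \<le> B s" using B(3)[OF tt(2) B(1)[OF ss(2)]] by simp
      show "B s \<le> B t" using B(3)[OF ss(2) B(1)[OF tt(2)]] gt st by simp
    qed
    ultimately have Ft: "F t = H (A s) (B s) (M * (t - A s))" using tT by (simp add: F_def)
    have AB: "A s \<in> T" "B s \<in> T" "A s < B s" using A(1)[OF ss(1)] B(1)[OF ss(2)] gs by auto
    have "cc_dist V (F s) (F t) \<le> ennreal (M * (t - A s) - M * (s - A s))"
      unfolding Ft using sT M gs gt st \<open>B t = B s\<close>
      by (simp add: F_def, intro tangent_path_imp_cc_dist_le[OF H(1)[OF AB]]) (auto intro!: mult_left_mono mult_nonneg_nonneg)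
    also have "M * (t - A s) - M * (s - A s) = M * (t - s)" by (simp add: algebra_simps)
    finally show ?thesis .
  qed
  define cl where "cl s = max lo (min hi s)" for s
  have lohi: "lo \<le> hi" using lo(2)[OF hi(1)] .
  have cl: "lo \<le> cl s" "cl s \<le> hi" "\<bar>cl s - cl t\<bar> \<le> \<bar>s - t\<bar>" for s t
    using lohi by (auto simp: cl_def max_def min_def)
  have clT: "cl t = t" if "t \<in> T" for t using lo(2)[OF that] hi(2)[OF that] by (simp add: cl_def)
  have "cc_dist V (F (cl s)) (F (cl t)) \<le> ennreal (M * \<bar>s - t\<bar>)" for s t
  proof -
    have "cc_dist V (F (cl s)) (F (cl t)) \<le> ennreal (M * \<bar>cl s - cl t\<bar>)"
    proof (cases "cl s \<le> cl t")
      case True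
      then show ?thesis using Flip[of "cl s" "cl t"] cl by simp
    next
      case False
      then show ?thesis using Flip[of "cl t" "cl s"] cl by (simp add: cc_dist_commute)
    qed
    also have "\<dots> \<le> ennreal (M * \<bar>s - t\<bar>)" using cl(3) M by (intro ennreal_leI mult_left_mono) auto
    finally show ?thesis .
  qed
  then show ?thesis using that[of "\<lambda>s. F (cl s)"] FT clT by (simp add: M_def)
qed

lemma norm_integral_increment:
  fixes F :: "real \<Rightarrow> 'b::euclidean_space"
  assumes ab: "a \<le> b" and r: "0 \<le> r" and M: "0 \<le> M"
    and lip: "\<And>s t. s \<in> {a..b + r} \<Longrightarrow> t \<in> {a..b + r} \<Longrightarrow> norm (F s - F t) \<le> M * \<bar>s - t\<bar>"
  shows "norm (integral {a..b} (\<lambda>s. F (s + r) - F s) - r *\<^sub>R (F b - F a)) \<le> 2 * M * r\<^sup>2"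
proof -
  have cont: "continuous_on {a..b + r} F"
    by (rule lipschitz_on_continuous_on[of M]) (use M lip in \<open>auto simp: lipschitz_on_def dist_norm\<close>)
  have int: "F integrable_on {u..w}" if "a \<le> u" "w \<le> b + r" for u w
    using that by (intro integrable_continuous_real continuous_on_subset[OF cont]) auto
  have short: "norm (integral {u..u + r} F - r *\<^sub>R F u) \<le> M * r\<^sup>2" if u: "a \<le> u" "u \<le> b" for u
  proof -
    have "integral {u..u + r} F - r *\<^sub>R F u = integral {u..u + r} (\<lambda>s. F s - F u)"
      using int[of u "u + r"] u r by (subst integral_diff) auto
    also have "norm \<dots> \<le> (M * r) * (u + r - u)"
    proof (rule integral_bound)
      show "continuous_on {u..u + r} (\<lambda>s. F s - F u)"
        using u r by (intro continuous_intros continuous_on_subset[OF cont]) auto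
      show "norm (F s - F u) \<le> M * r" if "s \<in> {u..u + r}" for s
      proof -
        have "norm (F s - F u) \<le> M * \<bar>s - u\<bar>" using that u r by (intro lip) auto
        also have "\<dots> \<le> M * r" using that M by (intro mult_left_mono) auto
        finally show ?thesis .
      qed
    qed (use r in auto)
    finally show ?thesis by (simp add: power2_eq_square)
  qed
  have shift: "integral {a..b} (\<lambda>s. F (s + r)) = integral {a + r..b + r} F"
    using integral_shift[of a r b F] continuous_on_subset[OF cont, of "{a + r..b + r}"] r by (simp add: comp_def)
  have sh: "continuous_on {a..b} (\<lambda>s. F (s + r))"
    by (rule continuous_on_compose2[OF cont]) (use r in \<open>auto intro!: continuous_intros\<close>)
  have "integral {a..b} (\<lambda>s. F (s + r) - F s) = integral {a + r..b + r} F - integral {a..b} F"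
    using shift int[of a b] r integrable_continuous_real[OF sh] by (subst integral_diff) auto
  also have "\<dots> = integral {b..b + r} F - integral {a..a + r} F"
    using Henstock_Kurzweil_Integration.integral_combine[of a "a + r" "b + r" F]
      Henstock_Kurzweil_Integration.integral_combine[of a b "b + r" F] int[of a "b + r"] ab r
    by (simp add: algebra_simps)
  finally have "integral {a..b} (\<lambda>s. F (s + r) - F s) - r *\<^sub>R (F b - F a)
      = (integral {b..b + r} F - r *\<^sub>R F b) - (integral {a..a + r} F - r *\<^sub>R F a)"
    by (simp add: algebra_simps)
  also have "norm \<dots> \<le> M * r\<^sup>2 + M * r\<^sup>2"
    by (rule order_trans[OF norm_triangle_ineq4 add_mono[OF short short]]) (use ab in auto)
  finally show ?thesis by simp
qed

lemma (in first_order_distribution) line_defect_small: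
  assumes M: "0 < M" and ccl: "\<And>s t. cc_dist V (G s) (G t) \<le> ennreal (M * \<bar>s - t\<bar>)"
    and e: "0 < \<epsilon>" "0 < e"
  obtains r\<^sub>0 where "r\<^sub>0 > 0" "\<And>r S. 0 < r \<Longrightarrow> r < r\<^sub>0 \<Longrightarrow> S \<in> lmeasurable \<Longrightarrow>
     S \<subseteq> {s\<in>{0..1}. ennreal (norm (G (s + r) - G s) + \<epsilon> * r) \<le> cc_dist V (G s) (G (s + r))} \<Longrightarrow>
     measure lebesgue S \<le> e"
proof -
  have lip: "norm (G s - G t) \<le> M * \<bar>s - t\<bar>" for s t
  proof -
    have "ennreal (norm (G s - G t)) \<le> ennreal (M * \<bar>s - t\<bar>)"
      by (subst abs_minus_commute) (rule order_trans[OF norm_le_cc_dist ccl])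
    then show ?thesis using M by (simp add: ennreal_le_iff)
  qed
  have tan: "tangent_at V G UNIV t" for t
  proof (rule tangent_at_if_chord_controlled[of "M + 1"])
    show "norm (G s - G t) \<le> (M + 1) * \<bar>s - t\<bar>" for s
      by (rule order_trans[OF lip]) (auto intro: mult_right_mono)
    show "chord_controlled V ((M + 1) * (s' - s)) (G s) (G s')" if "s < s'" for s s'
    proof (rule cc_dist_chord_controlled)
      have "cc_dist V (G s) (G s') \<le> ennreal (M * \<bar>s - s'\<bar>)" by (rule ccl)
      also have "\<dots> < ennreal ((M + 1) * (s' - s))" using that M by (simp add: ennreal_less_iff)
      finally show "cc_dist V (G s) (G s') < ennreal ((M + 1) * (s' - s))" .
    qed
  qed (use M in auto)
  have cc_arc: "cc_dist V (G s) (G t) \<le> arc_length G s t" if "s \<le> t" for s t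
    using M lip tangent_at_subset[OF tan] by (intro cc_dist_le_arc_length[OF that, of M]) auto
  have arc_le: "arc_length G s t \<le> ennreal (M * (t - s))" if "s \<le> t" for s t
  proof (rule arc_length_lipschitz[OF _ that])
    show "norm (G w - G u) \<le> M * (w - u)" if "u \<le> w" for u w using lip[of w u] that by simp
  qed
  have fin: "arc_length G s t < top" if "s \<le> t" for s t
    using arc_le[OF that] by (rule le_less_trans) simp
  define lam where "lam t = enn2real (arc_length G 0 t)" for t
  have lam0: "lam 0 = 0" by (simp add: lam_def arc_length_refl)
  have inc: "lam t - lam s = enn2real (arc_length G s t)" if "0 \<le> s" "s \<le> t" for s t
    using arc_length_additive[of 0 s t G] fin[of 0 s] fin[of s t] that by (simp add: lam_def enn2real_plus)
  have inc_le: "0 \<le> lam t - lam s" "lam t - lam s \<le> M * (t - s)" if "0 \<le> s" "s \<le> t" for s t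
  proof -
    show "0 \<le> lam t - lam s" using inc[OF that] by simp
    have "enn2real (arc_length G s t) \<le> enn2real (ennreal (M * (t - s)))" using that arc_le by (intro enn2real_mono) auto
    then show "lam t - lam s \<le> M * (t - s)" using inc[OF that] M that by simp
  qed
  have lam_lip: "norm (lam s - lam t) \<le> M * \<bar>s - t\<bar>" if "0 \<le> s" "0 \<le> t" for s t
    using inc_le[of s t] inc_le[of t s] that by (cases "s \<le> t") auto
  have contG: "continuous_on A G" for A
    by (rule lipschitz_on_continuous_on[of M]) (use M lip in \<open>auto simp: lipschitz_on_def dist_norm\<close>)
  have contl: "continuous_on A lam" if "A \<subseteq> {0..}" for A
    by (rule lipschitz_on_continuous_on[of M]) (use M lam_lip that in \<open>auto simp: lipschitz_on_def dist_norm subset_iff\<close>)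
  define \<eta> where "\<eta> = \<epsilon> * e / 2"
  have \<eta>: "\<eta> > 0" using e by (simp add: \<eta>_def)
  obtain D where D: "D division_of {0..1::real}" "lam 1 - \<eta> \<le> chord_sum G D"
  proof (cases "lam 1 - \<eta> < 0")
    case True
    obtain D where "D division_of {0..1::real}" using elementary_interval[of "0::real" 1] by (auto simp: box_real)
    then show ?thesis using that[of D] True chord_sum_nonneg[of G D] by linarith
  next
    case False
    have "ennreal (lam 1 - \<eta>) < arc_length G 0 1"
    proof -
      have "arc_length G 0 1 = ennreal (lam 1)" using fin[of 0 1] by (simp add: lam_def)
      then show ?thesis using False \<eta> by (simp add: ennreal_less_iff)
    qed
    then obtain D where "D division_of {0..1::real}" "ennreal (lam 1 - \<eta>) < ennreal (chord_sum G D)"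
      unfolding arc_length_def less_SUP_iff by auto
    then show ?thesis using that[of D] False by (simp add: ennreal_less_iff)
  qed
  define N where "N = 2 * M * (1 + real (card D))"
  have N: "N > 0" using M by (simp add: N_def)
  show ?thesis
  proof (rule that[of "\<eta> / N"])
    show "\<eta> / N > 0" using \<eta> N by simp
    fix r S assume r: "0 < r" "r < \<eta> / N" and S: "S \<in> lmeasurable"
      and sub: "S \<subseteq> {s\<in>{0..1}. ennreal (norm (G (s + r) - G s) + \<epsilon> * r) \<le> cc_dist V (G s) (G (s + r))}"
    define h where "h s = (lam (s + r) - lam s) - norm (G (s + r) - G s)" for s
    have contlr: "continuous_on {0..1} (\<lambda>s. lam (s + r))"
      using r by (intro continuous_on_compose2[OF contl[of "{0..}"]] continuous_intros) auto
    have contGr: "continuous_on A (\<lambda>s. G (s + r))" for A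
      by (intro continuous_on_compose2[OF contG[of UNIV]] continuous_intros) auto
    have int1: "(\<lambda>s. lam (s + r) - lam s) integrable_on {0..1}"
      by (intro integrable_continuous_real continuous_intros contlr contl) auto
    have int2: "(\<lambda>s. norm (G (s + r) - G s)) integrable_on {u..w}" for u w
      by (intro integrable_continuous_real continuous_intros contGr contG)
    have hint: "h integrable_on {0..1}" unfolding h_def using int1 int2 by (rule integrable_diff)
    have h0: "0 \<le> h s" if "s \<in> {0..1}" for s
    proof -
      have "ennreal (norm (G (s + r) - G s)) \<le> arc_length G s (s + r)" using r by (intro norm_le_arc_length) auto
      also have "\<dots> = ennreal (lam (s + r) - lam s)" using inc[of s "s + r"] fin[of s "s + r"] that r by simp
      finally show ?thesis using inc_le[of s "s + r"] that r by (simp add: h_def ennreal_le_iff)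
    qed
    have hS: "\<epsilon> * r \<le> h s" if "s \<in> S" for s
    proof -
      have s: "s \<in> {0..1}" "ennreal (norm (G (s + r) - G s) + \<epsilon> * r) \<le> cc_dist V (G s) (G (s + r))" using sub that by auto
      note s(2)
      also have "cc_dist V (G s) (G (s + r)) \<le> arc_length G s (s + r)" using r by (intro cc_arc) auto
      also have "\<dots> = ennreal (lam (s + r) - lam s)" using inc[of s "s + r"] fin[of s "s + r"] s r by simp
      finally have "norm (G (s + r) - G s) + \<epsilon> * r \<le> lam (s + r) - lam s"
        using inc_le(1)[of s "s + r"] s r by (subst (asm) ennreal_le_iff) auto
      then show ?thesis by (simp add: h_def)
    qed
    have "((\<lambda>s. indicator S s :: real) has_integral measure lebesgue S) UNIV"
      using S lmeasurable_iff_has_integral by blast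
    then have "((\<lambda>s. if s \<in> {0..1} then indicator S s else (0::real)) has_integral measure lebesgue S) UNIV"
      by (rule has_integral_eq[rotated]) (use sub in \<open>auto simp: indicator_def\<close>)
    then have "((\<lambda>s. indicator S s :: real) has_integral measure lebesgue S) {0..1}"
      by (simp only: has_integral_restrict_UNIV)
    then have iS: "((\<lambda>s. (\<epsilon> * r) * indicator S s) has_integral (\<epsilon> * r) * measure lebesgue S) {0..1}"
      by (rule has_integral_mult_right)
    have up: "(\<epsilon> * r) * measure lebesgue S \<le> integral {0..1} h"
      using iS integrable_integral[OF hint]
      by (rule has_integral_le) (use h0 hS in \<open>auto simp: indicator_def\<close>)
    have split: "integral {0..1} h = integral {0..1} (\<lambda>s. lam (s + r) - lam s) - integral {0..1} (\<lambda>s. norm (G (s + r) - G s))"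
      unfolding h_def using int1 int2 by (rule integral_diff)
    have first: "integral {0..1} (\<lambda>s. lam (s + r) - lam s) \<le> r * lam 1 + 2 * M * r\<^sup>2"
      using norm_integral_increment[of 0 1 r M lam] lam_lip r M lam0 by (auto simp: abs_le_iff)
    have second: "integral {0..1} (\<lambda>s. norm (G (s + r) - G s)) \<ge> r * (lam 1 - \<eta>) - real (card D) * (2 * M * r\<^sup>2)"
    proof -
      have one: "r * norm (G (Sup I) - G (Inf I)) - 2 * M * r\<^sup>2 \<le> integral I (\<lambda>s. norm (G (s + r) - G s))" if ID: "I \<in> D" for I
      proof -
        obtain u w where uw: "u \<le> w" "I = {u..w}" using division_intervalE[OF D(1) ID] by blast
        have "norm (integral {u..w} (\<lambda>s. G (s + r) - G s) - r *\<^sub>R (G w - G u)) \<le> 2 * M * r\<^sup>2"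
          using lip uw r M by (intro norm_integral_increment) auto
        then have "norm (r *\<^sub>R (G w - G u)) - 2 * M * r\<^sup>2 \<le> norm (integral {u..w} (\<lambda>s. G (s + r) - G s))"
          using norm_triangle_sub[of "r *\<^sub>R (G w - G u)" "integral {u..w} (\<lambda>s. G (s + r) - G s)"]
          by (simp add: norm_minus_commute)
        also have "\<dots> \<le> integral {u..w} (\<lambda>s. norm (G (s + r) - G s))"
          by (intro integral_norm_bound_integral integrable_continuous_real continuous_intros contGr contG) auto
        finally show ?thesis using uw r by simp
      qed
      have "r * (lam 1 - \<eta>) - real (card D) * (2 * M * r\<^sup>2) \<le> r * chord_sum G D - real (card D) * (2 * M * r\<^sup>2)"
        using D(2) r by simp
      also have "\<dots> = (\<Sum>I\<in>D. r * norm (G (Sup I) - G (Inf I)) - 2 * M * r\<^sup>2)"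
        by (simp add: chord_sum_def sum_subtractf sum_distrib_left)
      also have "\<dots> \<le> (\<Sum>I\<in>D. integral I (\<lambda>s. norm (G (s + r) - G s)))" by (intro sum_mono one)
      also have "\<dots> = integral {0..1} (\<lambda>s. norm (G (s + r) - G s))"
        using integral_combine_division_topdown[OF int2 D(1)] by simp
      finally show ?thesis .
    qed
    have "(\<epsilon> * r) * measure lebesgue S \<le> r * lam 1 + 2 * M * r\<^sup>2 - (r * (lam 1 - \<eta>) - real (card D) * (2 * M * r\<^sup>2))"
      using up first second unfolding split by linarith
    also have "\<dots> = r * (\<eta> + N * r)" by (simp add: N_def algebra_simps power2_eq_square)
    also have "\<dots> \<le> r * (\<eta> + \<eta>)"
    proof -
      have "N * r < \<eta>" using r(2) N by (simp add: pos_less_divide_eq mult.commute)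
      then show ?thesis using r(1) by (intro mult_left_mono) auto
    qed
    also have "\<dots> = (\<epsilon> * r) * e" by (simp add: \<eta>_def)
    finally show "measure lebesgue S \<le> e" using e r by simp
  qed
qed

definition cc_lipschitz_on :: "real \<Rightarrow> ('b::euclidean_space \<Rightarrow> 'b set) \<Rightarrow> 'a::metric_space set \<Rightarrow> ('a \<Rightarrow> 'b) \<Rightarrow> bool" where
  "cc_lipschitz_on L V K f \<longleftrightarrow> 0 \<le> L \<and> (\<forall>x\<in>K. \<forall>y\<in>K. cc_dist V (f x) (f y) \<le> ennreal (L * dist x y))"

lemma cc_lipschitz_on_norm:
  assumes "cc_lipschitz_on L V K f" "x \<in> K" "y \<in> K"
  shows "norm (f x - f y) \<le> L * dist x y"
proof -
  have "ennreal (norm (f y - f x)) \<le> ennreal (L * dist x y)"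
    using norm_le_cc_dist assms unfolding cc_lipschitz_on_def by (meson order_trans)
  then show ?thesis using assms by (simp add: cc_lipschitz_on_def ennreal_le_iff norm_minus_commute)
qed

lemma cc_lipschitz_on_continuous:
  assumes "cc_lipschitz_on L V K f"
  shows "continuous_on K f"
  by (rule lipschitz_on_continuous_on[of L])
     (use assms cc_lipschitz_on_norm[OF assms] in \<open>auto simp: lipschitz_on_def dist_norm cc_lipschitz_on_def\<close>)

definition real_cc_dist :: "('b::euclidean_space \<Rightarrow> 'b set) \<Rightarrow> 'b \<Rightarrow> 'b \<Rightarrow> real" where
  "real_cc_dist V p q = enn2real (cc_dist V p q)"

lemma cc_lipschitz_on_real:
  assumes "cc_lipschitz_on L V K f" "x \<in> K" "y \<in> K"
  shows "cc_dist V (f x) (f y) = ennreal (real_cc_dist V (f x) (f y))" "real_cc_dist V (f x) (f y) \<le> L * dist x y"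
    "0 \<le> real_cc_dist V (f x) (f y)"
proof -
  have le: "cc_dist V (f x) (f y) \<le> ennreal (L * dist x y)" using assms by (auto simp: cc_lipschitz_on_def)
  then show eq: "cc_dist V (f x) (f y) = ennreal (real_cc_dist V (f x) (f y))"
    unfolding real_cc_dist_def by (metis ennreal_enn2real ennreal_less_top le_less_trans)
  show "0 \<le> real_cc_dist V (f x) (f y)" by (simp add: real_cc_dist_def)
  have "0 \<le> L * dist x y" using assms(1) by (simp add: cc_lipschitz_on_def)
  then show "real_cc_dist V (f x) (f y) \<le> L * dist x y" using le unfolding eq by (simp add: ennreal_le_iff)
qed

lemma (in first_order_distribution) real_cc_dist_triangle:
  assumes "cc_lipschitz_on L V K f" "x \<in> K" "y \<in> K" "z \<in> K"
  shows "real_cc_dist V (f x) (f z) \<le> real_cc_dist V (f x) (f y) + real_cc_dist V (f y) (f z)"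
proof -
  note r = cc_lipschitz_on_real[OF assms(1)]
  have "ennreal (real_cc_dist V (f x) (f z)) \<le> ennreal (real_cc_dist V (f x) (f y)) + ennreal (real_cc_dist V (f y) (f z))"
    using cc_dist_triangle[of "f x" "f z" "f y"] r(1) assms(2-4) by metis
  then show ?thesis using r(3) assms(2-4) by (simp add: ennreal_plus[symmetric] ennreal_le_iff del: ennreal_plus)
qed

lemma (in first_order_distribution) continuous_on_real_cc_dist:
  fixes A :: "'c::metric_space set" and K :: "'a::metric_space set"
  assumes f: "cc_lipschitz_on L V K f"
    and u: "continuous_on A u" "u ` A \<subseteq> K" and w: "continuous_on A w" "w ` A \<subseteq> K"
  shows "continuous_on A (\<lambda>x. real_cc_dist V (f (u x)) (f (w x)))"
  unfolding continuous_on_iff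
proof (intro ballI allI impI)
  fix x e assume x: "x \<in> A" and e: "(0::real) < e"
  have L: "0 \<le> L" using f by (simp add: cc_lipschitz_on_def)
  define e' where "e' = e / 2 / (L + 1)"
  have e': "e' > 0" using e L by (simp add: e'_def)
  obtain d1 where d1: "d1 > 0" "\<And>y. y \<in> A \<Longrightarrow> dist y x < d1 \<Longrightarrow> dist (u y) (u x) < e'"
    using u(1) x e' unfolding continuous_on_iff by meson
  obtain d2 where d2: "d2 > 0" "\<And>y. y \<in> A \<Longrightarrow> dist y x < d2 \<Longrightarrow> dist (w y) (w x) < e'"
    using w(1) x e' unfolding continuous_on_iff by meson
  have "dist (real_cc_dist V (f (u y)) (f (w y))) (real_cc_dist V (f (u x)) (f (w x))) < e"
    if y: "y \<in> A" "dist y x < min d1 d2" for y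
  proof -
    let ?r = "\<lambda>a b. real_cc_dist V (f a) (f b)"
    have K: "u x \<in> K" "u y \<in> K" "w x \<in> K" "w y \<in> K" using x y u w by auto
    note t = real_cc_dist_triangle[OF f] and l = cc_lipschitz_on_real(2)[OF f]
    have "?r (u y) (w y) \<le> ?r (u y) (u x) + (?r (u x) (w x) + ?r (w x) (w y))"
      using t[of "u y" "u x" "w y"] t[of "u x" "w x" "w y"] K by linarith
    moreover have "?r (u x) (w x) \<le> ?r (u x) (u y) + (?r (u y) (w y) + ?r (w y) (w x))"
      using t[of "u x" "u y" "w x"] t[of "u y" "w y" "w x"] K by linarith
    moreover have "?r (u x) (u y) \<le> L * e'" "?r (u y) (u x) \<le> L * e'" "?r (w x) (w y) \<le> L * e'" "?r (w y) (w x) \<le> L * e'"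
    proof -
      have "dist (u y) (u x) \<le> e'" "dist (w y) (w x) \<le> e'" using d1(2) d2(2) y by (auto intro: less_imp_le)
      then have "L * dist (u y) (u x) \<le> L * e'" "L * dist (w y) (w x) \<le> L * e'" using L by (auto intro: mult_left_mono)
      then show "?r (u x) (u y) \<le> L * e'" "?r (u y) (u x) \<le> L * e'" "?r (w x) (w y) \<le> L * e'" "?r (w y) (w x) \<le> L * e'"
        using l[of "u x" "u y"] l[of "u y" "u x"] l[of "w x" "w y"] l[of "w y" "w x"] K by (auto simp: dist_commute)
    qed
    moreover have "2 * (L * e') < e"
    proof -
      have "2 * (L * e') < 2 * ((L + 1) * e')" using e' by simp
      also have "(L + 1) * e' = e / 2"
      proof -
        have "L + 1 \<noteq> 0" using L by simp
        then show ?thesis by (metis e'_def mult.commute nonzero_eq_divide_eq)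
      qed
      also have "2 * (e / 2) = e" by simp
      finally show ?thesis .
    qed
    ultimately show ?thesis by (auto simp: dist_real_def abs_less_iff)
  qed
  then show "\<exists>d>0. \<forall>y\<in>A. dist y x < d \<longrightarrow> dist (real_cc_dist V (f (u y)) (f (w y))) (real_cc_dist V (f (u x)) (f (w x))) < e"
    using d1(1) d2(1) by (intro exI[of _ "min d1 d2"]) auto
qed

definition direction_defect ::
  "('b::euclidean_space \<Rightarrow> 'b set) \<Rightarrow> 'a::euclidean_space set \<Rightarrow> ('a \<Rightarrow> 'b) \<Rightarrow> 'a \<Rightarrow> real \<Rightarrow> real \<Rightarrow> 'a set" where
  "direction_defect V K f v \<epsilon> r = {x \<in> K. x + r *\<^sub>R v \<in> K \<and>
     norm (f (x + r *\<^sub>R v) - f x) + \<epsilon> * r \<le> real_cc_dist V (f x) (f (x + r *\<^sub>R v))}"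

lemma compact_shifted_intersection:
  assumes "compact (K :: 'a::euclidean_space set)"
  shows "compact {x \<in> K. x + a \<in> K}"
proof -
  have "{x \<in> K. x + a \<in> K} = K \<inter> (\<lambda>x. x - a) ` K" by (force simp: image_iff)
  moreover have "compact ((\<lambda>x. x - a) ` K)" using assms by (simp add: compact_translation_subtract)
  ultimately show ?thesis using assms by (simp add: compact_Int)
qed

lemma (in first_order_distribution) compact_direction_defect:
  assumes f: "cc_lipschitz_on L V K f" and K: "compact K"
  shows "compact (direction_defect V K f v \<epsilon> r)"
proof -
  let ?A = "{x \<in> K. x + r *\<^sub>R v \<in> K}"
  let ?g = "\<lambda>x. real_cc_dist V (f x) (f (x + r *\<^sub>R v)) - norm (f (x + r *\<^sub>R v) - f x)"
  have A: "compact ?A" by (rule compact_shifted_intersection[OF K])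
  have cf: "continuous_on K f" by (rule cc_lipschitz_on_continuous[OF f])
  have "continuous_on ?A ?g"
    by (intro continuous_intros continuous_on_real_cc_dist[OF f] continuous_on_compose2[OF cf]) auto
  then have "closed (?A \<inter> ?g -` {\<epsilon> * r..})"
    using compact_imp_closed[OF A] by (intro continuous_closed_preimage) auto
  with A have "compact (?A \<inter> (?A \<inter> ?g -` {\<epsilon> * r..}))" by (rule compact_Int_closed)
  moreover have "direction_defect V K f v \<epsilon> r = ?A \<inter> ?g -` {\<epsilon> * r..}"
    by (auto simp: direction_defect_def)
  ultimately show ?thesis by (simp only: Int_left_absorb)
qed

lemma (in first_order_distribution) direction_defect_on_line_tendsto_0:
  assumes f: "cc_lipschitz_on L V K f" and K: "compact K" and \<epsilon>: "0 < \<epsilon>"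
    and r: "\<And>n. 0 < r n" "r \<longlonglongrightarrow> 0"
  shows "(\<lambda>n. emeasure lborel {s\<in>{0..1}. x + s *\<^sub>R v \<in> direction_defect V K f v \<epsilon> (r n)}) \<longlonglongrightarrow> 0"
proof -
  define T where "T = {s\<in>{0..2}. x + s *\<^sub>R v \<in> K}"
  define S where "S n = {s\<in>{0..1}. x + s *\<^sub>R v \<in> direction_defect V K f v \<epsilon> (r n)}" for n
  have pre: "closed {s\<in>{0..c::real}. x + s *\<^sub>R v \<in> A}" if "closed A" for A c
  proof -
    have "closed ({0..c} \<inter> (\<lambda>s. x + s *\<^sub>R v) -` A)" using that
      by (intro continuous_closed_preimage continuous_intros) auto
    then show ?thesis by (simp add: vimage_def Int_def)
  qed
  have "closed T" unfolding T_def using K by (intro pre compact_imp_closed)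
  moreover have "bounded T" by (rule bounded_subset[of "{0..2}"]) (auto simp: T_def)
  ultimately have cT: "compact T" by (simp add: compact_eq_bounded_closed)
  have Sm: "S n \<in> lmeasurable" for n
  proof -
    have "closed (S n)" unfolding S_def using compact_direction_defect[OF f K] by (intro pre compact_imp_closed)
    moreover have "bounded (S n)" by (rule bounded_subset[of "{0..1}"]) (auto simp: S_def)
    ultimately show ?thesis by (simp add: compact_eq_bounded_closed lmeasurable_compact)
  qed
  have L: "0 \<le> L" using f by (simp add: cc_lipschitz_on_def)
  have "(\<lambda>n. measure lebesgue (S n)) \<longlonglongrightarrow> 0"
  proof (cases "T = {}")
    case True
    have ev: "eventually (\<lambda>n. r n < 1) sequentially" using r(2) by (rule order_tendstoD) simp
    then have "eventually (\<lambda>n. measure lebesgue (S n) = 0) sequentially"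
    proof (rule eventually_mono)
      fix n assume "r n < 1"
      have "S n = {}"
      proof (rule ccontr)
        assume "S n \<noteq> {}"
        then obtain s where "s \<in> S n" by blast
        then have "s \<in> T" by (auto simp: S_def T_def direction_defect_def)
        then show False using True by simp
      qed
      then show "measure lebesgue (S n) = 0" by simp
    qed
    then show ?thesis by (rule tendsto_eventually)
  next
    case False
    have "cc_dist V (f (x + s *\<^sub>R v)) (f (x + t *\<^sub>R v)) \<le> ennreal ((L * norm v) * \<bar>s - t\<bar>)" if "s \<in> T" "t \<in> T" for s t
    proof -
      have "dist (x + s *\<^sub>R v) (x + t *\<^sub>R v) = norm v * \<bar>s - t\<bar>"
        by (simp add: dist_norm scaleR_diff_left[symmetric])
      moreover have "cc_dist V (f (x + s *\<^sub>R v)) (f (x + t *\<^sub>R v)) \<le> ennreal (L * dist (x + s *\<^sub>R v) (x + t *\<^sub>R v))"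
        using f that unfolding cc_lipschitz_on_def T_def by blast
      ultimately show ?thesis by (simp only: mult.assoc)
    qed
    then obtain G where G: "\<And>t. t \<in> T \<Longrightarrow> G t = f (x + t *\<^sub>R v)"
      "\<And>s t. cc_dist V (G s) (G t) \<le> ennreal ((L * norm v + 1) * \<bar>s - t\<bar>)"
      using lipschitz_extension_to_line[OF cT False, of "L * norm v" "\<lambda>s. f (x + s *\<^sub>R v)"] L by auto
    have M: "0 < L * norm v + 1" using L by (simp add: add_nonneg_pos)
    show ?thesis
    proof (rule LIMSEQ_I)
      fix e :: real assume e: "e > 0"
      obtain r0 where r0: "r0 > 0" "\<And>r S. 0 < r \<Longrightarrow> r < r0 \<Longrightarrow> S \<in> lmeasurable \<Longrightarrow>
         S \<subseteq> {s\<in>{0..1}. ennreal (norm (G (s + r) - G s) + \<epsilon> * r) \<le> cc_dist V (G s) (G (s + r))} \<Longrightarrow>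
         measure lebesgue S \<le> e / 2"
        by (rule line_defect_small[OF M G(2) \<epsilon>, of "e/2"]) (use e in auto)
      have "eventually (\<lambda>n. r n < min 1 r0) sequentially" using r0(1) by (intro order_tendstoD[OF r(2)]) auto
      then obtain N where N: "\<And>n. n \<ge> N \<Longrightarrow> r n < min 1 r0" unfolding eventually_sequentially by blast
      have "norm (measure lebesgue (S n) - 0) < e" if "n \<ge> N" for n
      proof -
        have rn: "r n < 1" "r n < r0" using N[OF that] by auto
        have "measure lebesgue (S n) \<le> e / 2"
        proof (rule r0(2)[OF r(1) rn(2) Sm], rule subsetI)
          fix s assume s: "s \<in> S n"
          have eq: "x + s *\<^sub>R v + r n *\<^sub>R v = x + (s + r n) *\<^sub>R v" by (simp add: scaleR_add_left)
          have s1: "s \<in> {0..1}" "x + s *\<^sub>R v \<in> K" "x + (s + r n) *\<^sub>R v \<in> K"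
            "norm (f (x + (s + r n) *\<^sub>R v) - f (x + s *\<^sub>R v)) + \<epsilon> * r n \<le> real_cc_dist V (f (x + s *\<^sub>R v)) (f (x + (s + r n) *\<^sub>R v))"
            using s unfolding S_def direction_defect_def mem_Collect_eq eq by auto
          have "s \<in> T" "s + r n \<in> T" using s1 rn r(1)[of n] by (auto simp: T_def)
          moreover have "ennreal (norm (f (x + (s + r n) *\<^sub>R v) - f (x + s *\<^sub>R v)) + \<epsilon> * r n) \<le> cc_dist V (f (x + s *\<^sub>R v)) (f (x + (s + r n) *\<^sub>R v))"
            unfolding cc_lipschitz_on_real(1)[OF f s1(2,3)] using s1(4) by (rule ennreal_leI)
          ultimately show "s \<in> {s\<in>{0..1}. ennreal (norm (G (s + r n) - G s) + \<epsilon> * r n) \<le> cc_dist V (G s) (G (s + r n))}"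
            using s1(1) G(1) by simp
        qed
        then show ?thesis using e by simp
      qed
      then show "\<exists>no. \<forall>n\<ge>no. norm (measure lebesgue (S n) - 0) < e" by blast
    qed
  qed
  then have "(\<lambda>n. ennreal (measure lebesgue (S n))) \<longlonglongrightarrow> ennreal 0" by (rule tendsto_ennrealI)
  moreover have "emeasure lborel (S n) = ennreal (measure lebesgue (S n))" for n
  proof -
    have "S n \<in> sets borel"
      unfolding S_def using compact_direction_defect[OF f K] by (intro borel_closed pre compact_imp_closed)
    then have "emeasure lborel (S n) = emeasure lebesgue (S n)" by simp
    also have "\<dots> = ennreal (measure lebesgue (S n))" using Sm by (rule emeasure_eq_measure2)
    finally show ?thesis .
  qed
  ultimately show ?thesis by (simp add: S_def)
qed

theorem (in first_order_distribution) direction_defect_measure_tendsto_0: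
  fixes K :: "'a::euclidean_space set"
  assumes f: "cc_lipschitz_on L V K f" and K: "compact K" and \<epsilon>: "0 < \<epsilon>"
    and r: "\<And>n. 0 < r n" "r \<longlonglongrightarrow> 0"
  shows "(\<lambda>n. emeasure lborel (direction_defect V K f v \<epsilon> (r n))) \<longlonglongrightarrow> 0"
proof -
  define D where "D n = direction_defect V K f v \<epsilon> (r n)" for n
  have Dc: "closed (D n)" for n unfolding D_def by (intro compact_imp_closed compact_direction_defect[OF f K])
  have DK: "D n \<subseteq> K" for n by (auto simp: D_def direction_defect_def)
  obtain B where B: "\<And>y. y \<in> K \<Longrightarrow> norm y \<le> B" using compact_imp_bounded[OF K] by (auto simp: bounded_iff)
  define R where "R = B + norm v"
  let ?u = "\<lambda>n x. emeasure lborel {s\<in>{0..1::real}. x + s *\<^sub>R v \<in> D n}"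
  have Dm: "(\<lambda>(s, x). indicator {0..1::real} s * indicator (D n) (x + s *\<^sub>R v) :: ennreal) \<in> borel_measurable (lborel \<Otimes>\<^sub>M lborel)" for n
  proof -
    have "(\<lambda>p. snd p + fst p *\<^sub>R v) \<in> borel_measurable (borel \<Otimes>\<^sub>M borel)" by measurable
    moreover have "D n \<in> sets borel" using Dc by simp
    ultimately have "(\<lambda>p. indicator {0..1::real} (fst p) * indicator (D n) (snd p + fst p *\<^sub>R v) :: ennreal) \<in> borel_measurable (borel \<Otimes>\<^sub>M borel)"
      by measurable
    then show ?thesis by (simp add: case_prod_unfold cong: measurable_cong_sets)
  qed
  have slice: "?u n x = (\<integral>\<^sup>+s. indicator {0..1::real} s * indicator (D n) (x + s *\<^sub>R v) \<partial>lborel)" for n x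
  proof -
    have "closed ({0..1::real} \<inter> (\<lambda>s. x + s *\<^sub>R v) -` D n)"
      by (intro continuous_closed_preimage continuous_intros Dc closed_real_atLeastAtMost)
    then have "closed {s\<in>{0..1::real}. x + s *\<^sub>R v \<in> D n}" by (simp add: vimage_def Int_def)
    then have "?u n x = (\<integral>\<^sup>+s. indicator {s\<in>{0..1::real}. x + s *\<^sub>R v \<in> D n} s \<partial>lborel)" by simp
    also have "\<dots> = (\<integral>\<^sup>+s. indicator {0..1::real} s * indicator (D n) (x + s *\<^sub>R v) \<partial>lborel)"
      by (intro nn_integral_cong) (auto simp: indicator_def)
    finally show ?thesis .
  qed
  have tonelli: "emeasure lborel (D n) = (\<integral>\<^sup>+x. ?u n x \<partial>lborel)" for n
  proof -
    have "(\<integral>\<^sup>+x. ?u n x \<partial>lborel) = (\<integral>\<^sup>+x. \<integral>\<^sup>+s. indicator {0..1::real} s * indicator (D n) (x + s *\<^sub>R v) \<partial>lborel \<partial>lborel)"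
      by (rule nn_integral_cong) (rule slice)
    also have "\<dots> = (\<integral>\<^sup>+s. \<integral>\<^sup>+x. indicator {0..1::real} s * indicator (D n) (x + s *\<^sub>R v) \<partial>lborel \<partial>lborel)"
      using lborel_pair.Fubini'[OF Dm] by simp
    also have "\<dots> = (\<integral>\<^sup>+s. indicator {0..1::real} s * emeasure lborel (D n) \<partial>lborel)"
    proof (rule nn_integral_cong)
      fix s :: real
      have [measurable]: "D n \<in> sets borel" using Dc by simp
      have m: "(\<lambda>x. indicator (D n) (x + s *\<^sub>R v) :: ennreal) \<in> borel_measurable borel" by measurable
      have "(\<integral>\<^sup>+x. indicator {0..1::real} s * indicator (D n) (x + s *\<^sub>R v) \<partial>lborel) =
         indicator {0..1::real} s * (\<integral>\<^sup>+x. indicator (D n) (s *\<^sub>R v + x) \<partial>lborel)"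
        using m by (subst nn_integral_cmult) (auto simp: add.commute)
      also have "(\<integral>\<^sup>+x. indicator (D n) (s *\<^sub>R v + x) \<partial>lborel) = (\<integral>\<^sup>+x. indicator (D n) x \<partial>distr lborel borel ((+) (s *\<^sub>R v)))"
        using Dc[of n] by (subst nn_integral_distr) auto
      also have "\<dots> = emeasure lborel (D n)" using Dc[of n] by (simp add: lborel_distr_plus)
      finally show "(\<integral>\<^sup>+x. indicator {0..1::real} s * indicator (D n) (x + s *\<^sub>R v) \<partial>lborel) = indicator {0..1::real} s * emeasure lborel (D n)" .
    qed
    also have "\<dots> = emeasure lborel (D n)" by (subst nn_integral_multc) auto
    finally show ?thesis by simp
  qed
  have "(\<lambda>n. \<integral>\<^sup>+x. ?u n x \<partial>lborel) \<longlonglongrightarrow> (\<integral>\<^sup>+x. 0 \<partial>(lborel :: 'a measure))"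
  proof (rule nn_integral_dominated_convergence[where w = "indicator (cball 0 R)"])
    show "?u n \<in> borel_measurable lborel" for n
      unfolding slice using lborel.borel_measurable_nn_integral[of "\<lambda>x s. indicator {0..1::real} s * indicator (D n) (x + s *\<^sub>R v)" lborel]
        measurable_compose[OF measurable_pair_swap' Dm[of n]] by (simp add: case_prod_unfold)
    show "AE x in lborel. ?u n x \<le> indicator (cball 0 R) x" for n
    proof (rule AE_I2)
      fix x :: 'a
      show "?u n x \<le> indicator (cball 0 R) x"
      proof (cases "x \<in> cball 0 R")
        case True
        have "?u n x \<le> emeasure lborel {0..1::real}" by (intro emeasure_mono) auto
        then show ?thesis using True by simp
      next
        case False
        have "{s\<in>{0..1::real}. x + s *\<^sub>R v \<in> D n} = {}"
        proof (rule ccontr)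
          assume "{s\<in>{0..1::real}. x + s *\<^sub>R v \<in> D n} \<noteq> {}"
          then obtain s :: real where s: "0 \<le> s" "s \<le> 1" "x + s *\<^sub>R v \<in> K" using DK by fastforce
          have "norm x \<le> norm (x + s *\<^sub>R v) + norm (s *\<^sub>R v)" using norm_triangle_ineq4[of "x + s *\<^sub>R v" "s *\<^sub>R v"] by simp
          also have "\<dots> \<le> B + norm v" using B[OF s(3)] s(1,2) by (intro add_mono) (auto intro: mult_left_le_one_le)
          finally show False using False by (simp add: R_def)
        qed
        then show ?thesis by (simp only: emeasure_empty zero_le)
      qed
    qed
    show "AE x in lborel. (\<lambda>n. ?u n x) \<longlonglongrightarrow> 0"
      using direction_defect_on_line_tendsto_0[OF f K \<epsilon> r] by (simp add: D_def)
    show "(\<integral>\<^sup>+x. indicator (cball 0 R) x \<partial>lborel) < \<infinity>"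
      using emeasure_lborel_cball_finite[of 0 R] by simp
    show "(indicator (cball 0 R) :: 'a \<Rightarrow> ennreal) \<in> borel_measurable lborel"
      by (intro borel_measurable_indicator) auto
  qed auto
  then show ?thesis using tonelli by (simp add: D_def)
qed

lemma McShane_extension:
  fixes g :: "'a::metric_space \<Rightarrow> real"
  assumes S: "S \<noteq> {}" and L: "0 \<le> L" and lip: "\<And>x y. x \<in> S \<Longrightarrow> y \<in> S \<Longrightarrow> \<bar>g x - g y\<bar> \<le> L * dist x y"
  obtains F where "\<And>x. x \<in> S \<Longrightarrow> F x = g x" "\<And>x y. \<bar>F x - F y\<bar> \<le> L * dist x y"
proof -
  define F where "F x = (INF y\<in>S. g y + L * dist x y)" for x
  obtain s where s: "s \<in> S" using S by blast
  have bdd: "bdd_below ((\<lambda>y. g y + L * dist x y) ` S)" for x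
  proof (rule bdd_belowI2)
    fix y assume y: "y \<in> S"
    have "g s - g y \<le> L * dist s y" using lip[OF s y] by linarith
    also have "\<dots> \<le> L * (dist s x + dist x y)" using L by (intro mult_left_mono dist_triangle)
    finally show "g s - L * dist s x \<le> g y + L * dist x y" by (simp add: algebra_simps)
  qed
  have le: "F x \<le> F y + L * dist x y" for x y
  proof -
    have "F x - L * dist x y \<le> g z + L * dist y z" if z: "z \<in> S" for z
    proof -
      have "F x \<le> g z + L * dist x z" unfolding F_def by (rule cINF_lower[OF bdd z])
      also have "\<dots> \<le> g z + L * (dist x y + dist y z)" using L by (intro add_left_mono mult_left_mono dist_triangle)
      finally show ?thesis by (simp add: algebra_simps)
    qed
    then have "F x - L * dist x y \<le> F y" unfolding F_def[of y] by (intro cINF_greatest S)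
    then show ?thesis by simp
  qed
  show ?thesis
  proof (rule that)
    fix x assume x: "x \<in> S"
    have "F x \<le> g x" using cINF_lower[OF bdd x, of x] by (simp add: F_def)
    moreover have "g x \<le> F x" unfolding F_def
    proof (rule cINF_greatest[OF S])
      fix y assume "y \<in> S"
      then show "g x \<le> g y + L * dist x y" using lip[OF x \<open>y \<in> S\<close>] by linarith
    qed
    ultimately show "F x = g x" by simp
  next
    fix x y show "\<bar>F x - F y\<bar> \<le> L * dist x y" using le[of x y] le[of y x] by (simp add: dist_commute abs_le_iff)
  qed
qed

lemma compactly_supported_lipschitz_extension:
  fixes f :: "'a::euclidean_space \<Rightarrow> 'b::euclidean_space"
  assumes K: "bounded K" and L: "0 \<le> L" and lip: "\<And>x y. x \<in> K \<Longrightarrow> y \<in> K \<Longrightarrow> norm (f x - f y) \<le> L * dist x y"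
  obtains F M R where "\<And>x. x \<in> K \<Longrightarrow> F x = f x" "0 \<le> M" "\<And>x y. norm (F x - F y) \<le> M * dist x y"
    "\<And>x. norm x > R \<Longrightarrow> F x = 0"
proof -
  obtain R where R: "\<And>x. x \<in> K \<Longrightarrow> norm x \<le> R" using K by (auto simp: bounded_iff)
  have "bounded (f ` K)"
  proof (cases "K = {}")
    case False
    then obtain k where k: "k \<in> K" by blast
    have "norm (f x) \<le> norm (f k) + L * (R + norm k)" if x: "x \<in> K" for x
    proof -
      have "norm (f x) \<le> norm (f k) + norm (f x - f k)" by (metis norm_triangle_sub)
      also have "norm (f x - f k) \<le> L * dist x k" by (rule lip[OF x k])
      also have "\<dots> \<le> L * (R + norm k)" using L R[OF x]
        by (intro mult_left_mono) (auto simp: dist_norm intro: order_trans[OF norm_triangle_ineq4])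
      finally show ?thesis by simp
    qed
    then show ?thesis by (auto simp: bounded_iff)
  qed simp
  then obtain C where C: "\<And>x. x \<in> K \<Longrightarrow> norm (f x) \<le> C" by (auto simp: bounded_iff)
  define C' where "C' = max C 0"
  define L' where "L' = max L C'"
  define S where "S = K \<union> {x. norm x > R + 1}"
  define g where "g x = (if x \<in> K then f x else 0)" for x
  have L': "0 \<le> L'" "L \<le> L'" "C' \<le> L'" using L by (auto simp: L'_def)
  have gl: "norm (g x - g y) \<le> L' * dist x y" if xy: "x \<in> S" "y \<in> S" for x y
  proof -
    have mixed: "norm (g x - g y) \<le> L' * dist x y" if "x \<in> K" "y \<notin> K" "y \<in> S" for x y
    proof -
      have "norm y > R + 1" using that by (auto simp: S_def)
      then have "1 \<le> dist x y" using R[OF that(1)] norm_triangle_ineq2[of y x] by (simp add: dist_norm norm_minus_commute)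
      have "norm (g x - g y) \<le> C'" using that C by (auto simp: g_def C'_def intro: order_trans[OF C])
      also have "\<dots> \<le> L' * 1" using L' by simp
      also have "\<dots> \<le> L' * dist x y" using L'(1) \<open>1 \<le> dist x y\<close> by (rule mult_left_mono[rotated])
      finally show ?thesis .
    qed
    consider "x \<in> K" "y \<in> K" | "x \<in> K" "y \<notin> K" | "x \<notin> K" "y \<in> K" | "x \<notin> K" "y \<notin> K" by blast
    then show ?thesis
    proof cases
      case 1
      then have "norm (g x - g y) \<le> L * dist x y" using lip by (simp add: g_def)
      also have "\<dots> \<le> L' * dist x y" using L' by (intro mult_right_mono) auto
      finally show ?thesis .
    next
      case 2 then show ?thesis using mixed xy by blast
    next
      case 3 then show ?thesis using mixed[of y x] xy by (simp add: dist_commute norm_minus_commute)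
    next
      case 4 then show ?thesis using L' by (simp add: g_def)
    qed
  qed
  have "S \<noteq> {}"
  proof -
    obtain x :: 'a where "norm x = \<bar>R\<bar> + 2" using vector_choose_size[of "\<bar>R\<bar> + 2"] by auto
    then have "norm x > R + 1" by linarith
    then show ?thesis by (auto simp: S_def)
  qed
  then have "\<exists>F. (\<forall>x\<in>S. F x = g x \<bullet> b) \<and> (\<forall>x y. \<bar>F x - F y\<bar> \<le> L' * dist x y)" if "b \<in> Basis" for b
    using McShane_extension[of S L' "\<lambda>x. g x \<bullet> b"] L'(1) gl order_trans[OF Basis_le_norm[OF that] gl]
    by (metis inner_diff_left)
  then obtain \<Phi> where \<Phi>: "\<And>b x. b \<in> Basis \<Longrightarrow> x \<in> S \<Longrightarrow> \<Phi> b x = g x \<bullet> b"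
    "\<And>b x y. b \<in> Basis \<Longrightarrow> \<bar>\<Phi> b x - \<Phi> b y\<bar> \<le> L' * dist x y" by metis
  define F where "F x = (\<Sum>b\<in>Basis. \<Phi> b x *\<^sub>R b)" for x
  have FS: "F x = g x" if "x \<in> S" for x
    using \<Phi>(1)[OF _ that] by (simp add: F_def euclidean_representation)
  show ?thesis
  proof (rule that[of F "real DIM('b) * L'" "R + 1"])
    show "F x = f x" if "x \<in> K" for x using FS[of x] that by (simp add: S_def g_def)
    show "F x = 0" if "norm x > R + 1" for x using FS[of x] that R[of x] by (force simp: S_def g_def)
    show "0 \<le> real DIM('b) * L'" using L' by simp
    fix x y
    have "norm (F x - F y) = norm (\<Sum>b\<in>Basis. (\<Phi> b x - \<Phi> b y) *\<^sub>R b)"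
      by (simp add: F_def sum_subtractf scaleR_diff_left)
    also have "\<dots> \<le> (\<Sum>b\<in>(Basis::'b set). L' * dist x y)"
      using \<Phi>(2) by (intro sum_norm_le) simp
    finally show "norm (F x - F y) \<le> real DIM('b) * L' * dist x y" by simp
  qed
qed

locale compactly_supported_lipschitz =
  fixes F :: "'a::euclidean_space \<Rightarrow> 'b::euclidean_space" and M R :: real
  assumes M: "0 \<le> M" and lip: "\<And>x y. norm (F x - F y) \<le> M * dist x y"
    and supp: "\<And>x. norm x > R \<Longrightarrow> F x = 0"
begin

definition E :: "'a \<Rightarrow> 'a \<Rightarrow> 'b" where "E u x = F (x + u)"

definition corr :: "'a \<Rightarrow> real" where "corr u = (\<integral>x. E u x \<bullet> E 0 x \<partial>lborel)"

lemma continuous_E: "continuous_on UNIV (E u)"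
proof -
  have "continuous_on UNIV F"
    by (rule lipschitz_on_continuous_on[of M]) (use M lip in \<open>auto simp: lipschitz_on_def dist_norm\<close>)
  then show ?thesis unfolding E_def by (rule continuous_on_compose2) (auto intro!: continuous_intros)
qed

lemma E_eq_0: "norm x > R + norm u \<Longrightarrow> E u x = 0"
  unfolding E_def using norm_triangle_ineq2[of x "- u"] by (intro supp) simp

lemma integrable_EE [simp]: "integrable lborel (\<lambda>x. E u x \<bullet> E v x)"
proof -
  let ?h = "\<lambda>x. E u x \<bullet> E v x" and ?A = "cball (0::'a) (R + norm u)"
  have c: "continuous_on UNIV ?h" by (intro continuous_intros continuous_E)
  have "continuous_on ?A ?h" by (rule continuous_on_subset[OF c]) (rule subset_UNIV)
  then have "bounded (?h ` ?A)" by (intro compact_imp_bounded compact_continuous_image compact_cball)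
  then obtain B where "\<forall>y\<in>?h ` ?A. norm y \<le> B" unfolding bounded_iff by (rule exE)
  then have B: "norm (?h x) \<le> B" if "x \<in> ?A" for x using that by blast
  show ?thesis
  proof (rule integrableI_bounded_set)
    show "?A \<in> sets lborel" by simp
    show "?h \<in> borel_measurable lborel" using borel_measurable_continuous_onI[OF c] by simp
    show "emeasure lborel ?A < \<infinity>" by (rule emeasure_lborel_cball_finite)
    show "AE x in lborel. x \<in> ?A \<longrightarrow> norm (?h x) \<le> B" using B by simp
    show "AE x in lborel. x \<notin> ?A \<longrightarrow> ?h x = 0" using E_eq_0[of u] by (simp add: not_le)
  qed
qed

lemma integral_EE: "(\<integral>x. E u x \<bullet> E v x \<partial>lborel) = corr (u - v)"
proof -
  let ?h = "\<lambda>x. E (u - v) x \<bullet> E 0 x"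
  have m: "?h \<in> borel_measurable borel"
    by (intro borel_measurable_continuous_onI continuous_intros continuous_E)
  have "corr (u - v) = (\<integral>x. ?h x \<partial>distr lborel borel ((+) v))" by (simp add: corr_def lborel_distr_plus)
  also have "\<dots> = (\<integral>x. ?h (v + x) \<partial>lborel)" using m by (intro integral_distr) auto
  also have "\<dots> = (\<integral>x. E u x \<bullet> E v x \<partial>lborel)" by (simp add: E_def algebra_simps)
  finally show ?thesis by simp
qed

lemma corr_minus: "corr (- u) = corr u"
  using integral_EE[of 0 u] integral_EE[of u 0] by (simp add: inner_commute)

definition J :: "'a \<Rightarrow> real" where "J u = corr 0 - corr u"

lemma J_minus: "J (- u) = J u" by (simp add: J_def corr_minus)

lemma J_eq: "2 * J u = (\<integral>x. (norm (E u x - E 0 x))\<^sup>2 \<partial>lborel)"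
  by (simp add: power2_norm_eq_inner inner_diff_left inner_diff_right integral_EE J_def corr_minus)

lemma corr_sum_diff:
  "corr (v - u) = corr (u - v)" "corr (- u - v) = corr (u + v)" "corr (- u + v) = corr (u - v)"
  "corr (- u - u) = corr (2 *\<^sub>R u)" "corr (u + u) = corr (2 *\<^sub>R u)"
proof -
  have "v - u = - (u - v)" "- u - v = - (u + v)" "- u + v = - (u - v)" "- u - u = - (2 *\<^sub>R u)" "u + u = 2 *\<^sub>R u"
    by (simp_all add: scaleR_2)
  then show "corr (v - u) = corr (u - v)" "corr (- u - v) = corr (u + v)" "corr (- u + v) = corr (u - v)"
    "corr (- u - u) = corr (2 *\<^sub>R u)" "corr (u + u) = corr (2 *\<^sub>R u)"
    by (metis corr_minus)+
qed

lemma mixed_difference_eq: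
  "(\<integral>x. (norm (E (u + v) x - E u x - E v x + E 0 x))\<^sup>2 \<partial>lborel) = 4 * J u + 4 * J v - 2 * J (u + v) - 2 * J (u - v)"
proof -
  have "corr (v - u) = corr (u - v)" "corr (- u - v) = corr (u + v)" "corr (- v - u) = corr (u + v)"
    using corr_sum_diff(1)[of v u] corr_sum_diff(2)[of u v] corr_sum_diff(2)[of v u] by (simp_all add: add.commute)
  then show ?thesis
    by (simp add: power2_norm_eq_inner inner_diff_left inner_diff_right inner_add_left inner_add_right
        integral_EE J_def corr_minus algebra_simps)
qed

lemma pure_difference_eq:
  "(\<integral>x. (norm (2 *\<^sub>R E 0 x - E u x - E (- u) x))\<^sup>2 \<partial>lborel) = 8 * J u - 2 * J (2 *\<^sub>R u)"
proof -
  have "corr (- u - u) = corr (2 *\<^sub>R u)" "corr (u + u) = corr (2 *\<^sub>R u)"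
    by (rule corr_sum_diff)+
  then show ?thesis
    by (simp add: power2_norm_eq_inner inner_diff_left inner_diff_right integral_EE J_def corr_minus)
qed

lemma four_point_eq:
  "(\<integral>x. (norm (E v x + E (- v) x - E u x - E (- u) x))\<^sup>2 \<partial>lborel) = 4 * J (u + v) + 4 * J (u - v) - 2 * J (2 *\<^sub>R u) - 2 * J (2 *\<^sub>R v)"
proof -
  have "corr (- u - u) = corr (2 *\<^sub>R u)" "corr (u + u) = corr (2 *\<^sub>R u)" "corr (- v - v) = corr (2 *\<^sub>R v)" "corr (v + v) = corr (2 *\<^sub>R v)"
    "corr (v - u) = corr (u - v)" "corr (- u - v) = corr (u + v)" "corr (- v - u) = corr (u + v)" "corr (v + u) = corr (u + v)"
    "corr (- u + v) = corr (u - v)" "corr (- v + u) = corr (u - v)"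
    using corr_sum_diff(1-3)[of v u] corr_sum_diff(1-3)[of u v] corr_sum_diff(4,5)[of u] corr_sum_diff(4,5)[of v]
    by (simp_all add: add.commute)
  then show ?thesis
    by (simp add: power2_norm_eq_inner inner_diff_left inner_diff_right inner_add_left inner_add_right
        integral_EE J_def corr_minus)
qed

lemma J_nonneg: "0 \<le> J u"
proof -
  have "0 \<le> 2 * J u" unfolding J_eq by simp
  then show ?thesis by simp
qed

lemma pure_nonneg: "0 \<le> 4 * J u - J (2 *\<^sub>R u)"
proof -
  have "0 \<le> 8 * J u - 2 * J (2 *\<^sub>R u)" unfolding pure_difference_eq[symmetric] by simp
  then show ?thesis by simp
qed

lemma mixed_le_pure:
  "(\<integral>x. (norm (E (u + v) x - E u x - E v x + E 0 x))\<^sup>2 \<partial>lborel)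
     \<le> (4 * J u - J (2 *\<^sub>R u)) + (4 * J v - J (2 *\<^sub>R v))"
proof -
  have "0 \<le> 4 * J (u + v) + 4 * J (u - v) - 2 * J (2 *\<^sub>R u) - 2 * J (2 *\<^sub>R v)"
    unfolding four_point_eq[symmetric] by simp
  then show ?thesis unfolding mixed_difference_eq by simp
qed

lemma J_quadratic_bound: "\<exists>C. \<forall>u. norm u \<le> B \<longrightarrow> J u \<le> C * (norm u)\<^sup>2"
proof -
  let ?A = "cball (0::'a) (R + B)"
  have "J u \<le> (M\<^sup>2 * measure lborel ?A) * (norm u)\<^sup>2" if u: "norm u \<le> B" for u
  proof -
    have "2 * J u = (\<integral>x. (norm (E u x - E 0 x))\<^sup>2 \<partial>lborel)" by (rule J_eq)
    also have "\<dots> \<le> (\<integral>x. (M * norm u)\<^sup>2 * indicator ?A x \<partial>lborel)"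
    proof (rule integral_mono)
      show "integrable lborel (\<lambda>x. (norm (E u x - E 0 x))\<^sup>2)"
        by (simp add: power2_norm_eq_inner inner_diff_left inner_diff_right)
      show "integrable lborel (\<lambda>x. (M * norm u)\<^sup>2 * indicator ?A x)"
        using emeasure_lborel_cball_finite[of 0 "R + B"] by (intro integrable_mult_right integrable_real_indicator) auto
      fix x
      show "(norm (E u x - E 0 x))\<^sup>2 \<le> (M * norm u)\<^sup>2 * indicator ?A x"
      proof (cases "x \<in> ?A")
        case True
        have "norm (E u x - E 0 x) \<le> M * norm u" using lip[of "x + u" x] by (simp add: E_def dist_norm)
        then show ?thesis using True by (simp add: power_mono)
      next
        case False
        have "E u x = 0" "E 0 x = 0" using False u norm_ge_zero[of u] by (auto intro!: E_eq_0 simp del: norm_ge_zero)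
        then show ?thesis by simp
      qed
    qed
    also have "\<dots> = (M\<^sup>2 * measure lborel ?A) * (norm u)\<^sup>2"
      using emeasure_lborel_cball_finite[of 0 "R + B"] by (simp add: power_mult_distrib)
    finally show ?thesis using J_nonneg[of u] by linarith
  qed
  then show ?thesis by blast
qed

lemma pure_difference_tendsto_0:
  "(\<lambda>k. (4 * J ((1/2)^k *\<^sub>R u) - J (2 *\<^sub>R (1/2)^k *\<^sub>R u)) / ((1/2)^k)\<^sup>2) \<longlonglongrightarrow> 0"
proof -
  define a where "a k = J ((1/2)^k *\<^sub>R u) / ((1/2)^k)\<^sup>2" for k :: nat
  have step: "(4 * J ((1/2)^(Suc k) *\<^sub>R u) - J (2 *\<^sub>R (1/2)^(Suc k) *\<^sub>R u)) / ((1/2)^(Suc k))\<^sup>2 = 4 * (a (Suc k) - a k)" for k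
    by (simp add: a_def field_simps power2_eq_square)
  have "incseq a"
  proof (rule incseq_SucI)
    fix k
    have "0 \<le> 4 * (a (Suc k) - a k)" unfolding step[symmetric] by (intro divide_nonneg_nonneg pure_nonneg zero_le_power2)
    then show "a k \<le> a (Suc k)" by simp
  qed
  obtain C where C: "\<And>w. norm w \<le> norm u \<Longrightarrow> J w \<le> C * (norm w)\<^sup>2" using J_quadratic_bound by blast
  have "a k \<le> C * (norm u)\<^sup>2" for k
  proof -
    have "norm ((1/2)^k *\<^sub>R u) \<le> norm u" by (simp add: mult_left_le_one_le power_le_one)
    then have "J ((1/2)^k *\<^sub>R u) \<le> C * (norm ((1/2)^k *\<^sub>R u))\<^sup>2" by (rule C)
    also have "\<dots> = (C * (norm u)\<^sup>2) * ((1/2)^k)\<^sup>2" by (simp add: power_mult_distrib)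
    finally show ?thesis unfolding a_def by (subst pos_divide_le_eq) auto
  qed
  then obtain l where "a \<longlonglongrightarrow> l" using incseq_convergent[OF \<open>incseq a\<close>] by blast
  then have "(\<lambda>k. 4 * (a (Suc k) - a k)) \<longlonglongrightarrow> 4 * (l - l)" by (intro tendsto_intros LIMSEQ_Suc)
  then have "(\<lambda>k. (4 * J ((1/2)^(Suc k) *\<^sub>R u) - J (2 *\<^sub>R (1/2)^(Suc k) *\<^sub>R u)) / ((1/2)^(Suc k))\<^sup>2) \<longlonglongrightarrow> 0"
    unfolding step by simp
  then show ?thesis by (rule LIMSEQ_imp_Suc)
qed

lemma mixed_difference_tendsto_0:
  "(\<lambda>k. (\<integral>x. (norm (E ((1/2)^k *\<^sub>R (u + v)) x - E ((1/2)^k *\<^sub>R u) x - E ((1/2)^k *\<^sub>R v) x + E 0 x))\<^sup>2 \<partial>lborel) / ((1/2)^k)\<^sup>2) \<longlonglongrightarrow> 0"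
proof (rule tendsto_sandwich[OF _ _ tendsto_const])
  let ?p = "\<lambda>u k. (4 * J ((1/2)^k *\<^sub>R u) - J (2 *\<^sub>R (1/2)^k *\<^sub>R u)) / ((1/2)^k)\<^sup>2"
  show "(\<lambda>k. ?p u k + ?p v k) \<longlonglongrightarrow> 0"
    using tendsto_add[OF pure_difference_tendsto_0[of u] pure_difference_tendsto_0[of v]] by simp
  show "eventually (\<lambda>k. (\<integral>x. (norm (E ((1/2)^k *\<^sub>R (u + v)) x - E ((1/2)^k *\<^sub>R u) x - E ((1/2)^k *\<^sub>R v) x + E 0 x))\<^sup>2 \<partial>lborel) / ((1/2)^k)\<^sup>2 \<le> ?p u k + ?p v k) sequentially"
    unfolding add_divide_distrib[symmetric] scaleR_add_right
    by (intro always_eventually allI divide_right_mono mixed_le_pure) auto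
qed (auto intro!: always_eventually divide_nonneg_nonneg)

definition affine_error :: "'a \<Rightarrow> real \<Rightarrow> 'a \<Rightarrow> 'b" where
  "affine_error w r x = E (r *\<^sub>R w) x - E 0 x - (\<Sum>b\<in>Basis. (w \<bullet> b) *\<^sub>R (E (r *\<^sub>R b) x - E 0 x))"

lemma integrable_affine_error: "integrable lborel (\<lambda>x. (norm (affine_error w r x))\<^sup>2)"
  unfolding affine_error_def
  by (simp add: power2_norm_eq_inner inner_diff_left inner_diff_right inner_sum_left inner_sum_right)

definition affine_error_negligible :: "'a \<Rightarrow> bool" where
  "affine_error_negligible w \<longleftrightarrow> (\<lambda>k. (\<integral>x. (norm (affine_error w ((1/2)^k) x))\<^sup>2 \<partial>lborel) / ((1/2)^k)\<^sup>2) \<longlonglongrightarrow> 0"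

lemma affine_error_add_Basis:
  assumes "e \<in> Basis"
  shows "affine_error (w + e) r x = affine_error w r x + (E (r *\<^sub>R (w + e)) x - E (r *\<^sub>R w) x - E (r *\<^sub>R e) x + E 0 x)"
proof -
  have "(\<Sum>b\<in>Basis. ((w + e) \<bullet> b) *\<^sub>R (E (r *\<^sub>R b) x - E 0 x)) =
     (\<Sum>b\<in>Basis. (w \<bullet> b) *\<^sub>R (E (r *\<^sub>R b) x - E 0 x)) + (\<Sum>b\<in>Basis. (if b = e then 1 else 0) *\<^sub>R (E (r *\<^sub>R b) x - E 0 x))"
    using assms by (simp only: inner_add_left scaleR_add_left sum.distrib) (auto intro!: sum.cong simp: inner_Basis)
  also have "(\<Sum>b\<in>Basis. (if b = e then 1 else 0) *\<^sub>R (E (r *\<^sub>R b) x - E 0 x)) = E (r *\<^sub>R e) x - E 0 x"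
    using assms by (simp add: if_distrib[of "\<lambda>c. c *\<^sub>R _"] cong: if_cong)
  finally show ?thesis by (simp add: affine_error_def)
qed

lemma norm_square_add_le: "(norm (a + b))\<^sup>2 \<le> 2 * (norm a)\<^sup>2 + 2 * (norm (b::'b))\<^sup>2"
proof -
  have "(norm (a + b))\<^sup>2 \<le> (norm a + norm b)\<^sup>2" by (intro power_mono norm_triangle_ineq) simp
  also have "\<dots> \<le> 2 * (norm a)\<^sup>2 + 2 * (norm b)\<^sup>2"
    using sum_squares_bound[of "norm a" "norm b"] by (simp add: power2_sum)
  finally show ?thesis .
qed

lemma integral_norm_square_le:
  assumes "\<And>x. h x = p x + q x" "integrable lborel (\<lambda>x. (norm (p x))\<^sup>2)" "integrable lborel (\<lambda>x. (norm (q x))\<^sup>2)"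
    "integrable lborel (\<lambda>x. (norm (h x :: 'b))\<^sup>2)"
  shows "(\<integral>x. (norm (h x))\<^sup>2 \<partial>lborel) \<le> 2 * (\<integral>x. (norm (p x))\<^sup>2 \<partial>lborel) + 2 * (\<integral>x. (norm (q (x::'a)))\<^sup>2 \<partial>lborel)"
proof -
  have "(\<integral>x. (norm (h x))\<^sup>2 \<partial>lborel) \<le> (\<integral>x. 2 * (norm (p x))\<^sup>2 + 2 * (norm (q x))\<^sup>2 \<partial>lborel)"
    using assms by (intro integral_mono) (auto simp: norm_square_add_le)
  then show ?thesis using assms by simp
qed

lemma affine_error_negligible_step:
  assumes e: "e \<in> Basis"
  shows "affine_error_negligible (w + e) \<longleftrightarrow> affine_error_negligible w"
proof -
  define m where "m k x = E ((1/2)^k *\<^sub>R (w + e)) x - E ((1/2)^k *\<^sub>R w) x - E ((1/2)^k *\<^sub>R e) x + E 0 x" for k :: nat and x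
  have im: "integrable lborel (\<lambda>x. (norm (m k x))\<^sup>2)" for k unfolding m_def
    by (simp add: power2_norm_eq_inner inner_diff_left inner_diff_right inner_add_left inner_add_right)
  have im': "integrable lborel (\<lambda>x. (norm (- m k x))\<^sup>2)" for k using im by simp
  let ?A = "\<lambda>w k. (\<integral>x. (norm (affine_error w ((1/2)^k) x))\<^sup>2 \<partial>lborel) / ((1/2)^k)\<^sup>2"
  let ?B = "\<lambda>k. (\<integral>x. (norm (m k x))\<^sup>2 \<partial>lborel) / ((1/2)^k)\<^sup>2"
  have B: "?B \<longlonglongrightarrow> 0" unfolding m_def by (rule mixed_difference_tendsto_0)
  have eq: "affine_error (w + e) ((1/2)^k) x = affine_error w ((1/2)^k) x + m k x" for k x
    unfolding m_def by (rule affine_error_add_Basis[OF e])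
  have up: "?A (w + e) k \<le> 2 * ?A w k + 2 * ?B k" for k
    using divide_right_mono[OF integral_norm_square_le[OF eq integrable_affine_error im integrable_affine_error], of "((1/2)^k)\<^sup>2" k]
    by (simp add: add_divide_distrib)
  have eq': "affine_error w ((1/2)^k) x = affine_error (w + e) ((1/2)^k) x + (- m k x)" for k x using eq by simp
  have down: "?A w k \<le> 2 * ?A (w + e) k + 2 * ?B k" for k
    using divide_right_mono[OF integral_norm_square_le[OF eq' integrable_affine_error im' integrable_affine_error], of "((1/2)^k)\<^sup>2" k]
    by (simp add: add_divide_distrib)
  have trans: "f \<longlonglongrightarrow> 0" if "g \<longlonglongrightarrow> 0" "\<And>k. f k \<le> 2 * g k + 2 * ?B k" "\<And>k. 0 \<le> f k" for f g :: "nat \<Rightarrow> real"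
  proof (rule tendsto_sandwich[OF _ _ tendsto_const])
    show "(\<lambda>k. 2 * g k + 2 * ?B k) \<longlonglongrightarrow> 0"
      using tendsto_add[OF tendsto_mult_left[OF that(1), of 2] tendsto_mult_left[OF B, of 2]] by simp
  qed (use that in \<open>auto intro: always_eventually\<close>)
  have nn: "0 \<le> ?A w k" for w k by simp
  show ?thesis unfolding affine_error_negligible_def
    using trans[OF _ up nn] trans[OF _ down nn] by blast
qed

lemma affine_error_negligible_add_multiple:
  assumes e: "e \<in> Basis" and w: "affine_error_negligible w"
  shows "affine_error_negligible (w + of_int n *\<^sub>R e)"
proof (induction n rule: int_induct[of _ 0])
  case base then show ?case using w by simp
next
  case (step1 i)
  then show ?case using affine_error_negligible_step[OF e, of "w + of_int i *\<^sub>R e"] by (simp add: algebra_simps)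
next
  case (step2 i)
  then show ?case using affine_error_negligible_step[OF e, of "w + of_int (i - 1) *\<^sub>R e"] by (simp add: algebra_simps)
qed

lemma affine_error_negligible_lattice: "affine_error_negligible (\<Sum>b\<in>Basis. of_int (c b) *\<^sub>R b)"
proof -
  have "affine_error_negligible (\<Sum>b\<in>S. of_int (c b) *\<^sub>R b)" if "finite S" "S \<subseteq> Basis" for S
    using that
  proof (induction S rule: finite_induct)
    case empty
    have "affine_error 0 r x = 0" for r x by (simp add: affine_error_def)
    then show ?case by (simp add: affine_error_negligible_def)
  next
    case (insert b S)
    then show ?case using affine_error_negligible_add_multiple[of b "\<Sum>b\<in>S. of_int (c b) *\<^sub>R b" "c b"]
      by (simp add: add.commute)
  qed
  then show ?thesis by simp
qed

end

definition lattice_box :: "nat \<Rightarrow> 'a::euclidean_space set" where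
  "lattice_box M = (\<lambda>c. \<Sum>b\<in>Basis. of_int (c b) *\<^sub>R b) ` (Basis \<rightarrow>\<^sub>E {- int M..int M})"

lemma finite_lattice_box: "finite (lattice_box M)"
  unfolding lattice_box_def by (intro finite_imageI finite_PiE) auto

lemma lattice_boxI:
  assumes "\<And>b. b \<in> Basis \<Longrightarrow> \<bar>c b\<bar> \<le> int M"
  shows "(\<Sum>b\<in>Basis. of_int (c b) *\<^sub>R b) \<in> lattice_box M"
  unfolding lattice_box_def
proof (rule image_eqI)
  show "restrict c Basis \<in> Basis \<rightarrow>\<^sub>E {- int M..int M}" using assms by (auto simp: abs_le_iff minus_le_iff)
qed simp

lemma lattice_box_pair:
  assumes uv: "u \<in> Basis" "v \<in> Basis" "u \<noteq> v" and st: "s \<le> M" "t \<le> M"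
  shows "real s *\<^sub>R u + real t *\<^sub>R v \<in> lattice_box M"
proof -
  let ?c = "\<lambda>b. (if b = u then int s else 0) + (if b = v then int t else 0)"
  have "(\<Sum>b\<in>Basis. of_int (?c b) *\<^sub>R b) = (\<Sum>b\<in>Basis. (if b = u then real s *\<^sub>R u else 0) + (if b = v then real t *\<^sub>R v else 0))"
    by (intro sum.cong) (auto simp: algebra_simps)
  also have "\<dots> = real s *\<^sub>R u + real t *\<^sub>R v" using uv by (simp add: sum.distrib)
  finally have "(\<Sum>b\<in>Basis. of_int (?c b) *\<^sub>R b) = real s *\<^sub>R u + real t *\<^sub>R v" .
  moreover have "(\<Sum>b\<in>Basis. of_int (?c b) *\<^sub>R b) \<in> lattice_box M" using uv st by (intro lattice_boxI) auto
  ultimately show ?thesis by simp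
qed

lemma lattice_box_0: "0 \<in> lattice_box M"
  using lattice_boxI[of "\<lambda>_. 0" M] by simp

lemma lattice_box_Basis:
  assumes "u \<in> Basis" "1 \<le> M" shows "u \<in> lattice_box M"
proof -
  have "(\<Sum>b\<in>Basis. of_int (if b = u then 1 else 0) *\<^sub>R b) \<in> lattice_box M" using assms by (intro lattice_boxI) auto
  moreover have "(\<Sum>b\<in>Basis. of_int (if b = u then 1 else 0) *\<^sub>R b) = u"
    using assms by (simp add: if_distrib[of "\<lambda>c. c *\<^sub>R _"] if_distrib[of of_int] cong: if_cong)
  ultimately show ?thesis by simp
qed

definition slope_map :: "('a::euclidean_space \<Rightarrow> 'b::euclidean_space) \<Rightarrow> real \<Rightarrow> 'a \<Rightarrow> 'a \<Rightarrow> 'b" where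
  "slope_map f r x w = (\<Sum>b\<in>Basis. (w \<bullet> b) *\<^sub>R ((f (x + r *\<^sub>R b) - f x) /\<^sub>R r))"

definition good_points ::
  "('b::euclidean_space \<Rightarrow> 'b set) \<Rightarrow> 'a::euclidean_space set \<Rightarrow> ('a \<Rightarrow> 'b) \<Rightarrow> nat \<Rightarrow> real \<Rightarrow> real \<Rightarrow> 'a set" where
  "good_points V K f M r \<epsilon> = {x\<in>K. (\<forall>w\<in>lattice_box M. x + r *\<^sub>R w \<in> K) \<and>
     (\<forall>w\<in>lattice_box M. norm (f (x + r *\<^sub>R w) - f x - r *\<^sub>R slope_map f r x w) \<le> \<epsilon> * r) \<and>
     (\<forall>w\<in>lattice_box M. \<forall>w'\<in>lattice_box M.
        real_cc_dist V (f (x + r *\<^sub>R w)) (f (x + r *\<^sub>R w')) \<le> norm (f (x + r *\<^sub>R w') - f (x + r *\<^sub>R w)) + \<epsilon> * r)}"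

lemma emeasure_lborel_shift:
  fixes a :: "'a::euclidean_space"
  assumes "S \<in> sets borel"
  shows "emeasure lborel {x. x + a \<in> S} = emeasure lborel S"
proof -
  have "emeasure lborel S = emeasure (distr lborel borel ((+) a)) S" by (simp add: lborel_distr_plus)
  also have "\<dots> = emeasure lborel ((+) a -` S \<inter> space lborel)" using assms by (intro emeasure_distr) auto
  also have "(+) a -` S \<inter> space lborel = {x. x + a \<in> S}" by (auto simp: add.commute)
  finally show ?thesis by simp
qed

lemma compact_open_neighbourhood_small:
  fixes K :: "'a::euclidean_space set"
  assumes "compact K" "0 < e"
  obtains G d where "open G" "emeasure lborel (G - K) < ennreal e" "0 < d" "(\<Union>x\<in>K. ball x d) \<subseteq> G"
proof -
  have K: "K \<in> sets borel" "K \<in> sets lebesgue" using assms(1) lmeasurable_compact by (auto intro: borel_compact fmeasurableD)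
  obtain G where G: "open G" "K \<subseteq> G" "emeasure lebesgue (G - K) < ennreal e"
    using sets_lebesgue_outer_open[OF K(2) assms(2)] by metis
  have "G - K \<in> sets borel" using K G by auto
  then have "emeasure lborel (G - K) < ennreal e" using G(3) by (simp add: emeasure_completion)
  moreover obtain d where "d > 0" "(\<Union>x\<in>K. ball x d) \<subseteq> G"
    using compact_subset_open_imp_ball_epsilon_subset[OF assms(1) G(1,2)] .
  ultimately show ?thesis using that G by blast
qed

lemma tendsto_0_ennrealI:
  fixes g :: "'c \<Rightarrow> ennreal"
  assumes "\<And>e::real. e > 0 \<Longrightarrow> eventually (\<lambda>k. g k \<le> ennreal e) F"
  shows "(g \<longlongrightarrow> 0) F"
proof (rule order_tendstoI)
  fix a :: ennreal assume "0 < a"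
  then obtain b where b: "0 < b" "b < a" using dense by blast
  then obtain e where e: "b = ennreal e" "0 < e" by (cases b) auto
  show "eventually (\<lambda>k. g k < a) F"
    using assms[OF e(2)] by (rule eventually_mono) (use b e in auto)
qed simp

lemma emeasure_leaving_tendsto_0:
  fixes K :: "'a::euclidean_space set"
  assumes K: "compact K" and r: "r \<longlonglongrightarrow> 0"
  shows "(\<lambda>k. emeasure lborel {x\<in>K. x + r k *\<^sub>R w \<notin> K}) \<longlonglongrightarrow> 0"
proof (rule tendsto_0_ennrealI)
  fix e :: real assume "e > 0"
  then obtain G d where G: "open G" "emeasure lborel (G - K) < ennreal e" "0 < d" "(\<Union>x\<in>K. ball x d) \<subseteq> G"
    using compact_open_neighbourhood_small[OF K] by metis
  have GK: "G - K \<in> sets borel" using G(1) K by (auto intro: borel_compact)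
  have "(\<lambda>k. norm (r k *\<^sub>R w)) \<longlonglongrightarrow> norm (0 *\<^sub>R w)" using r by (intro tendsto_intros)
  then have "eventually (\<lambda>k. norm (r k *\<^sub>R w) < d) sequentially" using G(3) by (intro order_tendstoD) auto
  then show "eventually (\<lambda>k. emeasure lborel {x\<in>K. x + r k *\<^sub>R w \<notin> K} \<le> ennreal e) sequentially"
  proof (rule eventually_mono)
    fix k assume k: "norm (r k *\<^sub>R w) < d"
    have "{x\<in>K. x + r k *\<^sub>R w \<notin> K} \<subseteq> {x. x + r k *\<^sub>R w \<in> G - K}"
    proof
      fix x assume x: "x \<in> {x\<in>K. x + r k *\<^sub>R w \<notin> K}"
      then have "x + r k *\<^sub>R w \<in> ball x d" using k by (simp add: dist_norm)
      then show "x \<in> {x. x + r k *\<^sub>R w \<in> G - K}" using x G(4) by blast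
    qed
    moreover have "{x. x + r k *\<^sub>R w \<in> G - K} \<in> sets lborel"
    proof -
      have "(\<lambda>x. x + r k *\<^sub>R w) \<in> measurable borel borel" by measurable
      then show ?thesis using measurable_sets[OF _ GK, of "\<lambda>x. x + r k *\<^sub>R w" borel] by (simp add: vimage_def)
    qed
    ultimately have "emeasure lborel {x\<in>K. x + r k *\<^sub>R w \<notin> K} \<le> emeasure lborel {x. x + r k *\<^sub>R w \<in> G - K}"
      by (rule emeasure_mono)
    also have "\<dots> = emeasure lborel (G - K)" by (rule emeasure_lborel_shift[OF GK])
    finally show "emeasure lborel {x\<in>K. x + r k *\<^sub>R w \<notin> K} \<le> ennreal e" using G(2) by simp
  qed
qed

lemma (in compactly_supported_lipschitz) affine_error_large_tendsto_0:
  assumes w: "affine_error_negligible w" and \<epsilon>: "0 < \<epsilon>"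
  shows "(\<lambda>k. emeasure lborel {x. (\<epsilon> * (1/2)^k)\<^sup>2 \<le> (norm (affine_error w ((1/2)^k) x))\<^sup>2}) \<longlonglongrightarrow> 0"
proof (rule tendsto_sandwich[OF _ _ tendsto_const])
  let ?I = "\<lambda>k. (\<integral>x. (norm (affine_error w ((1/2)^k) x))\<^sup>2 \<partial>lborel)"
  have "(\<lambda>k. 1 / \<epsilon>\<^sup>2 * (?I k / ((1/2)^k)\<^sup>2)) \<longlonglongrightarrow> 1 / \<epsilon>\<^sup>2 * 0"
    using w unfolding affine_error_negligible_def by (rule tendsto_mult_left)
  then show "(\<lambda>k. ennreal (1 / \<epsilon>\<^sup>2 * (?I k / ((1/2)^k)\<^sup>2))) \<longlonglongrightarrow> 0" using tendsto_ennrealI by force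
  show "eventually (\<lambda>k. emeasure lborel {x. (\<epsilon> * (1/2)^k)\<^sup>2 \<le> (norm (affine_error w ((1/2)^k) x))\<^sup>2} \<le> ennreal (1 / \<epsilon>\<^sup>2 * (?I k / ((1/2)^k)\<^sup>2))) sequentially"
  proof (intro always_eventually allI)
    fix k :: nat
    have "emeasure lborel {x \<in> space lborel. (\<epsilon> * (1/2)^k)\<^sup>2 \<le> (norm (affine_error w ((1/2)^k) x))\<^sup>2} \<le> ennreal (1 / (\<epsilon> * (1/2)^k)\<^sup>2 * ?I k)"
      using \<epsilon> by (intro integral_Markov_inequality integrable_affine_error) auto
    then show "emeasure lborel {x. (\<epsilon> * (1/2)^k)\<^sup>2 \<le> (norm (affine_error w ((1/2)^k) x))\<^sup>2} \<le> ennreal (1 / \<epsilon>\<^sup>2 * (?I k / ((1/2)^k)\<^sup>2))"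
      by (simp add: power_mult_distrib)
  qed
qed (auto intro: always_eventually)

lemma (in compactly_supported_lipschitz) affine_error_large_measurable:
  "{x. c \<le> (norm (affine_error w r x))\<^sup>2} \<in> sets borel"
proof -
  have "continuous_on UNIV (\<lambda>x. (norm (affine_error w r x))\<^sup>2)"
    unfolding affine_error_def by (intro continuous_intros continuous_E)
  then have "closed {x. c \<le> (norm (affine_error w r x))\<^sup>2}" by (intro closed_Collect_le continuous_on_const)
  then show ?thesis by simp
qed

theorem (in first_order_distribution) good_points_exhaust:
  fixes K :: "'a::euclidean_space set" and f :: "'a \<Rightarrow> 'b"
  assumes f: "cc_lipschitz_on L V K f" and K: "compact K" and M: "1 \<le> M" and \<epsilon>: "0 < \<epsilon>"
  obtains B where "\<And>k. B k \<in> sets borel" "\<And>k. K - good_points V K f M ((1/2)^k) \<epsilon> \<subseteq> B k"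
    "(\<lambda>k. emeasure lborel (B k)) \<longlonglongrightarrow> 0"
proof -
  obtain F N R where F: "\<And>x. x \<in> K \<Longrightarrow> F x = f x" "0 \<le> N" "\<And>x y. norm (F x - F y) \<le> N * dist x y"
    "\<And>x. norm x > R \<Longrightarrow> F x = 0"
    using compactly_supported_lipschitz_extension[OF compact_imp_bounded[OF K] _ cc_lipschitz_on_norm[OF f]] f
    unfolding cc_lipschitz_on_def by metis
  interpret F: compactly_supported_lipschitz F N R using F by unfold_locales auto
  let ?lat = "lattice_box M :: 'a set"
  let ?r = "\<lambda>k::nat. (1/2::real)^k"
  have r0: "?r \<longlonglongrightarrow> 0" by (intro LIMSEQ_power_zero) simp
  define B1 where "B1 k w = {x\<in>K. x + ?r k *\<^sub>R w \<notin> K}" for k w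
  define B2 where "B2 k w = {x. (\<epsilon> * ?r k)\<^sup>2 \<le> (norm (F.affine_error w (?r k) x))\<^sup>2}" for k w
  define D where "D k v = direction_defect V K f v \<epsilon> (?r k)" for k v
  define B3 where "B3 k w w' = {x. x + ?r k *\<^sub>R w \<in> D k (w' - w)}" for k w w'
  define B where "B k = (\<Union>w\<in>?lat. B1 k w) \<union> (\<Union>w\<in>?lat. B2 k w) \<union> (\<Union>p\<in>?lat \<times> ?lat. B3 k (fst p) (snd p))" for k
  have shift_meas: "{x. x + a \<in> S} \<in> sets borel" if "S \<in> sets borel" for a :: 'a and S
  proof -
    have "(\<lambda>x. x + a) \<in> measurable borel borel" by measurable
    then show ?thesis using measurable_sets[OF _ that, of "\<lambda>x. x + a" borel] by (simp add: vimage_def)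
  qed
  have Kb: "K \<in> sets borel" using K by (rule borel_compact)
  have Db: "D k v \<in> sets borel" for k v unfolding D_def by (intro borel_compact compact_direction_defect[OF f K])
  have m1: "B1 k w \<in> sets borel" for k w
  proof -
    have "B1 k w = K - {x. x + ?r k *\<^sub>R w \<in> K}" by (auto simp: B1_def)
    then show ?thesis using Kb shift_meas[OF Kb] by simp
  qed
  have m2: "B2 k w \<in> sets borel" for k w unfolding B2_def by (rule F.affine_error_large_measurable)
  have m3: "B3 k w w' \<in> sets borel" for k w w' unfolding B3_def by (rule shift_meas[OF Db])
  have fin: "finite ?lat" by (rule finite_lattice_box)
  have t1: "(\<lambda>k. emeasure lborel (B1 k w)) \<longlonglongrightarrow> 0" for w
    unfolding B1_def by (rule emeasure_leaving_tendsto_0[OF K r0])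
  have t2: "(\<lambda>k. emeasure lborel (B2 k w)) \<longlonglongrightarrow> 0" if "w \<in> ?lat" for w
  proof -
    have "F.affine_error_negligible w" using that F.affine_error_negligible_lattice by (auto simp: lattice_box_def)
    then show ?thesis unfolding B2_def by (rule F.affine_error_large_tendsto_0[OF _ \<epsilon>])
  qed
  have t3: "(\<lambda>k. emeasure lborel (B3 k w w')) \<longlonglongrightarrow> 0" for w w'
    unfolding B3_def emeasure_lborel_shift[OF Db] unfolding D_def
    by (rule direction_defect_measure_tendsto_0[OF f K \<epsilon> _ r0]) simp
  show ?thesis
  proof (rule that[of B])
    show "B k \<in> sets borel" for k unfolding B_def using fin m1 m2 m3 by (intro sets.Un sets.finite_UN) auto
    show "(\<lambda>k. emeasure lborel (B k)) \<longlonglongrightarrow> 0"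
    proof (rule tendsto_sandwich[OF _ _ tendsto_const])
      let ?S = "\<lambda>k. (\<Sum>w\<in>?lat. emeasure lborel (B1 k w)) + (\<Sum>w\<in>?lat. emeasure lborel (B2 k w)) + (\<Sum>p\<in>?lat \<times> ?lat. emeasure lborel (B3 k (fst p) (snd p)))"
      have "?S \<longlonglongrightarrow> (\<Sum>w\<in>?lat. 0) + (\<Sum>w\<in>?lat. 0) + (\<Sum>p\<in>?lat \<times> ?lat. 0)"
        by (intro tendsto_add tendsto_sum t1 t2 t3)
      then show "?S \<longlonglongrightarrow> 0" by simp
      show "eventually (\<lambda>k. emeasure lborel (B k) \<le> ?S k) sequentially"
      proof (intro always_eventually allI)
        fix k
        have u1: "emeasure lborel (\<Union>w\<in>?lat. B1 k w) \<le> (\<Sum>w\<in>?lat. emeasure lborel (B1 k w))"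
          using fin m1 by (intro emeasure_subadditive_finite) auto
        have u2: "emeasure lborel (\<Union>w\<in>?lat. B2 k w) \<le> (\<Sum>w\<in>?lat. emeasure lborel (B2 k w))"
          using fin m2 by (intro emeasure_subadditive_finite) auto
        have u3: "emeasure lborel (\<Union>p\<in>?lat \<times> ?lat. B3 k (fst p) (snd p)) \<le> (\<Sum>p\<in>?lat \<times> ?lat. emeasure lborel (B3 k (fst p) (snd p)))"
          using fin m3 by (intro emeasure_subadditive_finite) auto
        have s: "(\<Union>w\<in>?lat. B1 k w) \<in> sets lborel" "(\<Union>w\<in>?lat. B2 k w) \<in> sets lborel" "(\<Union>p\<in>?lat \<times> ?lat. B3 k (fst p) (snd p)) \<in> sets lborel"
          using fin m1 m2 m3 by (auto intro!: sets.finite_UN)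
        have "emeasure lborel (B k) \<le> emeasure lborel ((\<Union>w\<in>?lat. B1 k w) \<union> (\<Union>w\<in>?lat. B2 k w)) + emeasure lborel (\<Union>p\<in>?lat \<times> ?lat. B3 k (fst p) (snd p))"
          unfolding B_def using s by (intro emeasure_subadditive sets.Un)
        also have "\<dots> \<le> (emeasure lborel (\<Union>w\<in>?lat. B1 k w) + emeasure lborel (\<Union>w\<in>?lat. B2 k w)) + emeasure lborel (\<Union>p\<in>?lat \<times> ?lat. B3 k (fst p) (snd p))"
          using s by (intro add_right_mono emeasure_subadditive)
        also have "\<dots> \<le> ?S k" by (intro add_mono u1 u2 u3)
        finally show "emeasure lborel (B k) \<le> ?S k" .
      qed
    qed (auto intro: always_eventually)
    show "K - good_points V K f M (?r k) \<epsilon> \<subseteq> B k" for k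
    proof
      fix x assume x: "x \<in> K - good_points V K f M (?r k) \<epsilon>"
      have rk: "0 < ?r k" by simp
      show "x \<in> B k"
      proof (rule ccontr)
        assume nB: "x \<notin> B k"
        have inK: "x + ?r k *\<^sub>R w \<in> K" if "w \<in> ?lat" for w
        proof -
          have "x \<notin> B1 k w" using nB that unfolding B_def by blast
          then show ?thesis using x by (simp add: B1_def)
        qed
        have "norm (f (x + ?r k *\<^sub>R w) - f x - ?r k *\<^sub>R slope_map f (?r k) x w) \<le> \<epsilon> * ?r k" if w: "w \<in> ?lat" for w
        proof -
          have "?r k *\<^sub>R slope_map f (?r k) x w = (\<Sum>b\<in>Basis. (w \<bullet> b) *\<^sub>R (f (x + ?r k *\<^sub>R b) - f x))"
            unfolding slope_map_def scaleR_sum_right using rk by (intro sum.cong) (auto simp: scaleR_scaleR)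
          also have "\<dots> = (\<Sum>b\<in>Basis. (w \<bullet> b) *\<^sub>R (F.E (?r k *\<^sub>R b) x - F.E 0 x))"
            using F(1) inK[OF lattice_box_Basis[OF _ M]] x by (intro sum.cong) (auto simp: F.E_def)
          finally have "f (x + ?r k *\<^sub>R w) - f x - ?r k *\<^sub>R slope_map f (?r k) x w = F.affine_error w (?r k) x"
            using F(1)[OF inK[OF w]] F(1)[of x] x by (simp add: F.affine_error_def F.E_def)
          moreover have "x \<notin> B2 k w" using nB w unfolding B_def by blast
          then have "(norm (F.affine_error w (?r k) x))\<^sup>2 < (\<epsilon> * ?r k)\<^sup>2" unfolding B2_def by simp
          then have "norm (F.affine_error w (?r k) x) \<le> \<epsilon> * ?r k"
            by (rule power2_le_imp_le[OF less_imp_le]) (use \<epsilon> in simp)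
          ultimately show ?thesis by simp
        qed
        moreover have "real_cc_dist V (f (x + ?r k *\<^sub>R w)) (f (x + ?r k *\<^sub>R w')) \<le> norm (f (x + ?r k *\<^sub>R w') - f (x + ?r k *\<^sub>R w)) + \<epsilon> * ?r k"
          if w: "w \<in> ?lat" "w' \<in> ?lat" for w w'
        proof -
          have "x \<notin> (\<Union>p\<in>?lat \<times> ?lat. B3 k (fst p) (snd p))" using nB unfolding B_def by blast
          then have "x \<notin> B3 k w w'" using w by force
          moreover have "x + ?r k *\<^sub>R w + ?r k *\<^sub>R (w' - w) = x + ?r k *\<^sub>R w'" by (simp add: algebra_simps)
          ultimately show ?thesis using inK[OF w(1)] inK[OF w(2)] by (auto simp: B3_def D_def direction_defect_def)
        qed
        ultimately have "x \<in> good_points V K f M (?r k) \<epsilon>" using x inK by (auto simp: good_points_def)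
        then show False using x by blast
      qed
    qed
  qed
qed

lemma slope_map_add: "slope_map f r x (v + w) = slope_map f r x v + slope_map f r x w"
  unfolding slope_map_def inner_add_left scaleR_add_left sum.distrib ..

lemma slope_map_scaleR: "slope_map f r x (c *\<^sub>R w) = c *\<^sub>R slope_map f r x w"
  by (simp add: slope_map_def scaleR_sum_right mult.assoc)

lemma slope_map_Basis:
  assumes "e \<in> Basis"
  shows "slope_map f r x e = (f (x + r *\<^sub>R e) - f x) /\<^sub>R r"
proof -
  have "slope_map f r x e = (\<Sum>b\<in>Basis. if b = e then (f (x + r *\<^sub>R b) - f x) /\<^sub>R r else 0)"
    unfolding slope_map_def using assms by (intro sum.cong) (auto simp: inner_Basis)
  then show ?thesis using assms by simp
qed

lemma good_points_step:
  fixes f :: "'a::euclidean_space \<Rightarrow> 'b::euclidean_space"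
  assumes f: "cc_lipschitz_on L V K f" and x: "x \<in> good_points V K f M r \<epsilon>" and r: "0 < r" and M: "1 \<le> M" and \<epsilon>: "0 \<le> \<epsilon>"
    and w: "w \<in> lattice_box M" "w + e \<in> lattice_box M" and e: "e \<in> Basis"
    and nw: "norm w \<le> 2 * real M" and nA: "norm (slope_map f r x w) \<le> 2 * real M * L"
    and B: "bounded_bilinear B" and BK: "\<And>a b. \<bar>B a b\<bar> \<le> \<kappa> * norm a * norm b" and \<kappa>: "0 \<le> \<kappa>" and \<eta>: "0 \<le> \<eta>"
    and ann: "\<And>q v. norm (q - f x) < \<delta> \<Longrightarrow> v \<in> V q \<Longrightarrow> \<bar>\<zeta> \<bullet> v - B (q - f x) v\<bar> \<le> \<eta> * norm (q - f x) * norm v"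
    and small: "(3 * L + 1) * real M * r < \<delta>"
  shows "\<bar>\<zeta> \<bullet> (f (x + r *\<^sub>R (w + e)) - f (x + r *\<^sub>R w)) - r\<^sup>2 * B (slope_map f r x w) (slope_map f r x e)\<bar>
    \<le> r\<^sup>2 * ((\<eta> * ((3 * L + 1) * real M) + \<kappa> * (L + 1)) * (L + 1) + 5 * \<kappa> * L * real M * \<epsilon>)"
proof -
  interpret B: bounded_bilinear B by fact
  have L: "0 \<le> L" using f by (simp add: cc_lipschitz_on_def)
  let ?q = "\<lambda>w. f (x + r *\<^sub>R w)" and ?A = "slope_map f r x"
  have xK: "x \<in> K" and inK: "\<And>w. w \<in> lattice_box M \<Longrightarrow> x + r *\<^sub>R w \<in> K" using x by (auto simp: good_points_def)
  have aff: "norm (?q w - f x - r *\<^sub>R ?A w) \<le> \<epsilon> * r" if "w \<in> lattice_box M" for w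
    using x that by (auto simp: good_points_def)
  have step: "norm (?q (w + e) - ?q w) \<le> L * r"
    using cc_lipschitz_on_norm[OF f inK[OF w(2)] inK[OF w(1)]] r e by (simp add: dist_norm algebra_simps)
  have rad: "norm (?q w - f x) \<le> 2 * L * real M * r"
  proof -
    have "norm (?q w - f x) \<le> L * (r * norm w)"
      using cc_lipschitz_on_norm[OF f inK[OF w(1)] xK] r by (simp add: dist_norm)
    also have "\<dots> \<le> L * (r * (2 * real M))" using L r nw by (intro mult_left_mono) auto
    finally show ?thesis by (simp add: mult_ac)
  qed
  have "chord_controlled V ((L + 1) * r) (?q w) (?q (w + e))"
  proof (rule cc_dist_chord_controlled)
    have "cc_dist V (?q w) (?q (w + e)) \<le> ennreal (L * dist (x + r *\<^sub>R w) (x + r *\<^sub>R (w + e)))"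
      using f inK[OF w(1)] inK[OF w(2)] unfolding cc_lipschitz_on_def by blast
    also have "dist (x + r *\<^sub>R w) (x + r *\<^sub>R (w + e)) = r" using r e by (simp add: dist_norm algebra_simps)
    also have "ennreal (L * r) < ennreal ((L + 1) * r)" using r L by (simp add: ennreal_less_iff)
    finally show "cc_dist V (?q w) (?q (w + e)) < ennreal ((L + 1) * r)" .
  qed
  then have c1: "\<bar>\<zeta> \<bullet> (?q (w + e) - ?q w) - B (?q w - f x) (?q (w + e) - ?q w)\<bar>
      \<le> (\<eta> * ((3 * L + 1) * real M * r) + \<kappa> * ((L + 1) * r)) * ((L + 1) * r)"
  proof (rule chord_controlledD[OF _ B BK \<kappa> \<eta> ann])
    have "(L + 1) * r \<le> (L + 1) * (real M * r)" using L r M by (intro mult_left_mono) auto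
    then show "norm (?q w - f x) + (L + 1) * r \<le> (3 * L + 1) * real M * r" using rad by (simp add: algebra_simps)
  qed (use small in auto)
  define \<rho> where "\<rho> w = ?q w - f x - r *\<^sub>R ?A w" for w
  have add: "?A (w + e) = ?A w + ?A e"
    by (rule slope_map_add)
  have d: "?q (w + e) - ?q w = r *\<^sub>R ?A e + (\<rho> (w + e) - \<rho> w)" 
    unfolding \<rho>_def add scaleR_add_right by simp
  have qw: "?q w - f x = r *\<^sub>R ?A w + \<rho> w" by (simp add: \<rho>_def)
  have "B (?q w - f x) (?q (w + e) - ?q w) = B (r *\<^sub>R ?A w) (?q (w + e) - ?q w) + B (\<rho> w) (?q (w + e) - ?q w)"
    unfolding qw by (rule B.add_left)
  also have "B (r *\<^sub>R ?A w) (?q (w + e) - ?q w) = r\<^sup>2 * B (?A w) (?A e) + B (r *\<^sub>R ?A w) (\<rho> (w + e) - \<rho> w)"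
    unfolding d B.add_right by (simp add: B.scaleR_left B.scaleR_right power2_eq_square)
  finally have "B (?q w - f x) (?q (w + e) - ?q w) - r\<^sup>2 * B (?A w) (?A e)
      = B (r *\<^sub>R ?A w) (\<rho> (w + e) - \<rho> w) + B (\<rho> w) (?q (w + e) - ?q w)" by simp
  then have "\<bar>B (?q w - f x) (?q (w + e) - ?q w) - r\<^sup>2 * B (?A w) (?A e)\<bar>
      \<le> \<bar>B (r *\<^sub>R ?A w) (\<rho> (w + e) - \<rho> w)\<bar> + \<bar>B (\<rho> w) (?q (w + e) - ?q w)\<bar>" by simp
  also have "\<bar>B (r *\<^sub>R ?A w) (\<rho> (w + e) - \<rho> w)\<bar> \<le> \<kappa> * (r * (2 * real M * L)) * (2 * (\<epsilon> * r))"
  proof -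
    have "norm (\<rho> (w + e) - \<rho> w) \<le> \<epsilon> * r + \<epsilon> * r"
      unfolding \<rho>_def by (rule order_trans[OF norm_triangle_ineq4 add_mono[OF aff[OF w(2)] aff[OF w(1)]]])
    moreover have "norm (r *\<^sub>R ?A w) \<le> r * (2 * real M * L)" using nA r by simp
    ultimately show ?thesis using \<kappa> r L by (intro order_trans[OF BK] mult_mono mult_left_mono) auto
  qed
  also have "\<bar>B (\<rho> w) (?q (w + e) - ?q w)\<bar> \<le> \<kappa> * (\<epsilon> * r) * (L * r)"
    using aff[OF w(1)] step \<kappa> \<epsilon> r by (intro order_trans[OF BK] mult_mono mult_left_mono) (auto simp: \<rho>_def)
  also have "\<kappa> * (r * (2 * real M * L)) * (2 * (\<epsilon> * r)) + \<kappa> * (\<epsilon> * r) * (L * r) \<le> r\<^sup>2 * (5 * \<kappa> * L * real M * \<epsilon>)"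
  proof -
    have "(\<kappa> * \<epsilon> * L * r\<^sup>2) * 1 \<le> (\<kappa> * \<epsilon> * L * r\<^sup>2) * real M" using \<kappa> \<epsilon> L M by (intro mult_left_mono) auto
    then show ?thesis by (simp add: algebra_simps power2_eq_square)
  qed
  finally have c2: "\<bar>B (?q w - f x) (?q (w + e) - ?q w) - r\<^sup>2 * B (?A w) (?A e)\<bar> \<le> r\<^sup>2 * (5 * \<kappa> * L * real M * \<epsilon>)" by simp
  have "(\<eta> * ((3 * L + 1) * real M * r) + \<kappa> * ((L + 1) * r)) * ((L + 1) * r)
      = r\<^sup>2 * ((\<eta> * ((3 * L + 1) * real M) + \<kappa> * (L + 1)) * (L + 1))"
    by (simp add: algebra_simps power2_eq_square)
  then show ?thesis using c1 c2 unfolding distrib_left[of "r\<^sup>2"] by linarith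
qed

lemma norm_slope_map_Basis:
  assumes f: "cc_lipschitz_on L V K f" and x: "x \<in> good_points V K f M r \<epsilon>" and r: "0 < r" and M: "1 \<le> M" and e: "e \<in> Basis"
  shows "norm (slope_map f r x e) \<le> L"
proof -
  have "slope_map f r x e = (f (x + r *\<^sub>R e) - f x) /\<^sub>R r"
    using e by (rule slope_map_Basis)
  moreover have "norm (f (x + r *\<^sub>R e) - f x) \<le> L * r"
    using cc_lipschitz_on_norm[OF f, of "x + r *\<^sub>R e" x] x lattice_box_Basis[OF e M] r e
    by (auto simp: good_points_def dist_norm)
  ultimately show ?thesis using r by (simp add: pos_divide_le_eq divide_inverse_commute[symmetric])
qed

lemma good_points_path:
  fixes f :: "'a::euclidean_space \<Rightarrow> 'b::euclidean_space"
  assumes f: "cc_lipschitz_on L V K f" and x: "x \<in> good_points V K f M r \<epsilon>" and r: "0 < r" and M: "1 \<le> M" and \<epsilon>: "0 \<le> \<epsilon>"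
    and uv: "u \<in> Basis" "v \<in> Basis" "u \<noteq> v"
    and B: "bounded_bilinear B" and BK: "\<And>a b. \<bar>B a b\<bar> \<le> \<kappa> * norm a * norm b" and \<kappa>: "0 \<le> \<kappa>" and \<eta>: "0 \<le> \<eta>"
    and ann: "\<And>q v. norm (q - f x) < \<delta> \<Longrightarrow> v \<in> V q \<Longrightarrow> \<bar>\<zeta> \<bullet> v - B (q - f x) v\<bar> \<le> \<eta> * norm (q - f x) * norm v"
    and small: "(3 * L + 1) * real M * r < \<delta>"
    and A: "A = slope_map f r x"
  shows "\<bar>\<zeta> \<bullet> (f (x + r *\<^sub>R (real M *\<^sub>R u + real M *\<^sub>R v)) - f x)
      - r\<^sup>2 * ((\<Sum>s<M. real s) * (B (A u) (A u) + B (A v) (A v)) + (real M)\<^sup>2 * B (A u) (A v))\<bar>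
    \<le> 2 * real M * (r\<^sup>2 * ((\<eta> * ((3 * L + 1) * real M) + \<kappa> * (L + 1)) * (L + 1) + 5 * \<kappa> * L * real M * \<epsilon>))"
proof -
  interpret B: bounded_bilinear B by fact
  have L: "0 \<le> L" using f by (simp add: cc_lipschitz_on_def)
  define \<tau> where "\<tau> = r\<^sup>2 * ((\<eta> * ((3 * L + 1) * real M) + \<kappa> * (L + 1)) * (L + 1) + 5 * \<kappa> * L * real M * \<epsilon>)"
  let ?q = "\<lambda>w. f (x + r *\<^sub>R w)"
  have nu: "norm (A u) \<le> L" "norm (A v) \<le> L" unfolding A using norm_slope_map_Basis[OF f x r M] uv by auto
  have Aw: "A (real s *\<^sub>R u + real t *\<^sub>R v) = real s *\<^sub>R A u + real t *\<^sub>R A v" for s t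
    by (simp add: A slope_map_add slope_map_scaleR)
  have st: "\<bar>\<zeta> \<bullet> (?q (real s *\<^sub>R u + real t *\<^sub>R v + e) - ?q (real s *\<^sub>R u + real t *\<^sub>R v)) - r\<^sup>2 * B (A (real s *\<^sub>R u + real t *\<^sub>R v)) (A e)\<bar> \<le> \<tau>"
    if "s \<le> M" "t \<le> M" "real s *\<^sub>R u + real t *\<^sub>R v + e \<in> lattice_box M" "e \<in> Basis" for s t e
    unfolding A \<tau>_def
  proof (rule good_points_step[OF f x r M \<epsilon> _ that(3,4) _ _ B BK \<kappa> \<eta> ann small])
    show "real s *\<^sub>R u + real t *\<^sub>R v \<in> lattice_box M" by (intro lattice_box_pair uv that)
    have "norm (real s *\<^sub>R u + real t *\<^sub>R v) \<le> real s + real t"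
      using norm_triangle_ineq[of "real s *\<^sub>R u" "real t *\<^sub>R v"] uv by simp
    then show "norm (real s *\<^sub>R u + real t *\<^sub>R v) \<le> 2 * real M" using that by simp
    have "norm (A (real s *\<^sub>R u + real t *\<^sub>R v)) \<le> real s * norm (A u) + real t * norm (A v)"
      unfolding Aw using norm_triangle_ineq[of "real s *\<^sub>R A u" "real t *\<^sub>R A v"] by simp
    also have "\<dots> \<le> real M * L + real M * L" using nu that L by (intro add_mono mult_mono) auto
    finally show "norm (slope_map f r x (real s *\<^sub>R u + real t *\<^sub>R v)) \<le> 2 * real M * L" by (simp add: A mult_ac)
  qed
  have p1: "\<bar>\<zeta> \<bullet> (?q (real (Suc s) *\<^sub>R u) - ?q (real s *\<^sub>R u)) - r\<^sup>2 * (real s * B (A u) (A u))\<bar> \<le> \<tau>" if "s < M" for s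
  proof -
    have eq: "real s *\<^sub>R u + real 0 *\<^sub>R v + u = real (Suc s) *\<^sub>R u" "real s *\<^sub>R u + real 0 *\<^sub>R v = real s *\<^sub>R u" by (simp_all add: algebra_simps)
    have "real (Suc s) *\<^sub>R u \<in> lattice_box M" using lattice_box_pair[OF uv, of "Suc s" M 0] that by simp
    then show ?thesis using st[of s 0 u] that uv eq by (simp add: A slope_map_scaleR B.scaleR_left)
  qed
  have p2: "\<bar>\<zeta> \<bullet> (?q (real M *\<^sub>R u + real (Suc t) *\<^sub>R v) - ?q (real M *\<^sub>R u + real t *\<^sub>R v)) - r\<^sup>2 * (real M * B (A u) (A v) + real t * B (A v) (A v))\<bar> \<le> \<tau>" if "t < M" for t
  proof -
    have eq: "real M *\<^sub>R u + real t *\<^sub>R v + v = real M *\<^sub>R u + real (Suc t) *\<^sub>R v" by (simp add: algebra_simps)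
    have "real M *\<^sub>R u + real (Suc t) *\<^sub>R v \<in> lattice_box M" using lattice_box_pair[OF uv, of M M "Suc t"] that by simp
    then show ?thesis using st[of M t v] that uv eq by (simp add: Aw B.scaleR_left B.add_left)
  qed
  have tele: "\<zeta> \<bullet> (?q (real M *\<^sub>R u + real M *\<^sub>R v) - f x) =
     (\<Sum>s<M. \<zeta> \<bullet> (?q (real (Suc s) *\<^sub>R u) - ?q (real s *\<^sub>R u))) + (\<Sum>t<M. \<zeta> \<bullet> (?q (real M *\<^sub>R u + real (Suc t) *\<^sub>R v) - ?q (real M *\<^sub>R u + real t *\<^sub>R v)))"
    unfolding inner_diff_right
    using sum_lessThan_telescope[of "\<lambda>s. \<zeta> \<bullet> ?q (real s *\<^sub>R u)" M]
      sum_lessThan_telescope[of "\<lambda>t. \<zeta> \<bullet> ?q (real M *\<^sub>R u + real t *\<^sub>R v)" M] by simp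
  have area: "(\<Sum>s<M. real s) * (B (A u) (A u) + B (A v) (A v)) + (real M)\<^sup>2 * B (A u) (A v) =
     (\<Sum>s<M. real s * B (A u) (A u)) + (\<Sum>t<M. real M * B (A u) (A v) + real t * B (A v) (A v))"
    by (simp add: sum.distrib sum_distrib_right distrib_left power2_eq_square)
  let ?S1 = "\<Sum>s<M. \<zeta> \<bullet> (?q (real (Suc s) *\<^sub>R u) - ?q (real s *\<^sub>R u)) - r\<^sup>2 * (real s * B (A u) (A u))"
  let ?S2 = "\<Sum>t<M. \<zeta> \<bullet> (?q (real M *\<^sub>R u + real (Suc t) *\<^sub>R v) - ?q (real M *\<^sub>R u + real t *\<^sub>R v)) - r\<^sup>2 * (real M * B (A u) (A v) + real t * B (A v) (A v))"
  let ?X = "\<zeta> \<bullet> (?q (real M *\<^sub>R u + real M *\<^sub>R v) - f x) - r\<^sup>2 * ((\<Sum>s<M. real s) * (B (A u) (A u) + B (A v) (A v)) + (real M)\<^sup>2 * B (A u) (A v))"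
  have X: "?X = ?S1 + ?S2"
    unfolding tele area sum_subtractf distrib_left[of "r\<^sup>2" "sum _ _"] sum_distrib_left[of "r\<^sup>2"] by linarith
  have "\<bar>?S1\<bar> \<le> (\<Sum>s<M. \<tau>)"
    by (rule order_trans[OF sum_abs]) (rule sum_mono, rule p1, simp)
  moreover have "\<bar>?S2\<bar> \<le> (\<Sum>t<M. \<tau>)"
    by (rule order_trans[OF sum_abs]) (rule sum_mono, rule p2, simp)
  ultimately have "\<bar>?S1 + ?S2\<bar> \<le> 2 * real M * \<tau>"
    using abs_triangle_ineq[of ?S1 ?S2] by (simp only: sum_constant card_lessThan)
  then show ?thesis unfolding X[symmetric] \<tau>_def .
qed

lemma good_points_almost_isotropic:
  fixes f :: "'a::euclidean_space \<Rightarrow> 'b::euclidean_space"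
  assumes f: "cc_lipschitz_on L V K f" and x: "x \<in> good_points V K f M r \<epsilon>" and r: "0 < r" and M: "1 \<le> M" and \<epsilon>: "0 \<le> \<epsilon>"
    and uv: "u \<in> Basis" "v \<in> Basis"
    and B: "bounded_bilinear B" and BK: "\<And>a b. \<bar>B a b\<bar> \<le> \<kappa> * norm a * norm b" and \<kappa>: "0 \<le> \<kappa>" and \<eta>: "0 \<le> \<eta>"
    and ann: "\<And>q v. norm (q - f x) < \<delta> \<Longrightarrow> v \<in> V q \<Longrightarrow> \<bar>\<zeta> \<bullet> v - B (q - f x) v\<bar> \<le> \<eta> * norm (q - f x) * norm v"
    and small: "(3 * L + 1) * real M * r < \<delta>"
    and A: "A = slope_map f r x"
  shows "\<bar>B (A u) (A v) - B (A v) (A u)\<bar> \<le> 4 * ((\<eta> * (3 * L + 1) + \<kappa> * (L + 1) / real M) * (L + 1) + 5 * \<kappa> * L * \<epsilon>)"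
proof (cases "u = v")
  case True
  have "0 \<le> L" using f by (simp add: cc_lipschitz_on_def)
  then show ?thesis using True \<eta> \<kappa> \<epsilon> by simp
next
  case False
  let ?S = "(\<Sum>s<M. real s) * (B (A u) (A u) + B (A v) (A v))"
  define \<tau> where "\<tau> = (\<eta> * ((3 * L + 1) * real M) + \<kappa> * (L + 1)) * (L + 1) + 5 * \<kappa> * L * real M * \<epsilon>"
  let ?z = "\<zeta> \<bullet> (f (x + r *\<^sub>R (real M *\<^sub>R u + real M *\<^sub>R v)) - f x)"
  have 1: "\<bar>?z - r\<^sup>2 * (?S + (real M)\<^sup>2 * B (A u) (A v))\<bar> \<le> 2 * real M * (r\<^sup>2 * \<tau>)"
    using good_points_path[OF f x r M \<epsilon> uv False B BK \<kappa> \<eta> ann small A] by (simp add: \<tau>_def)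
  have 2: "\<bar>?z - r\<^sup>2 * (?S + (real M)\<^sup>2 * B (A v) (A u))\<bar> \<le> 2 * real M * (r\<^sup>2 * \<tau>)"
    using good_points_path[OF f x r M \<epsilon> uv(2,1) False[symmetric] B BK \<kappa> \<eta> ann small A] by (simp add: \<tau>_def add.commute)
  have "r\<^sup>2 * (real M * (real M * \<bar>B (A u) (A v) - B (A v) (A u)\<bar>)) =
     \<bar>r\<^sup>2 * (?S + (real M)\<^sup>2 * B (A u) (A v)) - r\<^sup>2 * (?S + (real M)\<^sup>2 * B (A v) (A u))\<bar>"
  proof -
    have "r\<^sup>2 * (?S + (real M)\<^sup>2 * B (A u) (A v)) - r\<^sup>2 * (?S + (real M)\<^sup>2 * B (A v) (A u)) = (r\<^sup>2 * (real M)\<^sup>2) * (B (A u) (A v) - B (A v) (A u))"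
      by (simp add: algebra_simps)
    then show ?thesis by (simp add: abs_mult power2_eq_square)
  qed
  also have "\<dots> \<le> 2 * real M * (r\<^sup>2 * \<tau>) + 2 * real M * (r\<^sup>2 * \<tau>)"
  proof -
    have tri: "\<bar>a - b\<bar> \<le> c + c" if "\<bar>z - a\<bar> \<le> c" "\<bar>z - b\<bar> \<le> c" for z a b c :: real
      using that by linarith
    show ?thesis by (rule tri[OF 1 2])
  qed
  also have "\<dots> = r\<^sup>2 * (real M * (4 * \<tau>))" by simp
  finally have "real M * (real M * \<bar>B (A u) (A v) - B (A v) (A u)\<bar>) \<le> real M * (4 * \<tau>)"
    using r by (simp add: mult_le_cancel_left)
  then have "real M * \<bar>B (A u) (A v) - B (A v) (A u)\<bar> \<le> 4 * \<tau>" using M by simp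
  also have "4 * \<tau> = real M * (4 * ((\<eta> * (3 * L + 1) + \<kappa> * (L + 1) / real M) * (L + 1) + 5 * \<kappa> * L * \<epsilon>))"
    using M by (simp add: \<tau>_def field_simps)
  finally show ?thesis using M by (simp add: mult_le_cancel_left)
qed

lemma good_points_almost_tangent:
  fixes f :: "'a::euclidean_space \<Rightarrow> 'b::euclidean_space"
  assumes f: "cc_lipschitz_on L V K f" and x: "x \<in> good_points V K f M r \<epsilon>" and r: "0 < r" and M: "1 \<le> M" and \<epsilon>: "0 \<le> \<epsilon>"
    and u: "u \<in> Basis"
    and B: "bounded_bilinear B" and BK: "\<And>a b. \<bar>B a b\<bar> \<le> \<kappa> * norm a * norm b" and \<kappa>: "0 \<le> \<kappa>" and \<eta>: "0 \<le> \<eta>"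
    and ann: "\<And>q v. norm (q - f x) < \<delta> \<Longrightarrow> v \<in> V q \<Longrightarrow> \<bar>\<zeta> \<bullet> v - B (q - f x) v\<bar> \<le> \<eta> * norm (q - f x) * norm v"
    and small: "(3 * L + 1) * real M * r < \<delta>"
  shows "\<bar>\<zeta> \<bullet> slope_map f r x u\<bar> \<le> r * ((\<eta> * ((3 * L + 1) * real M) + \<kappa> * (L + 1)) * (L + 1) + 5 * \<kappa> * L * real M * \<epsilon>)"
proof -
  interpret B: bounded_bilinear B by fact
  have L: "0 \<le> L" using f by (simp add: cc_lipschitz_on_def)
  have 0: "slope_map f r x 0 = 0" by (simp add: slope_map_def)
  have "f (x + r *\<^sub>R u) - f x = r *\<^sub>R slope_map f r x u"
    using u r by (simp add: slope_map_Basis)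
  then have "\<zeta> \<bullet> (f (x + r *\<^sub>R (0 + u)) - f (x + r *\<^sub>R 0)) - r\<^sup>2 * B (slope_map f r x 0) (slope_map f r x u) = r * (\<zeta> \<bullet> slope_map f r x u)"
    by (simp add: 0 B.zero_left)
  moreover have "\<bar>\<zeta> \<bullet> (f (x + r *\<^sub>R (0 + u)) - f (x + r *\<^sub>R 0)) - r\<^sup>2 * B (slope_map f r x 0) (slope_map f r x u)\<bar>
     \<le> r\<^sup>2 * ((\<eta> * ((3 * L + 1) * real M) + \<kappa> * (L + 1)) * (L + 1) + 5 * \<kappa> * L * real M * \<epsilon>)"
    using lattice_box_0[of M] lattice_box_Basis[OF u M] L
    by (intro good_points_step[OF f x r M \<epsilon> _ _ u _ _ B BK \<kappa> \<eta> ann small]) (auto simp: 0)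
  ultimately have "r * \<bar>\<zeta> \<bullet> slope_map f r x u\<bar> \<le> r * (r * ((\<eta> * ((3 * L + 1) * real M) + \<kappa> * (L + 1)) * (L + 1) + 5 * \<kappa> * L * real M * \<epsilon>))"
    using r by (simp add: abs_mult power2_eq_square mult.assoc)
  then show ?thesis using r by (simp add: mult_le_cancel_left)
qed

lemma finite_family_convergent_subsequence:
  fixes a :: "nat \<Rightarrow> 'c \<Rightarrow> 'b::euclidean_space"
  assumes "finite S" "\<And>b. b \<in> S \<Longrightarrow> bounded (range (\<lambda>n. a n b))"
  shows "\<exists>\<phi>. strict_mono \<phi> \<and> (\<forall>b\<in>S. \<exists>l. (\<lambda>n. a (\<phi> n) b) \<longlonglongrightarrow> l)"
  using assms
proof (induction S rule: finite_induct)
  case empty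
  then show ?case by (auto intro: exI[of _ id] simp: strict_mono_def)
next
  case (insert b S)
  then obtain \<phi> where \<phi>: "strict_mono \<phi>" "\<forall>b\<in>S. \<exists>l. (\<lambda>n. a (\<phi> n) b) \<longlonglongrightarrow> l" by auto
  have "bounded (range (\<lambda>n. a (\<phi> n) b))" using insert.prems[of b] by (rule bounded_subset) auto
  then obtain l \<psi> where \<psi>: "strict_mono \<psi>" "((\<lambda>n. a (\<phi> n) b) \<circ> \<psi>) \<longlonglongrightarrow> l"
    using bounded_imp_convergent_subsequence by blast
  have "\<forall>b'\<in>insert b S. \<exists>l. (\<lambda>n. a ((\<phi> \<circ> \<psi>) n) b') \<longlonglongrightarrow> l"
  proof
    fix b' assume "b' \<in> insert b S"
    then consider "b' = b" | "b' \<in> S" by auto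
    then show "\<exists>l. (\<lambda>n. a ((\<phi> \<circ> \<psi>) n) b') \<longlonglongrightarrow> l"
    proof cases
      case 1 then show ?thesis using \<psi>(2) by (auto simp: comp_def)
    next
      case 2
      then obtain l' where "(\<lambda>n. a (\<phi> n) b') \<longlonglongrightarrow> l'" using \<phi>(2) by blast
      then show ?thesis using LIMSEQ_subseq_LIMSEQ[OF _ \<psi>(1)] by (auto simp: comp_def)
    qed
  qed
  then show ?case using strict_mono_o[OF \<phi>(1) \<psi>(1)] by blast
qed

lemma no_noncollapsed_sequence:
  fixes f :: "'a::euclidean_space \<Rightarrow> 'b::euclidean_space"
  assumes X: "\<And>l. l < k \<Longrightarrow> class_C_on 1 UNIV (X l)" and V: "spans_on UNIV k X V" and dimV: "\<And>p. dim (V p) = k"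
    and noninv: "h_noninvolutive h V" and h: "h \<le> DIM('a)"
    and f: "cc_lipschitz_on L V K f"
    and x: "\<And>n. x \<in> good_points V K f (M n) (r n) (\<epsilon> n)" and r: "\<And>n. 0 < r n" and M: "\<And>n. 1 \<le> M n" and \<epsilon>: "\<And>n. 0 \<le> \<epsilon> n"
    and Mlim: "filterlim (\<lambda>n. real (M n)) at_top sequentially" and \<epsilon>lim: "\<epsilon> \<longlonglongrightarrow> 0" and Mr: "(\<lambda>n. real (M n) * r n) \<longlonglongrightarrow> 0"
    and c: "0 < c" and nc: "\<And>n v. c * norm v \<le> norm (slope_map f (r n) x v)"
  shows False
proof -
  have L: "0 \<le> L" using f by (simp add: cc_lipschitz_on_def)
  let ?p = "f x"
  have bnd: "bounded (range (\<lambda>n. slope_map f (r n) x b))" if "b \<in> Basis" for b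
    using norm_slope_map_Basis[OF f x r M that] by (auto simp: bounded_iff intro!: exI[of _ L])
  obtain \<phi> where \<phi>: "strict_mono \<phi>" "\<forall>b\<in>Basis. \<exists>l. (\<lambda>n. slope_map f (r (\<phi> n)) x b) \<longlonglongrightarrow> l"
    using finite_family_convergent_subsequence[OF finite_Basis, of "\<lambda>n b. slope_map f (r n) x b"] bnd by blast
  then obtain a0 where a0: "\<And>b. b \<in> Basis \<Longrightarrow> (\<lambda>n. slope_map f (r (\<phi> n)) x b) \<longlonglongrightarrow> a0 b" by metis
  define A where "A v = (\<Sum>b\<in>Basis. (v \<bullet> b) *\<^sub>R a0 b)" for v
  let ?S = "\<lambda>n. slope_map f (r (\<phi> n)) x"
  have Slim: "(\<lambda>n. ?S n v) \<longlonglongrightarrow> A v" for v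
  proof -
    have "?S n v = (\<Sum>b\<in>Basis. (v \<bullet> b) *\<^sub>R ?S n b)" for n
      unfolding slope_map_def[of f "r (\<phi> n)" x v] by (intro sum.cong refl) (simp add: slope_map_Basis)
    moreover have "(\<lambda>n. \<Sum>b\<in>Basis. (v \<bullet> b) *\<^sub>R ?S n b) \<longlonglongrightarrow> A v"
      unfolding A_def by (intro tendsto_sum tendsto_scaleR tendsto_const a0)
    ultimately show ?thesis by simp
  qed
  have linA: "linear A" unfolding A_def
    by (intro linearI) (simp_all add: inner_add_left scaleR_add_left sum.distrib scaleR_sum_right)
  have ncA: "c * norm v \<le> norm (A v)" for v
    using tendsto_norm[OF Slim] by (rule tendsto_lowerbound) (auto intro: always_eventually nc)
  have injA: "inj A"
  proof -
    have "v = 0" if "A v = 0" for v using ncA[of v] that c by (simp add: mult_le_0_iff)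
    then show ?thesis using linear_injective_0[OF linA] by blast
  qed
  obtain T where T: "T \<subseteq> (Basis :: 'a set)" "card T = h" "finite T"
    using obtain_subset_with_card_n[OF h] by blast
  obtain e where "bij_betw e {0..<card T} T" using ex_bij_betw_nat_finite[OF T(3)] by blast
  then have e: "inj_on e {..<h}" "e ` {..<h} = T" unfolding T(2) bij_betw_def lessThan_atLeast0 by auto
  have eB: "e i \<in> Basis" if "i < h" for i using e(2) T(1) that by auto
  have indT: "independent T" using T(1) independent_Basis independent_mono by blast
  have "independent (A ` T)"
    using linA indT injA by (intro linear_independent_injective_image) (auto intro: inj_on_subset)
  then have "independent ((\<lambda>i. A (e i)) ` {..<h})" using e(2) by (simp add: image_comp[symmetric] image_image[symmetric])
  moreover have "inj_on (\<lambda>i. A (e i)) {..<h}"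
    using e(1) injA by (auto simp: inj_on_def)
  ultimately obtain b where b: "dual_family h b (\<lambda>i. A (e i))" by (rule independent_imp_dual_family)
  have Vq: "V q = span ((\<lambda>l. X l q) ` {..<k})" for q using V by (auto simp: spans_on_def)
  obtain z where z: "dual_family k z (\<lambda>l. X l ?p)"
    using dim_span_imp_dual_family[of "\<lambda>l. X l ?p" k] dimV[of ?p] Vq by metis
  let ?D = "\<lambda>l. frechet_derivative (X l) (at ?p)"
  have D: "(X l has_derivative ?D l) (at ?p)" if "l < k" for l
    using X[OF that] frechet_derivative_works by (auto simp: class_C_on_1_iff)
  have M\<phi>: "filterlim (\<lambda>n. real (M (\<phi> n))) at_top sequentially"
    by (rule filterlim_compose[OF Mlim filterlim_subseq[OF \<phi>(1)]])
  have \<epsilon>\<phi>: "(\<lambda>n. \<epsilon> (\<phi> n)) \<longlonglongrightarrow> 0" using LIMSEQ_subseq_LIMSEQ[OF \<epsilon>lim \<phi>(1)] by (simp add: comp_def)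
  have Mr\<phi>: "(\<lambda>n. real (M (\<phi> n)) * r (\<phi> n)) \<longlonglongrightarrow> 0" using LIMSEQ_subseq_LIMSEQ[OF Mr \<phi>(1)] by (simp add: comp_def)
  have r\<phi>: "(\<lambda>n. r (\<phi> n)) \<longlonglongrightarrow> 0"
  proof (rule tendsto_sandwich[OF _ _ tendsto_const Mr\<phi>])
    show "eventually (\<lambda>n. r (\<phi> n) \<le> real (M (\<phi> n)) * r (\<phi> n)) sequentially"
    proof (intro always_eventually allI)
      fix n
      have "1 * r (\<phi> n) \<le> real (M (\<phi> n)) * r (\<phi> n)" using r M by (intro mult_right_mono) (auto intro: less_imp_le)
      then show "r (\<phi> n) \<le> real (M (\<phi> n)) * r (\<phi> n)" by simp
    qed
  qed (use r in \<open>auto intro: always_eventually less_imp_le\<close>)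
  have ev_small: "eventually (\<lambda>n. (3 * L + 1) * real (M (\<phi> n)) * r (\<phi> n) < \<delta>) sequentially" if "\<delta> > 0" for \<delta>
  proof -
    have "(\<lambda>n. (3 * L + 1) * (real (M (\<phi> n)) * r (\<phi> n))) \<longlonglongrightarrow> (3 * L + 1) * 0" by (intro tendsto_mult_left Mr\<phi>)
    then have "eventually (\<lambda>n. (3 * L + 1) * (real (M (\<phi> n)) * r (\<phi> n)) < \<delta>) sequentially" using that by (intro order_tendstoD) auto
    then show ?thesis by (simp add: mult.assoc)
  qed
  have correction: "\<exists>\<kappa>. bounded_bilinear (annihilator_correction k ?D z \<zeta>) \<and> 0 < \<kappa> \<and> (\<forall>a b. \<bar>annihilator_correction k ?D z \<zeta> a b\<bar> \<le> \<kappa> * norm a * norm b) \<and>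
     annihilates_to_first_order V ?p \<zeta> (annihilator_correction k ?D z \<zeta>)" if \<zeta>: "\<forall>v\<in>V ?p. \<zeta> \<bullet> v = 0" for \<zeta>
  proof -
    have bb: "bounded_bilinear (annihilator_correction k ?D z \<zeta>)"
      using D by (intro bounded_bilinear_annihilator_correction has_derivative_bounded_linear)
    then interpret B: bounded_bilinear "annihilator_correction k ?D z \<zeta>" .
    obtain \<kappa> where \<kappa>: "\<kappa> > 0" "\<And>a b. norm (annihilator_correction k ?D z \<zeta> a b) \<le> norm a * norm b * \<kappa>" using B.pos_bounded by blast
    have "X l ?p \<in> V ?p" if "l < k" for l using that unfolding Vq by (auto intro: span_base)
    then have "annihilates_to_first_order V ?p \<zeta> (annihilator_correction k ?D z \<zeta>)"
      using \<zeta> by (intro annihilates_to_first_order_frame[OF open_UNIV UNIV_I V D z]) auto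
    then show ?thesis using bb \<kappa> by (intro exI[of _ \<kappa>]) (auto simp: mult_ac)
  qed
  have AV: "A u \<in> V ?p" if u: "u \<in> Basis" for u
  proof (rule mem_subspace_if_orthogonal_annihilator)
    show "subspace (V ?p)" unfolding Vq by simp
    fix \<zeta> assume \<zeta>: "\<forall>v\<in>V ?p. \<zeta> \<bullet> v = 0"
    let ?B = "annihilator_correction k ?D z \<zeta>"
    obtain \<kappa> where B: "bounded_bilinear ?B" and \<kappa>: "0 < \<kappa>" "\<And>a b. \<bar>?B a b\<bar> \<le> \<kappa> * norm a * norm b"
      and ann: "annihilates_to_first_order V ?p \<zeta> ?B" using correction[OF \<zeta>] by blast
    obtain \<delta> where \<delta>: "\<delta> > 0" "\<And>q w. norm (q - ?p) < \<delta> \<Longrightarrow> w \<in> V q \<Longrightarrow> \<bar>\<zeta> \<bullet> w - ?B (q - ?p) w\<bar> \<le> 1 * norm (q - ?p) * norm w"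
      using ann unfolding annihilates_to_first_order_def by (meson zero_less_one)
    let ?R = "\<lambda>n. (real (M (\<phi> n)) * r (\<phi> n)) * ((3 * L + 1) * (L + 1)) + r (\<phi> n) * (\<kappa> * (L + 1) * (L + 1)) + 5 * \<kappa> * L * (real (M (\<phi> n)) * r (\<phi> n)) * \<epsilon> (\<phi> n)"
    have "?R \<longlonglongrightarrow> 0 * ((3 * L + 1) * (L + 1)) + 0 * (\<kappa> * (L + 1) * (L + 1)) + 5 * \<kappa> * L * 0 * 0"
      by (intro tendsto_add tendsto_mult tendsto_const Mr\<phi> r\<phi> \<epsilon>\<phi>)
    then have R0: "?R \<longlonglongrightarrow> 0" by simp
    have "eventually (\<lambda>n. \<bar>\<zeta> \<bullet> ?S n u\<bar> \<le> ?R n) sequentially"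
      using ev_small[OF \<delta>(1)]
    proof (rule eventually_mono)
      fix n assume sm: "(3 * L + 1) * real (M (\<phi> n)) * r (\<phi> n) < \<delta>"
      have "\<bar>\<zeta> \<bullet> ?S n u\<bar> \<le> r (\<phi> n) * ((1 * ((3 * L + 1) * real (M (\<phi> n))) + \<kappa> * (L + 1)) * (L + 1) + 5 * \<kappa> * L * real (M (\<phi> n)) * \<epsilon> (\<phi> n))"
        using \<kappa>(1) by (intro good_points_almost_tangent[OF f x r M \<epsilon> u B \<kappa>(2) _ _ \<delta>(2) sm]) auto
      also have "\<dots> = ?R n" by (simp add: algebra_simps)
      finally show "\<bar>\<zeta> \<bullet> ?S n u\<bar> \<le> ?R n" .
    qed
    moreover have "(\<lambda>n. \<bar>\<zeta> \<bullet> ?S n u\<bar>) \<longlonglongrightarrow> \<bar>\<zeta> \<bullet> A u\<bar>" by (intro tendsto_rabs tendsto_inner tendsto_const Slim)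
    ultimately have "\<bar>\<zeta> \<bullet> A u\<bar> \<le> 0" using tendsto_le[OF sequentially_bot R0] by blast
    then show "\<zeta> \<bullet> A u = 0" by simp
  qed
  have "\<not> h_noninvolutive_at h V ?p"
  proof (rule isotropic_imp_not_h_noninvolutive[OF X V z _ b])
    show "A (e i) \<in> V ?p" if "i < h" for i using AV eB[OF that] by blast
    fix \<zeta> i j assume \<zeta>: "\<forall>v\<in>V ?p. \<zeta> \<bullet> v = 0" and ij: "i < h" "j < h"
    let ?B = "annihilator_correction k ?D z \<zeta>"
    obtain \<kappa> where B: "bounded_bilinear ?B" and \<kappa>: "0 < \<kappa>" "\<And>a b. \<bar>?B a b\<bar> \<le> \<kappa> * norm a * norm b"
      and ann: "annihilates_to_first_order V ?p \<zeta> ?B" using correction[OF \<zeta>] by blast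
    interpret B: bounded_bilinear ?B by (rule B)
    let ?u = "e i" and ?v = "e j"
    have lim: "(\<lambda>n. \<bar>?B (?S n ?u) (?S n ?v) - ?B (?S n ?v) (?S n ?u)\<bar>) \<longlonglongrightarrow> \<bar>?B (A ?u) (A ?v) - ?B (A ?v) (A ?u)\<bar>"
      by (intro tendsto_rabs tendsto_diff B.tendsto Slim)
    have "\<bar>?B (A ?u) (A ?v) - ?B (A ?v) (A ?u)\<bar> \<le> 0 + t" if t: "t > 0" for t
    proof -
      define \<eta> where "\<eta> = t / (4 * ((3 * L + 1) * (L + 1)))"
      have pos: "4 * ((3 * L + 1) * (L + 1)) > 0" using L by (intro mult_pos_pos) auto
      then have \<eta>: "\<eta> > 0" using t unfolding \<eta>_def by (intro divide_pos_pos)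
      obtain \<delta> where \<delta>: "\<delta> > 0" "\<And>q w. norm (q - ?p) < \<delta> \<Longrightarrow> w \<in> V q \<Longrightarrow> \<bar>\<zeta> \<bullet> w - ?B (q - ?p) w\<bar> \<le> \<eta> * norm (q - ?p) * norm w"
        using ann \<eta> unfolding annihilates_to_first_order_def by meson
      let ?R = "\<lambda>n. 4 * ((\<eta> * (3 * L + 1) + \<kappa> * (L + 1) / real (M (\<phi> n))) * (L + 1) + 5 * \<kappa> * L * \<epsilon> (\<phi> n))"
      have "(\<lambda>n. \<kappa> * (L + 1) / real (M (\<phi> n))) \<longlonglongrightarrow> 0"
        by (rule tendsto_divide_0[OF tendsto_const]) (rule filterlim_at_top_imp_at_infinity[OF M\<phi>])
      then have "?R \<longlonglongrightarrow> 4 * ((\<eta> * (3 * L + 1) + 0) * (L + 1) + 5 * \<kappa> * L * 0)"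
        by (intro tendsto_add tendsto_mult tendsto_const \<epsilon>\<phi>)
      moreover have "4 * ((\<eta> * (3 * L + 1) + 0) * (L + 1) + 5 * \<kappa> * L * 0) = \<eta> * (4 * ((3 * L + 1) * (L + 1)))" by simp
      moreover have "\<eta> * (4 * ((3 * L + 1) * (L + 1))) = t" unfolding \<eta>_def using less_imp_neq[OF pos] by (metis nonzero_eq_divide_eq)
      ultimately have Rt: "?R \<longlonglongrightarrow> t" by metis
      have "eventually (\<lambda>n. \<bar>?B (?S n ?u) (?S n ?v) - ?B (?S n ?v) (?S n ?u)\<bar> \<le> ?R n) sequentially"
        using ev_small[OF \<delta>(1)]
      proof (rule eventually_mono)
        fix n assume sm: "(3 * L + 1) * real (M (\<phi> n)) * r (\<phi> n) < \<delta>"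
        show "\<bar>?B (?S n ?u) (?S n ?v) - ?B (?S n ?v) (?S n ?u)\<bar> \<le> ?R n"
          using \<kappa>(1) \<eta> by (intro good_points_almost_isotropic[OF f x r M \<epsilon> eB[OF ij(1)] eB[OF ij(2)] B \<kappa>(2) _ _ \<delta>(2) sm refl]) auto
      qed
      then show ?thesis using tendsto_le[OF sequentially_bot Rt lim] by simp
    qed
    then have "\<bar>?B (A ?u) (A ?v) - ?B (A ?v) (A ?u)\<bar> \<le> 0" by (rule field_le_epsilon)
    then show "?B (A ?u) (A ?v) = ?B (A ?v) (A ?u)" by simp
  qed
  then show False using noninv unfolding h_noninvolutive_def by blast
qed

definition noncollapsed_points ::
  "('b::euclidean_space \<Rightarrow> 'b set) \<Rightarrow> 'a::euclidean_space set \<Rightarrow> ('a \<Rightarrow> 'b) \<Rightarrow> nat \<Rightarrow> real \<Rightarrow> real \<Rightarrow> real \<Rightarrow> 'a set" where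
  "noncollapsed_points V K f M r \<epsilon> c = {x \<in> good_points V K f M r \<epsilon>. \<forall>v. c * norm v \<le> norm (slope_map f r x v)}"

lemma (in first_order_distribution) closed_noncollapsed_points:
  assumes f: "cc_lipschitz_on L V K f" and K: "compact K" and M: "1 \<le> M"
  shows "closed (noncollapsed_points V K f M r \<epsilon> c)"
proof -
  let ?lat = "lattice_box M"
  define K0 where "K0 = K \<inter> (\<Inter>w\<in>?lat. {x\<in>K. x + r *\<^sub>R w \<in> K})"
  have K0: "closed K0" unfolding K0_def
    using K by (intro closed_Int closed_INT ballI compact_imp_closed compact_shifted_intersection)
  have in0: "x + r *\<^sub>R w \<in> K" if "x \<in> K0" "w \<in> ?lat" for x w using that by (auto simp: K0_def)
  have cf: "continuous_on K f" by (rule cc_lipschitz_on_continuous[OF f])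
  have cs: "continuous_on K0 (\<lambda>x. f (x + r *\<^sub>R w))" if "w \<in> ?lat" for w
    by (rule continuous_on_compose2[OF cf]) (use in0 that in \<open>auto intro!: continuous_intros\<close>)
  have cf0: "continuous_on K0 f" by (rule continuous_on_subset[OF cf]) (auto simp: K0_def)
  have csl: "continuous_on K0 (\<lambda>x. slope_map f r x w)" for w
    unfolding slope_map_def by (intro continuous_intros cs cf0 lattice_box_Basis M)
  define C1 where "C1 w = {x\<in>K0. norm (f (x + r *\<^sub>R w) - f x - r *\<^sub>R slope_map f r x w) \<le> \<epsilon> * r}" for w
  define C2 where "C2 p = {x\<in>K0. real_cc_dist V (f (x + r *\<^sub>R fst p)) (f (x + r *\<^sub>R snd p)) \<le> norm (f (x + r *\<^sub>R snd p) - f (x + r *\<^sub>R fst p)) + \<epsilon> * r}" for p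
  define C3 where "C3 v = {x\<in>K0. c * norm v \<le> norm (slope_map f r x v)}" for v
  have "closed (C1 w)" if "w \<in> ?lat" for w
    unfolding C1_def by (intro continuous_on_closed_Collect_le K0 continuous_intros cs cf0 csl that)
  moreover have "closed (C2 p)" if "p \<in> ?lat \<times> ?lat" for p
  proof -
    have p: "fst p \<in> ?lat" "snd p \<in> ?lat" using that by auto
    have "continuous_on K0 (\<lambda>x. real_cc_dist V (f (x + r *\<^sub>R fst p)) (f (x + r *\<^sub>R snd p)))"
      using in0 p by (intro continuous_on_real_cc_dist[OF f] continuous_intros) auto
    then show ?thesis unfolding C2_def by (intro continuous_on_closed_Collect_le K0 continuous_intros cs p)
  qed
  moreover have "closed (C3 v)" for v
    unfolding C3_def by (intro continuous_on_closed_Collect_le K0 continuous_intros csl)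
  ultimately have "closed (K0 \<inter> (\<Inter>w\<in>?lat. C1 w) \<inter> (\<Inter>p\<in>?lat \<times> ?lat. C2 p) \<inter> (\<Inter>v. C3 v))"
    using K0 by (intro closed_Int closed_INT ballI) auto
  moreover have "noncollapsed_points V K f M r \<epsilon> c = K0 \<inter> (\<Inter>w\<in>?lat. C1 w) \<inter> (\<Inter>p\<in>?lat \<times> ?lat. C2 p) \<inter> (\<Inter>v. C3 v)"
    unfolding noncollapsed_points_def good_points_def K0_def C1_def C2_def C3_def by auto
  ultimately show ?thesis by simp
qed

theorem (in first_order_distribution) collapsed_at_small_scale:
  fixes f :: "'a::euclidean_space \<Rightarrow> 'b"
  assumes X: "\<And>l. l < k \<Longrightarrow> class_C_on 1 UNIV (X l)" and Vsp: "spans_on UNIV k X V" and dimV: "\<And>p. dim (V p) = k"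
    and noninv: "h_noninvolutive h V" and h: "h \<le> DIM('a)"
    and f: "cc_lipschitz_on L V K f" and K: "compact K" and c: "0 < c" and e: "0 < e"
  obtains M :: nat and r \<epsilon> :: real and B :: "'a set" where "1 \<le> M" "1 / real M < e" "0 < r" "real M * r < e" "0 \<le> \<epsilon>" "\<epsilon> < e"
    "B \<in> sets borel" "emeasure lborel B < ennreal e"
    "\<And>x. x \<in> K - B \<Longrightarrow> x \<in> good_points V K f M r \<epsilon> \<and> (\<exists>v. norm (slope_map f r x v) < c * norm v)"
proof -
  have "\<exists>n B. real (Suc j) * (1/2)^n < 1 / real (Suc j) \<and> B \<in> sets borel \<and>
      K - good_points V K f (Suc j) ((1/2)^n) (1 / real (Suc j)) \<subseteq> B \<and> emeasure lborel B < ennreal (1 / real (Suc j))" for j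
  proof -
    obtain B where B: "\<And>n. B n \<in> sets borel" "\<And>n. K - good_points V K f (Suc j) ((1/2)^n) (1 / real (Suc j)) \<subseteq> B n"
      "(\<lambda>n. emeasure lborel (B n)) \<longlonglongrightarrow> 0"
      using good_points_exhaust[OF f K, of "Suc j" "1 / real (Suc j)"] by auto
    have "eventually (\<lambda>n. emeasure lborel (B n) < ennreal (1 / real (Suc j))) sequentially"
      using B(3) by (rule order_tendstoD) simp
    moreover have "(\<lambda>n. real (Suc j) * (1/2)^n) \<longlonglongrightarrow> real (Suc j) * 0"
      by (intro tendsto_mult_left LIMSEQ_power_zero) simp
    then have "eventually (\<lambda>n. real (Suc j) * (1/2)^n < 1 / real (Suc j)) sequentially"
      by (rule order_tendstoD) simp
    ultimately have "eventually (\<lambda>n. real (Suc j) * (1/2)^n < 1 / real (Suc j) \<and> emeasure lborel (B n) < ennreal (1 / real (Suc j))) sequentially"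
      by (simp add: eventually_conj)
    then obtain n where "real (Suc j) * (1/2)^n < 1 / real (Suc j)" "emeasure lborel (B n) < ennreal (1 / real (Suc j))"
      using eventually_happens'[OF sequentially_bot] by blast
    then show ?thesis using B by blast
  qed
  then obtain n B where nB: "\<And>j. real (Suc j) * (1/2)^(n j) < 1 / real (Suc j)" "\<And>j. B j \<in> sets borel"
    "\<And>j. K - good_points V K f (Suc j) ((1/2)^(n j)) (1 / real (Suc j)) \<subseteq> B j" "\<And>j. emeasure lborel (B j) < ennreal (1 / real (Suc j))" by metis
  let ?r = "\<lambda>j. (1/2::real)^(n j)"
  define N where "N j = noncollapsed_points V K f (Suc j) (?r j) (1 / real (Suc j)) c" for j
  have Nc: "closed (N j)" for j unfolding N_def by (rule closed_noncollapsed_points[OF f K]) simp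
  have NK: "N j \<subseteq> K" for j by (auto simp: N_def noncollapsed_points_def good_points_def)
  have inv: "(\<lambda>j. 1 / real (Suc j)) \<longlonglongrightarrow> 0" using LIMSEQ_inverse_real_of_nat by (simp add: inverse_eq_divide)
  have empty: "(\<Inter>j. \<Union>i\<in>{j..}. N i) = {}"
  proof (rule ccontr)
    assume "(\<Inter>j. \<Union>i\<in>{j..}. N i) \<noteq> {}"
    then obtain x where "x \<in> (\<Inter>j. \<Union>i\<in>{j..}. N i)" by blast
    then have "x \<in> (\<Union>i\<in>{j..}. N i)" for j by (rule INT_D) simp
    then have x: "\<exists>i\<ge>j. x \<in> N i" for j by (meson UN_iff atLeast_iff)
    then have inf: "infinite {i. x \<in> N i}" by (simp add: infinite_nat_iff_unbounded_le)
    define \<phi> where "\<phi> = enumerate {i. x \<in> N i}"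
    have \<phi>: "strict_mono \<phi>" "\<And>i. x \<in> N (\<phi> i)" using strict_mono_enumerate[OF inf] enumerate_in_set[OF inf] by (auto simp: \<phi>_def)
    have xin: "x \<in> good_points V K f (Suc (\<phi> i)) (?r (\<phi> i)) (1 / real (Suc (\<phi> i)))" "\<And>v. c * norm v \<le> norm (slope_map f (?r (\<phi> i)) x v)" for i
      using \<phi>(2)[of i] by (auto simp: N_def noncollapsed_points_def)
    have inv\<phi>: "(\<lambda>i. 1 / real (Suc (\<phi> i))) \<longlonglongrightarrow> 0" using LIMSEQ_subseq_LIMSEQ[OF inv \<phi>(1)] by (simp add: comp_def)
    show False
    proof (rule no_noncollapsed_sequence[OF X Vsp dimV noninv h f xin(1) _ _ _ _ inv\<phi> _ c xin(2)])
      show "filterlim (\<lambda>i. real (Suc (\<phi> i))) at_top sequentially"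
        by (rule filterlim_compose[OF filterlim_real_sequentially]) (rule filterlim_compose[OF filterlim_Suc filterlim_subseq[OF \<phi>(1)]])
      show "(\<lambda>i. real (Suc (\<phi> i)) * ?r (\<phi> i)) \<longlonglongrightarrow> 0"
      proof (rule tendsto_sandwich[OF _ _ tendsto_const inv\<phi>])
        show "eventually (\<lambda>i. real (Suc (\<phi> i)) * ?r (\<phi> i) \<le> 1 / real (Suc (\<phi> i))) sequentially"
          by (intro always_eventually allI less_imp_le nB(1))
      qed (intro always_eventually allI, simp)
    qed auto
  qed
  have "(\<lambda>j. emeasure lborel (\<Union>i\<in>{j..}. N i)) \<longlonglongrightarrow> emeasure lborel (\<Inter>j. \<Union>i\<in>{j..}. N i)"
  proof (rule Lim_emeasure_decseq)
    show "range (\<lambda>j. \<Union>i\<in>{j..}. N i) \<subseteq> sets lborel" using Nc by (auto intro!: sets.countable_UN')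
    show "decseq (\<lambda>j. \<Union>i\<in>{j..}. N i)" by (intro decseq_SucI UN_mono) auto
    fix j
    have "emeasure lborel (\<Union>i\<in>{j..}. N i) \<le> emeasure lborel K"
      using NK K by (intro emeasure_mono) (auto intro: borel_compact)
    also have "\<dots> < \<infinity>" using K by (rule emeasure_compact_finite)
    finally show "emeasure lborel (\<Union>i\<in>{j..}. N i) \<noteq> \<infinity>" by simp
  qed
  then have lim: "(\<lambda>j. emeasure lborel (\<Union>i\<in>{j..}. N i)) \<longlonglongrightarrow> 0" by (simp add: empty)
  have "eventually (\<lambda>j. emeasure lborel (\<Union>i\<in>{j..}. N i) < ennreal (e/2)) sequentially"
    using lim by (rule order_tendstoD) (use e in simp)
  moreover have "eventually (\<lambda>j. 1 / real (Suc j) < e / 2) sequentially" using inv by (rule order_tendstoD) (use e in simp)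
  ultimately have "eventually (\<lambda>j. emeasure lborel (\<Union>i\<in>{j..}. N i) < ennreal (e/2) \<and> 1 / real (Suc j) < e / 2) sequentially"
    by (rule eventually_conj)
  then obtain j where j: "emeasure lborel (\<Union>i\<in>{j..}. N i) < ennreal (e/2)" "1 / real (Suc j) < e / 2"
    using eventually_happens'[OF sequentially_bot] by blast
  show ?thesis
  proof (rule that[of "Suc j" "?r j" "1 / real (Suc j)" "B j \<union> N j"])
    show "B j \<union> N j \<in> sets borel" using nB(2) Nc by simp
    have "emeasure lborel (B j \<union> N j) \<le> emeasure lborel (B j) + emeasure lborel (N j)"
      using nB(2) Nc by (intro emeasure_subadditive) auto
    also have "emeasure lborel (N j) \<le> emeasure lborel (\<Union>i\<in>{j..}. N i)"
      using Nc by (intro emeasure_mono) (auto intro!: sets.countable_UN')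
    also have "emeasure lborel (B j) + emeasure lborel (\<Union>i\<in>{j..}. N i) < ennreal (e/2) + ennreal (e/2)"
    proof (rule add_strict_mono)
      show "emeasure lborel (B j) < ennreal (e/2)" using nB(4)[of j] j(2) by (simp add: less_le_trans ennreal_leI less_imp_le)
    qed (rule j(1))
    also have "ennreal (e/2) + ennreal (e/2) = ennreal e" using e by (simp add: ennreal_plus[symmetric] del: ennreal_plus)
    finally show "emeasure lborel (B j \<union> N j) < ennreal e" by (simp add: add_left_mono)
    show "real (Suc j) * ?r j < e" "1 / real (Suc j) < e" using nB(1)[of j] j(2) e by linarith+
    then show "1 / real (Suc j) < e" by simp
    fix x assume "x \<in> K - (B j \<union> N j)"
    then have x: "x \<in> good_points V K f (Suc j) (?r j) (1 / real (Suc j))" "x \<notin> N j" using nB(3)[of j] by auto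
    then show "x \<in> good_points V K f (Suc j) (?r j) (1 / real (Suc j)) \<and> (\<exists>v. norm (slope_map f (?r j) x v) < c * norm v)"
      by (auto simp: N_def noncollapsed_points_def not_le)
  qed auto
qed

lemma hausdorff_pre_le_finite_cover:
  fixes d :: "'i \<Rightarrow> real"
  assumes I: "finite I" and E: "E \<subseteq> (\<Union>i\<in>I. A i)" and d0: "\<And>i. i \<in> I \<Longrightarrow> 0 \<le> d i"
    and diam: "\<And>i x y. i \<in> I \<Longrightarrow> x \<in> A i \<Longrightarrow> y \<in> A i \<Longrightarrow> \<rho> x y \<le> ennreal (d i)"
    and \<delta>: "\<And>i. i \<in> I \<Longrightarrow> ennreal (d i) \<le> \<delta>"
  shows "hausdorff_pre \<rho> m \<delta> E \<le> ennreal (unit_ball_vol (real m) / 2 ^ m * (\<Sum>i\<in>I. d i ^ m))"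
proof -
  define c where "c = unit_ball_vol (real m) / 2 ^ m"
  have c: "0 \<le> c" by (simp add: c_def)
  define N where "N = card I"
  obtain g where "bij_betw g {0..<N} I" using ex_bij_betw_nat_finite[OF I] unfolding N_def by blast
  then have g: "inj_on g {..<N}" "g ` {..<N} = I" by (auto simp: bij_betw_def lessThan_atLeast0)
  define B where "B n = (if n < N then A (g n) else {})" for n
  have gI: "g n \<in> I" if "n < N" for n using g(2) that by auto
  have dB: "diam_wrt \<rho> (B n) \<le> ennreal (d (g n))" if "n < N" for n
    unfolding diam_wrt_def B_def using that diam[OF gI[OF that]] by (auto intro!: SUP_least)
  have B: "E \<subseteq> (\<Union>n. B n)"
  proof
    fix x assume "x \<in> E"
    then obtain i where "i \<in> I" "x \<in> A i" using E by blast
    moreover then obtain n where "n < N" "i = g n" using g(2) by auto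
    ultimately show "x \<in> (\<Union>n. B n)" by (auto simp: B_def intro!: exI[of _ n])
  qed
  have B\<delta>: "diam_wrt \<rho> (B n) \<le> \<delta>" for n
  proof (cases "n < N")
    case True
    show ?thesis by (rule order_trans[OF dB[OF True] \<delta>[OF gI[OF True]]])
  next
    case False
    then show ?thesis by (simp add: B_def diam_wrt_def bot_ennreal)
  qed
  let ?t = "\<lambda>n. if B n = {} then 0 else ennreal c * diam_wrt \<rho> (B n) ^ m"
  have "hausdorff_pre \<rho> m \<delta> E \<le> (\<Sum>n. ?t n)"
    unfolding hausdorff_pre_def c_def using B B\<delta> by (intro INF_lower) auto
  also have "\<dots> = (\<Sum>n<N. ?t n)" by (rule suminf_finite) (auto simp: B_def)
  also have "\<dots> \<le> (\<Sum>n<N. ennreal (c * d (g n) ^ m))"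
  proof (rule sum_mono)
    fix n assume n: "n \<in> {..<N}"
    have "ennreal c * diam_wrt \<rho> (B n) ^ m \<le> ennreal c * ennreal (d (g n)) ^ m"
      using n by (intro mult_left_mono power_mono dB) auto
    also have "\<dots> = ennreal (c * d (g n) ^ m)" using c d0[OF gI] n by (simp add: ennreal_power ennreal_mult)
    finally show "?t n \<le> ennreal (c * d (g n) ^ m)" by simp
  qed
  also have "\<dots> = ennreal (\<Sum>n<N. c * d (g n) ^ m)" using c d0[OF gI] by (intro sum_ennreal) auto
  also have "(\<Sum>n<N. c * d (g n) ^ m) = c * (\<Sum>i\<in>I. d i ^ m)"
    unfolding g(2)[symmetric] by (simp add: sum.reindex[OF g(1)] sum_distrib_left)
  finally show ?thesis by (simp add: c_def)
qed

lemma norm_le_coordinate_bound: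
  fixes x :: "'a::euclidean_space"
  assumes "\<And>b. b \<in> Basis \<Longrightarrow> \<bar>x \<bullet> b\<bar> \<le> C"
  shows "norm x \<le> real DIM('a) * C"
proof -
  have "norm x \<le> (\<Sum>b\<in>Basis. \<bar>x \<bullet> b\<bar>)" by (rule norm_le_l1)
  also have "\<dots> \<le> (\<Sum>b\<in>(Basis::'a set). C)" using assms by (rule sum_mono)
  finally show ?thesis by simp
qed

lemma normalized_direction:
  fixes v :: "'a::euclidean_space"
  assumes "v \<noteq> 0"
  obtains i t where "i \<in> Basis" "(t *\<^sub>R v) \<bullet> i = 1" "\<And>b. b \<in> Basis \<Longrightarrow> \<bar>(t *\<^sub>R v) \<bullet> b\<bar> \<le> 1"
proof -
  let ?m = "Max ((\<lambda>b. \<bar>v \<bullet> b\<bar>) ` Basis)"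
  have "?m \<in> (\<lambda>b. \<bar>v \<bullet> b\<bar>) ` Basis" by (rule Max_in) auto
  then obtain i where i: "?m = \<bar>v \<bullet> i\<bar>" "i \<in> Basis" by (rule imageE)
  have mx: "\<bar>v \<bullet> b\<bar> \<le> \<bar>v \<bullet> i\<bar>" if "b \<in> Basis" for b unfolding i(1)[symmetric] using that by (intro Max_ge) auto
  have "v \<bullet> i \<noteq> 0"
  proof
    assume "v \<bullet> i = 0"
    then have "\<bar>v \<bullet> b\<bar> \<le> 0" if "b \<in> Basis" for b using mx[OF that] by linarith
    then have "\<forall>b\<in>Basis. v \<bullet> b = 0" by simp
    then have "v = 0" by (simp only: euclidean_all_zero_iff)
    then show False using assms by contradiction
  qed
  then have pos: "0 < \<bar>v \<bullet> i\<bar>" by simp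
  show ?thesis
  proof (rule that[OF i(2)])
    show "((1 / (v \<bullet> i)) *\<^sub>R v) \<bullet> i = 1" using pos by simp
    show "\<bar>((1 / (v \<bullet> i)) *\<^sub>R v) \<bullet> b\<bar> \<le> 1" if "b \<in> Basis" for b
      using mx[OF that] pos by (simp add: abs_divide divide_le_eq_1)
  qed
qed

lemma norm_slope_map_le:
  fixes f :: "'a::euclidean_space \<Rightarrow> 'b::euclidean_space"
  assumes f: "cc_lipschitz_on L V K f" and x: "x \<in> good_points V K f M r \<epsilon>" and r: "0 < r" and M: "1 \<le> M"
  shows "norm (slope_map f r x w) \<le> real DIM('a) * L * norm w"
proof -
  have "slope_map f r x w = (\<Sum>b\<in>Basis. (w \<bullet> b) *\<^sub>R slope_map f r x b)"
    unfolding slope_map_def[of f r x w] by (intro sum.cong refl) (simp add: slope_map_Basis)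
  also have "norm \<dots> \<le> (\<Sum>b\<in>(Basis::'a set). norm w * L)"
  proof (rule sum_norm_le)
    fix b :: 'a assume b: "b \<in> Basis"
    show "norm ((w \<bullet> b) *\<^sub>R slope_map f r x b) \<le> norm w * L"
      using Basis_le_norm[OF b, of w] norm_slope_map_Basis[OF f x r M b] by (simp add: mult_mono)
  qed
  finally show ?thesis by (simp add: mult_ac)
qed

lemma power_card_bound:
  fixes \<kappa> :: real
  assumes \<kappa>: "0 < \<kappa>" "\<kappa> \<le> 1/4" and S: "finite S"
  shows "real (card (PiE S (\<lambda>_. {- \<lceil>2 / \<kappa>\<rceil>..\<lceil>2 / \<kappa>\<rceil>}))) \<le> (7 / \<kappa>) ^ card S"
proof -
  let ?Q = "\<lceil>2 / \<kappa>\<rceil>"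
  have "0 < 2 / \<kappa>" using \<kappa>(1) by simp
  then have Q: "0 \<le> ?Q" by linarith
  have "real (card {- ?Q..?Q}) = 2 * real_of_int ?Q + 1" using Q by simp
  also have "\<dots> \<le> 2 * (2 / \<kappa> + 1) + 1" 
    by (intro add_right_mono mult_left_mono of_int_ceiling_le_add_one) simp
  also have "\<dots> \<le> 7 / \<kappa>" using \<kappa> by (simp add: field_simps)
  finally have "real (card {- ?Q..?Q}) \<le> 7 / \<kappa>" .
  then have "real (card {- ?Q..?Q}) ^ card S \<le> (7 / \<kappa>) ^ card S" by (intro power_mono) auto
  then show ?thesis using S by (simp add: card_PiE prod_constant)
qed

lemma (in first_order_distribution) collapsed_ball_cover:
  fixes f :: "'a::euclidean_space \<Rightarrow> 'b"
  assumes f: "cc_lipschitz_on L V K f" and x: "x \<in> good_points V K f M r \<epsilon>" and r: "0 < r" and \<epsilon>: "0 \<le> \<epsilon>" "\<epsilon> \<le> 1"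
    and \<kappa>: "0 < \<kappa>" "\<kappa> \<le> 1/4" and M\<kappa>: "1 \<le> real M * \<kappa>"
    and v: "norm (slope_map f r x v) < \<kappa> * norm v"
    and C: "C = 2 * L * real DIM('a) + 3 + 2 * real DIM('a) + 3 * (real DIM('a))\<^sup>2 * L"
  obtains J :: "('a \<Rightarrow> int) set" and g where "finite J" "real (card J) \<le> (7 / \<kappa>) ^ (DIM('a) - 1)"
    "\<And>z. z \<in> K \<inter> cball x (3/4 * (real M * r)) \<Longrightarrow> g z \<in> J"
    "\<And>z z'. z \<in> K \<inter> cball x (3/4 * (real M * r)) \<Longrightarrow> z' \<in> K \<inter> cball x (3/4 * (real M * r)) \<Longrightarrow> g z = g z' \<Longrightarrow>
       cc_dist V (f z) (f z') \<le> ennreal (C * \<kappa> * (real M * r))"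
proof -
  let ?m = "real DIM('a)" and ?A = "slope_map f r x"
  have L: "0 \<le> L" using f by (simp add: cc_lipschitz_on_def)
  have m1: "1 \<le> ?m" by (simp add: Suc_leI)
  have "real M * \<kappa> \<le> real M * (1/4)" using \<kappa> by (intro mult_left_mono) auto
  then have M4: "4 \<le> real M" using M\<kappa> by linarith
  then have M: "1 \<le> M" by linarith
  have "v \<noteq> 0" using v by auto
  obtain i t where i: "i \<in> Basis" "(t *\<^sub>R v) \<bullet> i = 1" "\<And>b. b \<in> Basis \<Longrightarrow> \<bar>(t *\<^sub>R v) \<bullet> b\<bar> \<le> 1"
    using normalized_direction[OF \<open>v \<noteq> 0\<close>] by metis
  define v' where "v' = t *\<^sub>R v"
  have Av': "norm (?A v') \<le> \<kappa> * ?m"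
  proof -
    have "norm (?A v') = \<bar>t\<bar> * norm (?A v)" by (simp add: v'_def slope_map_scaleR)
    also have "\<dots> \<le> \<bar>t\<bar> * (\<kappa> * norm v)" using v by (intro mult_left_mono) auto
    also have "\<dots> = \<kappa> * norm v'" by (simp add: v'_def)
    also have "\<dots> \<le> \<kappa> * (?m * 1)" using \<kappa> i(3) by (intro mult_left_mono norm_le_coordinate_bound) (auto simp: v'_def)
    finally show ?thesis by simp
  qed
  define y where "y z = (z - x) /\<^sub>R r" for z
  define u where "u z = y z - (y z \<bullet> i) *\<^sub>R v'" for z
  define w where "w z = (\<Sum>b\<in>Basis. of_int \<lfloor>y z \<bullet> b\<rfloor> *\<^sub>R b)" for z
  define g where "g z = (\<lambda>b\<in>Basis - {i}. \<lfloor>(u z \<bullet> b) / (\<kappa> * real M)\<rfloor>)" for z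
  define J where "J = PiE (Basis - {i}) (\<lambda>_. {- \<lceil>2 / \<kappa>\<rceil>..\<lceil>2 / \<kappa>\<rceil>})"
  have \<kappa>M: "0 < \<kappa> * real M" using \<kappa> M4 by simp
  have yb: "\<bar>y z \<bullet> b\<bar> \<le> 3/4 * real M" if "z \<in> cball x (3/4 * (real M * r))" "b \<in> Basis" for z b
  proof -
    have "norm (z - x) \<le> 3/4 * (real M * r)" using that by (simp add: dist_norm norm_minus_commute)
    moreover have "norm (y z) = norm (z - x) / r" using r by (simp add: y_def divide_inverse mult.commute)
    ultimately have "norm (y z) \<le> 3/4 * real M" using r by (simp add: pos_divide_le_eq)
    then show ?thesis using Basis_le_norm[OF that(2), of "y z"] by linarith
  qed
  have ub: "\<bar>u z \<bullet> b\<bar> \<le> 3/2 * real M" if "z \<in> cball x (3/4 * (real M * r))" "b \<in> Basis" for z b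
  proof -
    have "\<bar>u z \<bullet> b\<bar> \<le> \<bar>y z \<bullet> b\<bar> + \<bar>y z \<bullet> i\<bar> * \<bar>v' \<bullet> b\<bar>"
      unfolding u_def by (simp add: inner_diff_left abs_mult[symmetric])
    also have "\<dots> \<le> 3/4 * real M + 3/4 * real M * 1"
      using yb[OF that] yb[OF that(1) i(1)] i(3)[OF that(2)] by (intro add_mono mult_mono) (auto simp: v'_def)
    finally show ?thesis by simp
  qed
  have wl: "w z \<in> lattice_box M" if "z \<in> cball x (3/4 * (real M * r))" for z
    unfolding w_def
  proof (rule lattice_boxI)
    fix b :: 'a assume b: "b \<in> Basis"
    have "\<bar>real_of_int \<lfloor>y z \<bullet> b\<rfloor>\<bar> \<le> real M" using yb[OF that b] M4 by linarith
    then show "\<bar>\<lfloor>y z \<bullet> b\<rfloor>\<bar> \<le> int M" by linarith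
  qed
  have wy: "norm (y z - w z) \<le> ?m" for z
  proof -
    have "norm (y z - w z) \<le> ?m * 1"
    proof (rule norm_le_coordinate_bound)
      fix b :: 'a assume "b \<in> Basis"
      then have "(y z - w z) \<bullet> b = y z \<bullet> b - of_int \<lfloor>y z \<bullet> b\<rfloor>" by (simp add: w_def inner_diff_left inner_sum_left_Basis)
      then show "\<bar>(y z - w z) \<bullet> b\<bar> \<le> 1" by linarith
    qed
    then show ?thesis by simp
  qed
  have ry: "r *\<^sub>R y z = z - x" for z using r by (simp add: y_def)
  show ?thesis
  proof (rule that[of J g])
    show "finite J" unfolding J_def by (intro finite_PiE) auto
    show "real (card J) \<le> (7 / \<kappa>) ^ (DIM('a) - 1)"
      using power_card_bound[OF \<kappa>, of "Basis - {i}"] i(1) by (simp add: J_def)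
    show "g z \<in> J" if z: "z \<in> K \<inter> cball x (3/4 * (real M * r))" for z
      unfolding g_def J_def
    proof (rule restrict_PiE_iff[THEN iffD2], rule ballI)
      fix b assume b: "b \<in> Basis - {i}"
      define s where "s = (u z \<bullet> b) / (\<kappa> * real M)"
      have "\<bar>u z \<bullet> b\<bar> \<le> 3/2 * real M" using ub z b by auto
      then have "\<bar>s\<bar> \<le> (3/2 * real M) / (\<kappa> * real M)" 
        unfolding s_def abs_divide abs_of_pos[OF \<kappa>M] using \<kappa>M by (intro divide_right_mono) auto
      also have "\<dots> = 3/2 / \<kappa>" using M4 by simp
      finally have "\<bar>s\<bar> \<le> 3/2 / \<kappa>" .
      moreover have "3/2 / \<kappa> + 1 \<le> 2 / \<kappa>" using \<kappa> by (simp add: field_simps)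
      ultimately have "- (2 / \<kappa>) \<le> s - 1" "s \<le> 2 / \<kappa>" by linarith+
      then show "\<lfloor>(u z \<bullet> b) / (\<kappa> * real M)\<rfloor> \<in> {- \<lceil>2 / \<kappa>\<rceil>..\<lceil>2 / \<kappa>\<rceil>}"
        unfolding s_def[symmetric] by (simp, linarith)
    qed
    fix z z' assume z: "z \<in> K \<inter> cball x (3/4 * (real M * r))" and z': "z' \<in> K \<inter> cball x (3/4 * (real M * r))" and eq: "g z = g z'"
    have du: "norm (u z - u z') \<le> ?m * (\<kappa> * real M)"
    proof (rule norm_le_coordinate_bound)
      fix b :: 'a assume b: "b \<in> Basis"
      show "\<bar>(u z - u z') \<bullet> b\<bar> \<le> \<kappa> * real M"
      proof (cases "b = i")
        case True
        have "u z'' \<bullet> i = 0" for z'' using i(2) by (simp add: u_def v'_def inner_diff_left)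
        then show ?thesis using True \<kappa>M by (simp add: inner_diff_left)
      next
        case False
        then have "\<lfloor>(u z \<bullet> b) / (\<kappa> * real M)\<rfloor> = \<lfloor>(u z' \<bullet> b) / (\<kappa> * real M)\<rfloor>"
          using fun_cong[OF eq, of b] b by (simp add: g_def)
        then have "\<bar>(u z \<bullet> b) / (\<kappa> * real M) - (u z' \<bullet> b) / (\<kappa> * real M)\<bar> \<le> 1" by linarith
        then have "\<bar>((u z - u z') \<bullet> b) / (\<kappa> * real M)\<bar> \<le> 1" by (simp add: diff_divide_distrib inner_diff_left)
        then show ?thesis unfolding abs_divide abs_of_pos[OF \<kappa>M] using \<kappa>M by (simp only: pos_divide_le_eq mult_1)
      qed
    qed
    have yd: "y z - y z' = ((y z - y z') \<bullet> i) *\<^sub>R v' + (u z - u z')" by (simp add: u_def inner_diff_left algebra_simps)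
    have Ay: "norm (?A (y z - y z')) \<le> real M * \<kappa> * (2 * ?m + ?m\<^sup>2 * L)"
    proof -
      have "norm (?A (y z - y z')) \<le> \<bar>(y z - y z') \<bullet> i\<bar> * norm (?A v') + norm (?A (u z - u z'))"
        by (subst yd) (simp add: slope_map_add slope_map_scaleR norm_triangle_ineq[THEN order_trans])
      also have "\<dots> \<le> (2 * real M) * (\<kappa> * ?m) + ?m * L * (?m * (\<kappa> * real M))"
      proof (rule add_mono)
        have "\<bar>(y z - y z') \<bullet> i\<bar> \<le> 2 * real M" using yb[of z i] yb[of z' i] z z' i(1) by (simp add: inner_diff_left)
        then show "\<bar>(y z - y z') \<bullet> i\<bar> * norm (?A v') \<le> (2 * real M) * (\<kappa> * ?m)" using Av' by (intro mult_mono) auto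
        show "norm (?A (u z - u z')) \<le> ?m * L * (?m * (\<kappa> * real M))"
          by (rule order_trans[OF norm_slope_map_le[OF f x r M] mult_left_mono[OF du]]) (use L in simp)
      qed
      also have "\<dots> = real M * \<kappa> * (2 * ?m + ?m\<^sup>2 * L)" by (simp add: algebra_simps power2_eq_square)
      finally show ?thesis .
    qed
    have Aw: "norm (?A (w z - w z')) \<le> real M * \<kappa> * (2 * ?m + ?m\<^sup>2 * L) + 2 * ?m\<^sup>2 * L"
    proof -
      define e where "e = (y z' - w z') - (y z - w z)"
      have ne: "norm e \<le> ?m + ?m" unfolding e_def by (rule order_trans[OF norm_triangle_ineq4 add_mono[OF wy wy]])
      have "norm (?A e) \<le> ?m * L * (?m + ?m)"
        by (rule order_trans[OF norm_slope_map_le[OF f x r M] mult_left_mono[OF ne]]) (use L in simp)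
      moreover have "w z - w z' = (y z - y z') + e" by (simp add: e_def)
      then have "norm (?A (w z - w z')) \<le> norm (?A (y z - y z')) + norm (?A e)"
        by (simp add: slope_map_add norm_triangle_ineq)
      ultimately show ?thesis using Ay by (simp add: power2_eq_square algebra_simps)
    qed
    let ?q = "x + r *\<^sub>R w z" and ?q' = "x + r *\<^sub>R w z'"
    have wz: "w z \<in> lattice_box M" "w z' \<in> lattice_box M" using wl z z' by auto
    have K: "z \<in> K" "z' \<in> K" "?q \<in> K" "?q' \<in> K" using z z' x wz by (auto simp: good_points_def)
    have aff: "norm (f ?q - f x - r *\<^sub>R ?A (w z)) \<le> \<epsilon> * r" "norm (f ?q' - f x - r *\<^sub>R ?A (w z')) \<le> \<epsilon> * r"
      and cc: "real_cc_dist V (f ?q) (f ?q') \<le> norm (f ?q' - f ?q) + \<epsilon> * r"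
      using x wz by (auto simp: good_points_def)
    have Ad: "?A (w z) = ?A (w z') + ?A (w z - w z')" using slope_map_add[of f r x "w z'" "w z - w z'"] by simp
    have "f ?q - f ?q' = (f ?q - f x - r *\<^sub>R ?A (w z)) - (f ?q' - f x - r *\<^sub>R ?A (w z')) + r *\<^sub>R ?A (w z - w z')"
      unfolding Ad by (simp add: algebra_simps)
    then have "norm (f ?q - f ?q') \<le> norm ((f ?q - f x - r *\<^sub>R ?A (w z)) - (f ?q' - f x - r *\<^sub>R ?A (w z'))) + norm (r *\<^sub>R ?A (w z - w z'))"
      by (metis norm_triangle_ineq)
    also have "\<dots> \<le> (\<epsilon> * r + \<epsilon> * r) + r * norm (?A (w z - w z'))"
      using r by (intro add_mono order_trans[OF norm_triangle_ineq4 add_mono[OF aff]]) auto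
    finally have nq: "norm (f ?q' - f ?q) \<le> 2 * \<epsilon> * r + r * norm (?A (w z - w z'))" by (simp add: norm_minus_commute)
    have dz: "dist z ?q \<le> ?m * r" "dist ?q' z' \<le> ?m * r"
    proof -
      have d: "dist z (x + r *\<^sub>R w z) \<le> ?m * r" for z
      proof -
        have "z - (x + r *\<^sub>R w z) = r *\<^sub>R (y z - w z)" by (simp add: scaleR_diff_right ry)
        then have "dist z (x + r *\<^sub>R w z) = r * norm (y z - w z)" using r by (simp add: dist_norm)
        also have "\<dots> \<le> r * ?m" using wy r by (intro mult_left_mono) auto
        finally show ?thesis by (simp add: mult.commute)
      qed
      show "dist z ?q \<le> ?m * r" by (rule d)
      show "dist ?q' z' \<le> ?m * r" unfolding dist_commute[of ?q' z'] by (rule d)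
    qed
    have "real_cc_dist V (f z) (f z') \<le> real_cc_dist V (f z) (f ?q) + (real_cc_dist V (f ?q) (f ?q') + real_cc_dist V (f ?q') (f z'))"
      using real_cc_dist_triangle[OF f K(1,3,2)] real_cc_dist_triangle[OF f K(3,4,2)] by linarith
    also have "\<dots> \<le> L * (?m * r) + ((3 * \<epsilon> * r + r * norm (?A (w z - w z'))) + L * (?m * r))"
    proof (intro add_mono)
      show "real_cc_dist V (f z) (f ?q) \<le> L * (?m * r)"
        using cc_lipschitz_on_real(2)[OF f K(1,3)] mult_left_mono[OF dz(1) L] by linarith
      show "real_cc_dist V (f ?q') (f z') \<le> L * (?m * r)"
        using cc_lipschitz_on_real(2)[OF f K(4,2)] mult_left_mono[OF dz(2) L] by linarith
      show "real_cc_dist V (f ?q) (f ?q') \<le> 3 * \<epsilon> * r + r * norm (?A (w z - w z'))" using cc nq by linarith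
    qed
    also have "\<dots> \<le> L * (?m * r) + ((3 * \<epsilon> * r + r * (real M * \<kappa> * (2 * ?m + ?m\<^sup>2 * L) + 2 * ?m\<^sup>2 * L)) + L * (?m * r))"
      using Aw r by (intro add_left_mono add_right_mono mult_left_mono) auto
    also have "\<dots> = r * (real M * \<kappa> * (2 * ?m + ?m\<^sup>2 * L) + (3 * \<epsilon> + (2 * L * ?m + 2 * ?m\<^sup>2 * L)))"
      by (simp add: algebra_simps)
    also have "\<dots> \<le> r * (real M * \<kappa> * (2 * ?m + ?m\<^sup>2 * L) + (real M * \<kappa>) * (3 + (2 * L * ?m + 2 * ?m\<^sup>2 * L)))"
    proof (intro mult_left_mono add_left_mono)
      have "3 * \<epsilon> + (2 * L * ?m + 2 * ?m\<^sup>2 * L) \<le> 1 * (3 + (2 * L * ?m + 2 * ?m\<^sup>2 * L))" using \<epsilon> by simp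
      also have "\<dots> \<le> (real M * \<kappa>) * (3 + (2 * L * ?m + 2 * ?m\<^sup>2 * L))" using M\<kappa> L by (intro mult_right_mono) auto
      finally show "3 * \<epsilon> + (2 * L * ?m + 2 * ?m\<^sup>2 * L) \<le> (real M * \<kappa>) * (3 + (2 * L * ?m + 2 * ?m\<^sup>2 * L))" .
    qed (use r in auto)
    also have "\<dots> = C * \<kappa> * (real M * r)" by (simp add: C algebra_simps)
    finally show "cc_dist V (f z) (f z') \<le> ennreal (C * \<kappa> * (real M * r))"
      unfolding cc_lipschitz_on_real(1)[OF f K(1,2)] by (rule ennreal_leI)
  qed
qed

lemma frame_imp_first_order_distribution:
  fixes X :: "nat \<Rightarrow> 'b::euclidean_space \<Rightarrow> 'b"
  assumes X: "\<And>l. l < k \<Longrightarrow> class_C_on 1 UNIV (X l)" and V: "spans_on UNIV k X V" and dimV: "\<And>p. dim (V p) = k"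
  shows "first_order_distribution V"
proof
  have Vq: "V q = span ((\<lambda>l. X l q) ` {..<k})" for q using V by (auto simp: spans_on_def)
  show "subspace (V p)" for p unfolding Vq by simp
  fix p \<zeta> assume \<zeta>: "\<forall>v\<in>V p. \<zeta> \<bullet> v = 0"
  obtain z where z: "dual_family k z (\<lambda>l. X l p)"
    using dim_span_imp_dual_family[of "\<lambda>l. X l p" k] dimV[of p] Vq by metis
  let ?D = "\<lambda>l. frechet_derivative (X l) (at p)"
  have D: "(X l has_derivative ?D l) (at p)" if "l < k" for l
    using X[OF that] frechet_derivative_works by (auto simp: class_C_on_1_iff)
  have "X l p \<in> V p" if "l < k" for l using that unfolding Vq by (auto intro: span_base)
  then have "annihilates_to_first_order V p \<zeta> (annihilator_correction k ?D z \<zeta>)"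
    using \<zeta> by (intro annihilates_to_first_order_frame[OF open_UNIV UNIV_I V D z]) auto
  moreover have "bounded_bilinear (annihilator_correction k ?D z \<zeta>)"
    using D by (intro bounded_bilinear_annihilator_correction has_derivative_bounded_linear)
  ultimately show "\<exists>B. bounded_bilinear B \<and> annihilates_to_first_order V p \<zeta> B" by blast
qed

lemma finite_separated_subset:
  fixes K :: "'a::metric_space set"
  assumes "compact K" "Y \<subseteq> K" "0 < \<tau>" and sep: "\<And>y y'. y \<in> Y \<Longrightarrow> y' \<in> Y \<Longrightarrow> y \<noteq> y' \<Longrightarrow> 2 * \<tau> \<le> dist y y'"
  shows "finite Y"
proof -
  obtain T where T: "finite T" "K \<subseteq> (\<Union>t\<in>T. ball t \<tau>)"
    using compactE_image[OF assms(1), of K "\<lambda>t. ball t \<tau>"] assms(3) by (metis centre_in_ball UN_I open_ball subsetI)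
  have "\<exists>t\<in>T. dist t y < \<tau>" if "y \<in> Y" for y
  proof -
    have "y \<in> (\<Union>t\<in>T. ball t \<tau>)" using T(2) assms(2) that by blast
    then show ?thesis by simp
  qed
  then obtain g where g: "\<And>y. y \<in> Y \<Longrightarrow> g y \<in> T \<and> dist (g y) y < \<tau>" by metis
  have "inj_on g Y"
  proof (rule inj_onI, rule ccontr)
    fix y y' assume y: "y \<in> Y" "y' \<in> Y" "g y = g y'" "y \<noteq> y'"
    have "dist y y' \<le> dist (g y) y + dist (g y) y'" by (rule dist_triangle3)
    also have "\<dots> < \<tau> + \<tau>" using g[OF y(1)] g[OF y(2)] y(3) by (intro add_strict_mono) auto
    finally show False using sep[OF y(1,2,4)] by simp
  qed
  moreover have "g ` Y \<subseteq> T" using g by auto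
  ultimately show ?thesis using T(1) by (meson finite_imageD finite_subset)
qed

lemma disjoint_cballs_card_le:
  fixes Y :: "'a::euclidean_space set"
  assumes fin: "finite Y" and disj: "disjoint_family_on (\<lambda>y. cball y \<tau>) Y" and \<tau>: "0 < \<tau>"
    and sub: "\<And>y. y \<in> Y \<Longrightarrow> cball y \<tau> \<subseteq> G" and G: "G \<in> sets borel" "emeasure lborel G \<le> ennreal c" and c: "0 \<le> c"
  shows "real (card Y) * (unit_ball_vol (real DIM('a)) * \<tau> ^ DIM('a)) \<le> c"
proof -
  let ?b = "unit_ball_vol (real DIM('a)) * \<tau> ^ DIM('a)"
  have b: "0 \<le> ?b" using \<tau> by simp
  have "ennreal (real (card Y) * ?b) = (\<Sum>y\<in>Y. emeasure lborel (cball y \<tau>))"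
    using \<tau> b by (simp add: emeasure_cball ennreal_mult'' ennreal_of_nat_eq_real_of_nat)
  also have "\<dots> = emeasure lborel (\<Union>y\<in>Y. cball y \<tau>)"
    using fin disj by (intro sum_emeasure) auto
  also have "\<dots> \<le> emeasure lborel G" using sub G(1) by (intro emeasure_mono) auto
  also have "\<dots> \<le> ennreal c" by (rule G(2))
  finally show ?thesis using c by (simp add: ennreal_le_iff)
qed

theorem (in first_order_distribution) hausdorff_measure_lipschitz_image_eq_0:
  fixes f :: "'a::euclidean_space \<Rightarrow> 'b"
  assumes X: "\<And>l. l < k \<Longrightarrow> class_C_on 1 UNIV (X l)" and Vsp: "spans_on UNIV k X V" and dimV: "\<And>p. dim (V p) = k"
    and noninv: "h_noninvolutive h V" and h: "h \<le> DIM('a)"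
    and f: "cc_lipschitz_on L V K f" and K: "compact K"
  shows "hausdorff_measure (cc_dist V) DIM('a) (f ` K) = 0"
proof -
  define m where "m = DIM('a)"
  have m: "1 \<le> m" by (simp add: m_def Suc_leI)
  have L: "0 \<le> L" using f by (simp add: cc_lipschitz_on_def)
  define \<omega> where "\<omega> = unit_ball_vol (real m)"
  have \<omega>: "0 < \<omega>" by (simp add: \<omega>_def)
  define C where "C = 2 * L * real DIM('a) + 3 + 2 * real DIM('a) + 3 * (real DIM('a))\<^sup>2 * L"
  have C: "0 < C" unfolding C_def using L by (intro add_pos_nonneg add_nonneg_pos) auto
  define vK where "vK = measure lborel K"
  have vK: "emeasure lborel K = ennreal vK" "0 \<le> vK"
    using emeasure_compact_finite[OF K] by (simp_all add: vK_def emeasure_eq_ennreal_measure less_top)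
  define C0 where "C0 = (vK + 1) * (7 ^ (m - 1) * (8 * C) ^ m)"
  define C2 where "C2 = 2 * (10 * L) ^ m"
  have C02: "0 \<le> C0" "0 \<le> C2" using vK C L by (auto simp: C0_def C2_def)
  have pre: "hausdorff_pre (cc_dist V) m \<delta> (f ` K) \<le> ennreal t" if \<delta>: "0 < \<delta>" and t: "0 < t" for \<delta> t
  proof -
    obtain d where d: "0 < d" "ennreal d \<le> \<delta>"
    proof -
      obtain b where "0 < b" "b < \<delta>" using dense[OF \<delta>] by blast
      then show ?thesis using that[of "enn2real b"] by (cases b) auto
    qed
    define q where "q = (C0 + C2) / 2 ^ m"
    have q: "0 \<le> q" using C02 by (simp add: q_def)
    define \<kappa> where "\<kappa> = min (1/4) (t / (q + 1))"
    have "0 < t / (q + 1)" using t q by simp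
    then have \<kappa>: "0 < \<kappa>" "\<kappa> \<le> 1/4" "\<kappa> \<le> t / (q + 1)" unfolding \<kappa>_def by linarith+
    have q\<kappa>: "q * \<kappa> \<le> t"
    proof -
      have "q * \<kappa> \<le> (q + 1) * (t / (q + 1))" using q \<kappa>(1,3) by (intro mult_mono) auto
      also have "\<dots> = t" using q by simp
      finally show ?thesis .
    qed
    define e1 where "e1 = min \<kappa> (d / (C + 10 * L))"
    have e1: "0 < e1" "e1 \<le> \<kappa>" using \<kappa> d C L by (auto simp: e1_def intro!: divide_pos_pos add_pos_nonneg)
    have e1d: "(C + 10 * L) * e1 \<le> d"
    proof -
      have "(C + 10 * L) * e1 \<le> (C + 10 * L) * (d / (C + 10 * L))" using C L by (intro mult_left_mono) (auto simp: e1_def)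
      also have "\<dots> = d" using C L by (simp add: add_pos_nonneg less_imp_neq[THEN not_sym])
      finally show ?thesis .
    qed
    obtain G dG where G: "open G" "emeasure lborel (G - K) < ennreal e1" "0 < dG" "(\<Union>x\<in>K. ball x dG) \<subseteq> G"
      using compact_open_neighbourhood_small[OF K e1(1)] by metis
    define e2 where "e2 = min e1 dG"
    have e2: "0 < e2" "e2 \<le> e1" "e2 \<le> dG" using e1 G by (auto simp: e2_def)
    obtain M r \<epsilon> B where Mr: "1 \<le> M" "1 / real M < e2" "0 < r" "real M * r < e2" and \<epsilon>: "0 \<le> \<epsilon>" "\<epsilon> < e2"
      and B: "B \<in> sets borel" "emeasure lborel B < ennreal e2"
      and good: "\<And>x. x \<in> K - B \<Longrightarrow> x \<in> good_points V K f M r \<epsilon> \<and> (\<exists>v. norm (slope_map f r x v) < \<kappa> * norm v)"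
      using collapsed_at_small_scale[OF X Vsp dimV noninv h f K \<kappa>(1) e2(1)] by blast
    have M\<kappa>: "1 \<le> real M * \<kappa>"
    proof -
      have "1 / real M \<le> \<kappa>" using Mr(2) e2 e1 by linarith
      then show ?thesis using Mr(1) by (simp add: pos_divide_le_eq mult.commute)
    qed
    define \<tau> where "\<tau> = real M * r / 8"
    have \<tau>: "0 < \<tau>" "8 * \<tau> < e2" using Mr by (auto simp: \<tau>_def)
    have \<epsilon>1: "\<epsilon> \<le> 1" using \<epsilon>(2) e2 e1 \<kappa>(2) by linarith
    obtain Y where Y: "countable Y" "Y \<subseteq> K" "pairwise (\<lambda>y y'. disjnt (cball y \<tau>) (cball y' \<tau>)) Y" "K \<subseteq> (\<Union>y\<in>Y. cball y (5 * \<tau>))"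
    proof (rule Vitali_covering_lemma_cballs[where S = K and K = K and a = "\<lambda>x. x" and r = "\<lambda>_. \<tau>" and B = \<tau>])
      show "K \<subseteq> (\<Union>i\<in>K. cball i \<tau>)" using \<tau>(1) by force
    qed (use \<tau>(1) in auto)
    have disj: "disjoint_family_on (\<lambda>y. cball y \<tau>) Y"
      using Y(3) by (auto simp: disjoint_family_on_def pairwise_def disjnt_def)
    have finY: "finite Y"
    proof (rule finite_separated_subset[OF K Y(2) \<tau>(1)])
      fix y y' assume y: "y \<in> Y" "y' \<in> Y" "y \<noteq> y'"
      show "2 * \<tau> \<le> dist y y'"
      proof (rule ccontr)
        assume "\<not> 2 * \<tau> \<le> dist y y'"
        then have "midpoint y y' \<in> cball y \<tau> \<inter> cball y' \<tau>"
          by (simp add: dist_midpoint)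
        moreover have "cball y \<tau> \<inter> cball y' \<tau> = {}" using disj y unfolding disjoint_family_on_def by blast
        ultimately show False by blast
      qed
    qed
    have YG: "cball y \<tau> \<subseteq> G" if "y \<in> Y" for y
    proof -
      have "cball y \<tau> \<subseteq> ball y dG" using \<tau> e2 by auto
      then show ?thesis using G(4) Y(2) that by blast
    qed
    have GKb: "G - K \<in> sets borel" using G(1) K by (intro sets.Diff borel_open borel_compact)
    define bad where "bad = {y\<in>Y. cball y \<tau> \<inter> (K - B) = {}}"
    have cardY: "real (card Y) * (\<omega> * \<tau> ^ m) \<le> vK + 1"
      unfolding \<omega>_def m_def
    proof (rule disjoint_cballs_card_le[OF finY disj \<tau>(1) YG])
      have "emeasure lborel G \<le> emeasure lborel (K \<union> (G - K))"
        using G(1) K by (intro emeasure_mono) (auto intro: borel_compact)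
      also have "\<dots> \<le> emeasure lborel K + emeasure lborel (G - K)"
        using G(1) K by (intro emeasure_subadditive) (auto intro: borel_compact)
      also have "\<dots> \<le> ennreal vK + ennreal 1"
      proof (rule add_mono)
        have "emeasure lborel (G - K) \<le> ennreal e1" using G(2) by simp
        also have "\<dots> \<le> ennreal 1" using e1 \<kappa> by (intro ennreal_leI) linarith
        finally show "emeasure lborel (G - K) \<le> ennreal 1" .
      qed (simp add: vK)
      also have "\<dots> = ennreal (vK + 1)" using vK by (simp add: ennreal_plus)
      finally show "emeasure lborel G \<le> ennreal (vK + 1)" .
    qed (use G vK in auto)
    have cardbad: "real (card bad) * (\<omega> * \<tau> ^ m) \<le> 2 * e1"
      unfolding \<omega>_def m_def
    proof (rule disjoint_cballs_card_le[OF _ _ \<tau>(1), where G = "B \<union> (G - K)"])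
      show "finite bad" using finY by (simp add: bad_def)
      show "disjoint_family_on (\<lambda>y. cball y \<tau>) bad" using disj by (auto simp: bad_def disjoint_family_on_def)
      show "cball y \<tau> \<subseteq> B \<union> (G - K)" if "y \<in> bad" for y using YG[of y] that by (auto simp: bad_def)
      show "B \<union> (G - K) \<in> sets borel" using B(1) GKb by (rule sets.Un)
      have "emeasure lborel (B \<union> (G - K)) \<le> emeasure lborel B + emeasure lborel (G - K)"
        using B(1) GKb by (intro emeasure_subadditive) simp_all
      also have "\<dots> \<le> ennreal e1 + ennreal e1"
      proof (rule add_mono)
        have "emeasure lborel B \<le> ennreal e2" using B(2) by simp
        also have "\<dots> \<le> ennreal e1" using e2 by (intro ennreal_leI)
        finally show "emeasure lborel B \<le> ennreal e1" .
      qed (use G(2) in simp)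
      also have "\<dots> = ennreal (2 * e1)" using e1 by (simp add: ennreal_plus[symmetric] del: ennreal_plus)
      finally show "emeasure lborel (B \<union> (G - K)) \<le> ennreal (2 * e1)" .
    qed (use e1 in auto)
    define P where "P = 7 ^ (m - 1) * (8 * C) ^ m * \<kappa> * \<tau> ^ m"
    define Q where "Q = (10 * L) ^ m * \<tau> ^ m"
    have P0: "0 \<le> P" and Q0: "0 \<le> Q" using C \<kappa> \<tau> L by (auto simp: P_def Q_def)
    define pieces where "pieces y J g D \<longleftrightarrow> finite (J :: ('a \<Rightarrow> int) set) \<and> (\<forall>z\<in>K \<inter> cball y (5 * \<tau>). g z \<in> J) \<and>
        (\<forall>z\<in>K \<inter> cball y (5 * \<tau>). \<forall>z'\<in>K \<inter> cball y (5 * \<tau>). g z = g z' \<longrightarrow> cc_dist V (f z) (f z') \<le> ennreal D) \<and>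
        0 \<le> D \<and> D \<le> d \<and> real (card J) * D ^ m \<le> (if y \<in> bad then Q else P)" for y J g D
    have "\<exists>J g D. pieces y J g D" if y: "y \<in> Y" for y
    proof (cases "y \<in> bad")
      case True
      have "cc_dist V (f z) (f z') \<le> ennreal (10 * L * \<tau>)" if z: "z \<in> K \<inter> cball y (5 * \<tau>)" "z' \<in> K \<inter> cball y (5 * \<tau>)" for z z'
      proof -
        have "dist z z' \<le> dist y z + dist y z'" by (rule dist_triangle3)
        then have "dist z z' \<le> 10 * \<tau>" using z by simp
        then have "L * dist z z' \<le> L * (10 * \<tau>)" using L by (rule mult_left_mono)
        moreover have "cc_dist V (f z) (f z') \<le> ennreal (L * dist z z')" using f z unfolding cc_lipschitz_on_def by blast
        ultimately show ?thesis by (simp add: mult_ac order_trans[OF _ ennreal_leI])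
      qed
      moreover have "10 * L * \<tau> \<le> d"
      proof -
        have "10 * L * \<tau> \<le> 10 * L * e1" using \<tau> e2 L by (intro mult_left_mono) auto
        also have "\<dots> \<le> (C + 10 * L) * e1" using C e1 by (intro mult_right_mono) auto
        finally show ?thesis using e1d by linarith
      qed
      moreover have "real (card {undefined :: 'a \<Rightarrow> int}) * (10 * L * \<tau>) ^ m \<le> Q" by (simp add: Q_def power_mult_distrib)
      moreover have "0 \<le> 10 * L * \<tau>" using L \<tau> by simp
      ultimately have "pieces y {undefined} (\<lambda>_. undefined) (10 * L * \<tau>)"
        unfolding pieces_def if_P[OF True] by blast
      then show ?thesis by blast
    next
      case False
      then obtain x where "x \<in> cball y \<tau> \<inter> (K - B)" using y unfolding bad_def by blast
      then have x: "dist y x \<le> \<tau>" "x \<in> K - B" by auto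
      obtain v where gx: "x \<in> good_points V K f M r \<epsilon>" and v: "norm (slope_map f r x v) < \<kappa> * norm v" using good[OF x(2)] by blast
      obtain J :: "('a \<Rightarrow> int) set" and g where J: "finite J" "real (card J) \<le> (7 / \<kappa>) ^ (DIM('a) - 1)"
        "\<And>z. z \<in> K \<inter> cball x (3/4 * (real M * r)) \<Longrightarrow> g z \<in> J"
        "\<And>z z'. z \<in> K \<inter> cball x (3/4 * (real M * r)) \<Longrightarrow> z' \<in> K \<inter> cball x (3/4 * (real M * r)) \<Longrightarrow> g z = g z' \<Longrightarrow>
           cc_dist V (f z) (f z') \<le> ennreal (C * \<kappa> * (real M * r))"
        using collapsed_ball_cover[OF f gx Mr(3) \<epsilon>(1) \<epsilon>1 \<kappa>(1,2) M\<kappa> v C_def] by blast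
      have sub: "z \<in> K \<inter> cball x (3/4 * (real M * r))" if "z \<in> K \<inter> cball y (5 * \<tau>)" for z
      proof -
        have "dist x z \<le> dist y x + dist y z" by (rule dist_triangle3)
        also have "\<dots> \<le> 3/4 * (real M * r)" using x(1) that by (simp add: \<tau>_def)
        finally show ?thesis using that by simp
      qed
      let ?D = "C * \<kappa> * (real M * r)"
      have "?D \<le> d"
      proof -
        have "?D \<le> C * 1 * e1" using C \<kappa> Mr e2 by (intro mult_mono) auto
        also have "\<dots> \<le> (C + 10 * L) * e1" using L e1 by (simp add: distrib_right)
        finally show ?thesis using e1d by linarith
      qed
      moreover have "real (card J) * ?D ^ m \<le> P"
      proof -
        have Deq: "?D = (8 * C) * \<kappa> * \<tau>" by (simp add: \<tau>_def)
        have "real (card J) * ?D ^ m \<le> (7 / \<kappa>) ^ (m - 1) * ?D ^ m"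
          using J(2) C \<kappa> Mr by (intro mult_right_mono) (auto simp: m_def)
        also have "\<dots> = P"
        proof -
          obtain m' where m': "m = Suc m'" using m by (cases m) auto
          show ?thesis unfolding Deq P_def m' using \<kappa>(1) by (simp add: power_mult_distrib power_divide)
        qed
        finally show ?thesis .
      qed
      moreover have "0 \<le> ?D" using C \<kappa> Mr by simp
      ultimately have "pieces y J g ?D"
        unfolding pieces_def if_not_P[OF False] using J sub by blast
      then show ?thesis by blast
    qed
    then obtain J g D where JgD: "\<And>y. y \<in> Y \<Longrightarrow> pieces y (J y) (g y) (D y)" by metis
    have J: "finite (J y)" "z \<in> K \<inter> cball y (5 * \<tau>) \<Longrightarrow> g y z \<in> J y"
      "z \<in> K \<inter> cball y (5 * \<tau>) \<Longrightarrow> z' \<in> K \<inter> cball y (5 * \<tau>) \<Longrightarrow> g y z = g y z' \<Longrightarrow> cc_dist V (f z) (f z') \<le> ennreal (D y)"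
      "0 \<le> D y" "D y \<le> d" "real (card (J y)) * D y ^ m \<le> (if y \<in> bad then Q else P)" if "y \<in> Y" for y z z'
      using JgD[OF that] unfolding pieces_def by blast+
    have "hausdorff_pre (cc_dist V) m \<delta> (f ` K) \<le> ennreal (unit_ball_vol (real m) / 2 ^ m * (\<Sum>p\<in>Sigma Y J. D (fst p) ^ m))"
    proof (rule hausdorff_pre_le_finite_cover[where A = "\<lambda>p. f ` {z \<in> K \<inter> cball (fst p) (5 * \<tau>). g (fst p) z = snd p}"])
      show "finite (Sigma Y J)" using finY J(1) by blast
      show "f ` K \<subseteq> (\<Union>p\<in>Sigma Y J. f ` {z \<in> K \<inter> cball (fst p) (5 * \<tau>). g (fst p) z = snd p})"
      proof
        fix x assume "x \<in> f ` K"
        then obtain z where z: "z \<in> K" "x = f z" by blast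
        then obtain y where y: "y \<in> Y" "z \<in> cball y (5 * \<tau>)" using Y(4) by blast
        then have "(y, g y z) \<in> Sigma Y J" using J(2)[OF y(1), of z] z by auto
        then show "x \<in> (\<Union>p\<in>Sigma Y J. f ` {z \<in> K \<inter> cball (fst p) (5 * \<tau>). g (fst p) z = snd p})"
          using z y by (intro UN_I[of "(y, g y z)"]) auto
      qed
      show "ennreal (D (fst p)) \<le> \<delta>" if "p \<in> Sigma Y J" for p
      proof -
        have "D (fst p) \<le> d" using J(5) that by auto
        then show ?thesis using d(2) by (meson ennreal_leI order_trans)
      qed
    qed (use J(3,4) in auto)
    also have "(\<Sum>p\<in>Sigma Y J. D (fst p) ^ m) = (\<Sum>y\<in>Y. real (card (J y)) * D y ^ m)"
      using finY J(1) by (subst sum.Sigma[symmetric, of Y J "\<lambda>y j. D y ^ m", unfolded case_prod_unfold]) auto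
    also have "unit_ball_vol (real m) / 2 ^ m * (\<Sum>y\<in>Y. real (card (J y)) * D y ^ m) \<le> t"
    proof -
      have "(\<Sum>y\<in>Y. real (card (J y)) * D y ^ m) \<le> (\<Sum>y\<in>Y. if y \<in> bad then Q else P)" by (intro sum_mono J(6))
      also have "\<dots> \<le> (\<Sum>y\<in>Y. P + (if y \<in> bad then Q else 0))" using P0 by (intro sum_mono) auto
      also have "\<dots> = real (card Y) * P + real (card bad) * Q"
      proof -
        have "(\<Sum>y\<in>Y. if y \<in> bad then Q else 0) = (\<Sum>y\<in>bad. Q)"
          using finY by (intro sum.mono_neutral_cong_right) (auto simp: bad_def)
        then show ?thesis by (simp add: sum.distrib)
      qed
      finally have "\<omega> * (\<Sum>y\<in>Y. real (card (J y)) * D y ^ m) \<le> \<omega> * (real (card Y) * P + real (card bad) * Q)"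
        using \<omega> by (intro mult_left_mono) auto
      also have "\<dots> = (real (card Y) * (\<omega> * \<tau> ^ m)) * (7 ^ (m - 1) * (8 * C) ^ m * \<kappa>) + (real (card bad) * (\<omega> * \<tau> ^ m)) * (10 * L) ^ m"
        by (simp add: P_def Q_def algebra_simps)
      also have "\<dots> \<le> (vK + 1) * (7 ^ (m - 1) * (8 * C) ^ m * \<kappa>) + (2 * e1) * (10 * L) ^ m"
        using C \<kappa> L by (intro add_mono mult_right_mono cardY cardbad) auto
      also have "\<dots> \<le> (vK + 1) * (7 ^ (m - 1) * (8 * C) ^ m * \<kappa>) + (2 * \<kappa>) * (10 * L) ^ m"
        using e1 L by (intro add_left_mono mult_right_mono) auto
      also have "\<dots> = (C0 + C2) * \<kappa>" by (simp add: C0_def C2_def algebra_simps)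
      finally have "\<omega> * (\<Sum>y\<in>Y. real (card (J y)) * D y ^ m) \<le> (C0 + C2) * \<kappa>" .
      then have "\<omega> * (\<Sum>y\<in>Y. real (card (J y)) * D y ^ m) / 2 ^ m \<le> (C0 + C2) * \<kappa> / 2 ^ m" by (rule divide_right_mono) simp
      also have "\<dots> = q * \<kappa>" by (simp add: q_def)
      finally show ?thesis using q\<kappa> by (simp add: \<omega>_def)
    qed
    finally show ?thesis by (simp add: ennreal_leI)
  qed
  have "hausdorff_pre (cc_dist V) m \<delta> (f ` K) \<le> 0" if "0 < \<delta>" for \<delta>
  proof (rule ennreal_le_epsilon)
    fix t :: real assume "0 < t"
    then show "hausdorff_pre (cc_dist V) m \<delta> (f ` K) \<le> 0 + ennreal t" using pre[OF \<open>0 < \<delta>\<close>] by simp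
  qed
  then have "hausdorff_measure (cc_dist V) m (f ` K) \<le> 0"
    unfolding hausdorff_measure_def by (intro SUP_least) simp
  then show ?thesis by (simp add: m_def)
qed

theorem theorem1p1p3:
  fixes V :: "real ^ 'n \<Rightarrow> (real ^ 'n) set"
    and k h :: nat
    and K :: "(real ^ 'm) set"
    and f :: "real ^ 'm \<Rightarrow> real ^ 'n"
  assumes "distribution_on \<infinity> UNIV k V"
    and "hoermander k V"
    and "1 < h" and "h \<le> k"
    and "h_noninvolutive h V"
    and "\<And>j. 0 < j \<Longrightarrow> j < h \<Longrightarrow> \<not> h_noninvolutive j V"
    and "h \<le> CARD('m)"
    and "compact K"
    and "lipschitz_wrt (cc_dist V) K f"
  shows "hausdorff_measure (cc_dist V) CARD('m) (f ` K) = 0"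
proof -
  obtain X where X: "\<And>i. i < k \<Longrightarrow> class_C_on \<infinity> UNIV (X i)" "spans_on UNIV k X V"
    using assms(1) unfolding distribution_on_def by blast
  have dim: "dim (V p) = k" for p using assms(1) unfolding distribution_on_def by blast
  have X1: "class_C_on 1 UNIV (X i)" if "i < k" for i using class_C_on_mono[OF X(1)[OF that]] by simp
  interpret first_order_distribution V by (rule frame_imp_first_order_distribution[OF X1 X(2) dim])
  obtain L where "cc_lipschitz_on L V K f"
    using assms(9) unfolding lipschitz_wrt_def cc_lipschitz_on_def by blast
  then have "hausdorff_measure (cc_dist V) DIM(real ^ 'm) (f ` K) = 0"
    using hausdorff_measure_lipschitz_image_eq_0[OF X1 X(2) dim assms(5) _ _ assms(8)] assms(7) by simp
  then show ?thesis by simp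
qed

end
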